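(* Let $5\le n\le 13$ and let $G$ be a connected tricyclic graph on $n$ vertices, i.e. a finite simple connected graph with $n$ vertices and $n+2$ edges. With the graphs $G^5,G^6,G^7,G^8,G^9_{(1)},G^9_{(2)},G^{10}_{(2)},G^{11}_{(2)},G^{12}_{(2)},G^{13}_{(2)}$ defined in the context: (i) if $n\in\{5,6,7,8\}$, then $ME(G)\le ME(G^n)$, with equality if and only if $G\cong G^n$; (ii) if $n=9$, then $ME(G)\le ME(G^9_{(1)})=ME(G^9_{(2)})$, with equality $ME(G)=ME(G^9_{(1)})$ if and only if $G\cong G^9_{(1)}$ or $G\cong G^9_{(2)}$; (iii) if $n\in\{10,11,12,13\}$, then $ME(G)\le ME(G^n_{(2)})$, with equality if and only if $G\cong G^n_{(2)}$.
   Context: All graphs are finite, simple, undirected. For a graph $G$ on $n$ vertices, $m(G,k)$ is the number of $k$-matchings (sets of $k$ pairwise nonadjacent, i.e. pairwise vertex-disjoint, edges), with $m(G,0)=1$. The matching polynomial is $\alpha(G,x)=\sum_{k\ge 0}(-1)^k m(G,k)x^{n-2k}$. If $\mu_1,\dots,\mu_n$ are its zeros (with multiplicity), the matching energy is $ME(G)=\sum_{i=1}^n|\mu_i|$. Notation: $C_k$ is the cycle on $k$ vertices. "Joining" two vertices means adding an edge between them. The extremal graphs: - $G^5$: $K_4$ with one edge subdivided once. - $G^6$: $K_{3,3}$ minus one edge. - $G^7$: take $K_{2,3}$ with parts $\{a,c\}$ and $\{b,d,x\}$, and add two new vertices $y_1,y_2$ and the edges of the path $b\,y_1\,y_2\,d$.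 - $G^8$: the ladder $P_2\square P_4$ ($2\times 4$ grid). - $G^9_{(1)}$: take the $2\times 3$ grid $P_2\square P_3$, let $u,v$ be the two adjacent vertices of one end rung (two adjacent vertices of degree 2), and add three new vertices $w_1,w_2,w_3$ and the edges of the path $u\,w_1\,w_2\,w_3\,v$ (the edge $uv$ is kept). - $G^9_{(2)}$: take $K_{2,3}$ with parts $\{a,c\}$ and $\{b,d,x\}$, and add four new vertices $y_1,\dots,y_4$ and the edges of the path $b\,y_1\,y_2\,y_3\,y_4\,d$. - $G^{10}_{(2)}$: the disjoint union of a $C_4$ and the $2\times 3$ grid $P_2\square P_3$, together with one edge joining a vertex of the $C_4$ to a corner (degree-2 vertex) of the grid. - $G^{11}_{(2)}$: let $B$ be the 7-vertex graph consisting of a 4-cycle and a 5-cycle sharing exactly one edge $cd$ (and no other vertices); let $b\ne d$ be the vertex of the 5-cycle, other than $d$, adjacent to $c$ on the 5-cycle. Take the disjoint union of $B$ and a $C_4$ and join $b$ to a vertex of the $C_4$. - $G^{12}_{(2)}$: take a cycle $C_4$ with two adjacent vertices $u,v$, and two further disjoint copies of $C_4$; join $u$ to a vertex of the first copy and $v$ to a vertex of the second copy. - $G^{13}_{(2)}$: take three disjoint copies of $C_4$ and one additional vertex, and join the additional vertex to exactly one vertex of each copy. *)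

theory Defs
  imports Complex_Main "HOL-Computational_Algebra.Computational_Algebra"
begin

record 'a ugraph =
  verts :: "'a set"
  edges :: "'a set set"

definition simple_graph :: "'a ugraph \<Rightarrow> bool" where
  "simple_graph G \<longleftrightarrow> finite (verts G) \<and> (\<forall>e \<in> edges G. e \<subseteq> verts G \<and> card e = 2)"

definition connected_graph :: "'a ugraph \<Rightarrow> bool" where
  "connected_graph G \<longleftrightarrow> verts G \<noteq> {} \<and>
     (\<forall>u \<in> verts G. \<forall>v \<in> verts G. (u, v) \<in> {(x, y). {x, y} \<in> edges G}\<^sup>*)"

definition tricyclic :: "'a ugraph \<Rightarrow> bool" where
  "tricyclic G \<longleftrightarrow> simple_graph G \<and> connected_graph G \<and> card (edges G) = card (verts G) + 2"

definition graph_iso :: "'a ugraph \<Rightarrow> 'b ugraph \<Rightarrow> bool" (infix "\<cong>\<^sub>G" 50) where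
  "G \<cong>\<^sub>G H \<longleftrightarrow> (\<exists>f. bij_betw f (verts G) (verts H) \<and>
     (\<forall>u \<in> verts G. \<forall>v \<in> verts G. {u, v} \<in> edges G \<longleftrightarrow> {f u, f v} \<in> edges H))"


definition matchings :: "'a ugraph \<Rightarrow> nat \<Rightarrow> 'a set set set" where
  "matchings G k = {M. M \<subseteq> edges G \<and> pairwise disjnt M \<and> card M = k}"

definition num_matchings :: "'a ugraph \<Rightarrow> nat \<Rightarrow> nat" where
  "num_matchings G k = card (matchings G k)"

(* There is no k-matching with 2k > n, so the sum over all k stops at n div 2;
   the natural-number exponent n - 2k is then never truncated. The coefficients are taken
   in the complex numbers so that the zeros, with multiplicity, are exactly n in number. *)
definition matching_poly :: "'a ugraph \<Rightarrow> complex poly" where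
  "matching_poly G =
     (\<Sum>k\<le>card (verts G) div 2.
        monom ((-1) ^ k * of_nat (num_matchings G k)) (card (verts G) - 2 * k))"

definition matching_energy :: "'a ugraph \<Rightarrow> real" where
  "matching_energy G = (\<Sum>\<mu> \<in># proots (matching_poly G). cmod \<mu>)"


fun path_edges :: "'a list \<Rightarrow> 'a set set" where
  "path_edges (x # y # zs) = insert {x, y} (path_edges (y # zs))"
| "path_edges _ = {}"

definition cycle_edges :: "'a list \<Rightarrow> 'a set set" where
  "cycle_edges xs = path_edges (xs @ [hd xs])"

(* The grid of two rows xs and ys of equal length, with rungs between equal positions. *)
definition ladder_edges :: "'a list \<Rightarrow> 'a list \<Rightarrow> 'a set set" where
  "ladder_edges xs ys =
     path_edges xs \<union> path_edges ys \<union> set (map2 (\<lambda>x y. {x, y}) xs ys)"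

definition complete_edges :: "'a set \<Rightarrow> 'a set set" where
  "complete_edges A = {e. e \<subseteq> A \<and> card e = 2}"

definition complete_bipartite_edges :: "'a set \<Rightarrow> 'a set \<Rightarrow> 'a set set" where
  "complete_bipartite_edges A B = {{a, b} | a b. a \<in> A \<and> b \<in> B}"

definition G5 :: "nat ugraph" where
  "G5 = \<lparr>verts = {..<5}, edges = (complete_edges {0, 1, 2, 3} - {{0, 1}}) \<union> path_edges [0, 4, 1]\<rparr>"

definition G6 :: "nat ugraph" where
  "G6 = \<lparr>verts = {..<6}, edges = complete_bipartite_edges {0, 1, 2} {3, 4, 5} - {{0, 3}}\<rparr>"

(* a = 0, c = 1, b = 2, d = 3, x = 4; y1 = 5, y2 = 6 *)
definition G7 :: "nat ugraph" where
  "G7 = \<lparr>verts = {..<7},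
         edges = complete_bipartite_edges {0, 1} {2, 3, 4} \<union> path_edges [2, 5, 6, 3]\<rparr>"

definition G8 :: "nat ugraph" where
  "G8 = \<lparr>verts = {..<8}, edges = ladder_edges [0, 1, 2, 3] [4, 5, 6, 7]\<rparr>"

(* u = 0, v = 3; w1 = 6, w2 = 7, w3 = 8 *)
definition G9_1 :: "nat ugraph" where
  "G9_1 = \<lparr>verts = {..<9},
           edges = ladder_edges [0, 1, 2] [3, 4, 5] \<union> path_edges [0, 6, 7, 8, 3]\<rparr>"

(* a = 0, c = 1, b = 2, d = 3, x = 4; y1 = 5, ..., y4 = 8 *)
definition G9_2 :: "nat ugraph" where
  "G9_2 = \<lparr>verts = {..<9},
           edges = complete_bipartite_edges {0, 1} {2, 3, 4} \<union> path_edges [2, 5, 6, 7, 8, 3]\<rparr>"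

definition G10_2 :: "nat ugraph" where
  "G10_2 = \<lparr>verts = {..<10},
            edges = cycle_edges [0, 1, 2, 3] \<union> ladder_edges [4, 5, 6] [7, 8, 9] \<union> {{0, 4}}\<rparr>"

(* B is the union of the first two cycles, with c = 0, d = 1, b = 6 *)
definition G11_2 :: "nat ugraph" where
  "G11_2 = \<lparr>verts = {..<11},
            edges = cycle_edges [0, 1, 2, 3] \<union> cycle_edges [0, 1, 4, 5, 6]
                    \<union> cycle_edges [7, 8, 9, 10] \<union> {{6, 7}}\<rparr>"

(* u = 0, v = 1 *)
definition G12_2 :: "nat ugraph" where
  "G12_2 = \<lparr>verts = {..<12},
            edges = cycle_edges [0, 1, 2, 3] \<union> cycle_edges [4, 5, 6, 7]
                    \<union> cycle_edges [8, 9, 10, 11] \<union> {{0, 4}, {1, 8}}\<rparr>"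

definition G13_2 :: "nat ugraph" where
  "G13_2 = \<lparr>verts = {..<13},
            edges = cycle_edges [0, 1, 2, 3] \<union> cycle_edges [4, 5, 6, 7]
                    \<union> cycle_edges [8, 9, 10, 11] \<union> {{12, 0}, {12, 4}, {12, 8}}\<rparr>"

end

theory Submission
  imports Defs "HOL-Analysis.Analysis" "HOL-Real_Asymp.Real_Asymp"
begin

text \<open>Write \<open>m_k\<close> for the number of \<open>k\<close>-matchings of a graph with edge set
  \<open>E\<close>, and \<open>mgf E y\<close> for \<open>\<Sum>k. m_k y^k\<close>. The zeros
  \<open>\<mu>_i\<close> of the matching polynomial are real, by the argument of Heilmann and
  Lieb: in the upper half plane the quotient of the matching polynomials of a graph and of the
  graph without one vertex has positive imaginary part. Substituting an imaginary number into the
  factorised matching polynomial therefore gives \<open>(\<Sum>k. m_k y^k)^2 = \<Prod>i. (1 +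
  \<mu>_i^2 y)\<close> for \<open>y > 0\<close>. Since \<open>\<integral> ln(1 + \<mu>^2 s^2) /
  s^2 ds = \<pi> |\<mu>|\<close>, the energy is an increasing function of the values of \<open>mgf
  E\<close> on the positive axis: a pointwise inequality between two such functions, or between
  one of them and an explicit product of factors \<open>1 + u^2 y\<close>, gives an inequality
  between energies (\<open>matching_energy_less\<close>,
  \<open>matching_energy_le_of_prod\<close>, \<open>matching_energy_ge_of_prod\<close>).

  What remains is combinatorial. For every order \<open>n\<close> from 3 to 13 there is a short
  list \<open>bounds n\<close> of polynomials such that a tricyclic graph of order
  \<open>n\<close> is isomorphic to an extremal graph or satisfies \<open>mgf E y \<le> peval p
  y\<close> for some \<open>p\<close> in the list and all \<open>y \<ge> 0\<close>; such a graph
  is called \<open>settled\<close>. The proof is an induction on \<open>n\<close> with three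
  cases.

  If there is a leaf \<open>v\<close> with neighbour \<open>u\<close>, then \<open>mgf\<close> of
  the graph is \<open>mgf\<close> of the graph without \<open>v\<close> plus \<open>y\<close>
  times \<open>mgf\<close> of the graph without \<open>u\<close> and \<open>v\<close>. The former
  graph is tricyclic of order \<open>n - 1\<close>, the latter is contained in a tricyclic graph
  of order \<open>n - 2\<close>. If there are adjacent vertices of degree two whose other
  neighbours are distinct and not adjacent, shortening the path through them by one or by two
  vertices gives tricyclic graphs of orders \<open>n - 1\<close> and \<open>n - 2\<close> with the
  same recurrence. In both cases the bounds for the smaller orders add up to bounds for
  \<open>n\<close>. The sums are too large only for \<open>n = 7, 9, 11\<close> when one of the
  smaller graphs is extremal; then the graph is one of a few explicit extensions of that extremal
  graph, and these are examined one by one, or only a proper subgraph of the extremal graph enters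
  the recurrence, which lowers the bound.

  In the remaining graphs every vertex of degree two lies on one of very few kinds of short
  threads between vertices of degree at least three. There are at most four such branch vertices,
  so the graph is described by a short list of codes. A search through all such lists, carried out
  by rewriting, evaluates \<open>mgf\<close> for each of them (\<open>search_multi\<close>,
  \<open>search_cubic\<close>, \<open>classification\<close>).

  Finally each listed polynomial belongs to a smaller energy than that of the extremal graph: it
  is either dominated coefficientwise, or separated from it by two products of factors \<open>1 +
  u^2 y\<close> with rational \<open>u\<close> close to the true square roots
  (\<open>bounds_beaten\<close>, \<open>energy_less\<close>).\<close>

section \<open>The Coulson integral\<close>

text \<open>The integrand vanishes for \<open>s \<le> 0\<close>, so that its integral over the whole line
  may be rescaled by substitution.\<close>

definition coulson :: "real \<Rightarrow> real \<Rightarrow> real" where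
  "coulson c s = indicator {0<..} s * (ln (1 + c\<^sup>2 * s\<^sup>2) / s\<^sup>2)"

text \<open>An antiderivative of \<open>ln(1 + s^2)/s^2\<close> on the positive axis is \<open>2 arctan s -
  ln(1 + s^2)/s\<close>; it tends to 0 at 0 and to \<open>\<pi>\<close> at infinity.\<close>

lemma coulson_one: "integrable lborel (coulson 1)" "(\<integral>s. coulson 1 s \<partial>lborel) = pi"
proof -
  let ?F = "\<lambda>s::real. 2 * arctan s - ln (1 + s\<^sup>2) / s"
  let ?f = "\<lambda>s::real. ln (1 + s\<^sup>2) / s\<^sup>2"
  have pos: "0 < 1 + s\<^sup>2" for s :: real
    by (simp add: add_pos_nonneg)
  have D: "(?F has_real_derivative ?f s) (at s)" if "s > 0" for s :: real
  proof -
    have "(?F has_real_derivative 2 * inverse (1 + s\<^sup>2) - (2 * s / (1 + s\<^sup>2) * s - ln (1 + s\<^sup>2) * 1) / (s * s)) (at s)"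
      using that pos[of s] by (auto intro!: derivative_eq_intros)
    also have "2 * inverse (1 + s\<^sup>2) - (2 * s / (1 + s\<^sup>2) * s - ln (1 + s\<^sup>2) * 1) / (s * s) = ?f s"
      using that by (simp add: power2_eq_square diff_divide_distrib inverse_eq_divide)
    finally show ?thesis .
  qed
  have C: "isCont ?f s" if "s > 0" for s :: real
    using that pos[of s] by (intro continuous_intros) (auto simp: add_eq_0_iff)
  have L: "(?F \<longlongrightarrow> 0) (at_right 0)" and R: "(?F \<longlongrightarrow> pi) at_top"
    by real_asymp+
  have code_coeffs: "einterval 0 \<infinity> = {0<..}"
    by (auto simp: einterval_def zero_ereal_def)
  have L': "((?F \<circ> real_of_ereal) \<longlongrightarrow> 0) (at_right 0)"
    and R': "((?F \<circ> real_of_ereal) \<longlongrightarrow> pi) (at_left \<infinity>)"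
    unfolding zero_ereal_def ereal_tendsto_simps using L R by auto
  have "set_integrable lborel (einterval 0 \<infinity>) ?f \<and> (LBINT x=0..\<infinity>. ?f x) = pi - 0"
    by (intro conjI interval_integral_FTC_nonneg[where F = ?F and A = 0 and B = pi] L' R')
       (auto intro: D C)
  then show "integrable lborel (coulson 1)" "(\<integral>s. coulson 1 s \<partial>lborel) = pi"
    by (auto simp: set_integrable_def interval_lebesgue_integral_0_infty set_lebesgue_integral_def
        coulson_def[abs_def] code_coeffs)
qed

lemma coulson_scale: "coulson c s = c\<^sup>2 * coulson 1 (0 + \<bar>c\<bar> * s)"
  by (cases "c = 0") (auto simp: coulson_def indicator_def power_mult_distrib zero_less_mult_iff field_simps)

text \<open>Substituting \<open>|c| s\<close> for \<open>s\<close> reduces this to \<open>c = 1\<close>.\<close>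

lemma coulson_integral:
  "integrable lborel (coulson c)" "(\<integral>s. coulson c s \<partial>lborel) = pi * \<bar>c\<bar>"
proof -
  have "integrable lborel (coulson c) \<and> (\<integral>s. coulson c s \<partial>lborel) = pi * \<bar>c\<bar>"
  proof (cases "c = 0")
    case True
    then show ?thesis by (simp add: coulson_def[abs_def])
  next
    case False
    have "pi = \<bar>c\<bar> * (\<integral>s. coulson 1 (0 + \<bar>c\<bar> * s) \<partial>lborel)"
      using lborel_integral_real_affine[of "\<bar>c\<bar>" "coulson 1" 0] False coulson_one by simp
    moreover have "integrable lborel (\<lambda>s. coulson 1 (0 + \<bar>c\<bar> * s))"
      using lborel_integrable_real_affine[OF coulson_one(1), of "\<bar>c\<bar>" 0] False by simp
    ultimately show ?thesis
      unfolding coulson_scale[of c, abs_def] power2_abs[of c, symmetric]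
      by (simp add: power2_eq_square del: abs_mult_self_eq)
  qed
  then show "integrable lborel (coulson c)" "(\<integral>s. coulson c s \<partial>lborel) = pi * \<bar>c\<bar>" by auto
qed

text \<open>The logarithm turns the product into a sum of the integrands above.\<close>

lemma coulson_sum_mset:
  fixes A :: "real multiset"
  defines "P \<equiv> \<lambda>y. \<Prod>u\<in>#A. 1 + u\<^sup>2 * y"
  shows "integrable lborel (\<lambda>s. indicator {0<..} s * (ln (P (s\<^sup>2)) / s\<^sup>2))" (is ?i)
    and "(\<integral>s. indicator {0<..} s * (ln (P (s\<^sup>2)) / s\<^sup>2) \<partial>lborel) = pi * (\<Sum>u\<in>#A. \<bar>u\<bar>)" (is ?v)
    and "0 \<le> y \<Longrightarrow> 0 < P y"
proof -
  have pos: "0 < (\<Prod>u\<in>#A. 1 + u\<^sup>2 * y)" if "0 \<le> y" for A :: "real multiset" and y :: real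
    using that by (induction A) (auto intro!: mult_pos_pos add_pos_nonneg)
  then show "0 \<le> y \<Longrightarrow> 0 < P y" by (simp add: P_def)
  have eq: "indicator {0<..} s * (ln (\<Prod>u\<in>#A. 1 + u\<^sup>2 * s\<^sup>2) / s\<^sup>2) = (\<Sum>u\<in>#A. coulson u s)"
    for s and A :: "real multiset"
  proof (induction A)
    case (add u A)
    have "0 < 1 + u\<^sup>2 * s\<^sup>2" by (simp add: add_pos_nonneg)
    then have "ln ((1 + u\<^sup>2 * s\<^sup>2) * (\<Prod>u\<in>#A. 1 + u\<^sup>2 * s\<^sup>2)) =
        ln (1 + u\<^sup>2 * s\<^sup>2) + ln (\<Prod>u\<in>#A. 1 + u\<^sup>2 * s\<^sup>2)"
      using pos[of "s\<^sup>2" A] by (intro ln_mult_pos) auto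
    with add show ?case
      by (simp add: coulson_def add_divide_distrib ring_distribs)
  qed simp
  have "integrable lborel (\<lambda>s. \<Sum>u\<in>#A. coulson u s) \<and>
      (\<integral>s. (\<Sum>u\<in>#A. coulson u s) \<partial>lborel) = pi * (\<Sum>u\<in>#A. \<bar>u\<bar>)"
    by (induction A) (auto simp: coulson_integral algebra_simps)
  then show ?i ?v unfolding P_def eq by blast+
qed

lemma sum_abs_le_of_prod_le:
  fixes A B :: "real multiset"
  assumes "\<And>y. 0 < y \<Longrightarrow> (\<Prod>u\<in>#A. 1 + u\<^sup>2 * y) \<le> (\<Prod>u\<in>#B. 1 + u\<^sup>2 * y)"
  shows "(\<Sum>u\<in>#A. \<bar>u\<bar>) \<le> (\<Sum>u\<in>#B. \<bar>u\<bar>)"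
proof -
  have "pi * (\<Sum>u\<in>#A. \<bar>u\<bar>) \<le> pi * (\<Sum>u\<in>#B. \<bar>u\<bar>)"
    unfolding coulson_sum_mset(2)[symmetric]
    by (intro integral_mono coulson_sum_mset(1))
       (auto simp: indicator_def divide_simps intro!: assms ln_mono coulson_sum_mset(3))
  then show ?thesis by simp
qed

text \<open>If the sums were equal, the nonnegative difference of the two integrands would have integral
  zero and hence vanish almost everywhere, although it is positive on the whole positive axis.\<close>

lemma sum_abs_less_of_prod_less:
  fixes A B :: "real multiset"
  assumes *: "\<And>y. 0 < y \<Longrightarrow> (\<Prod>u\<in>#A. 1 + u\<^sup>2 * y) < (\<Prod>u\<in>#B. 1 + u\<^sup>2 * y)"
  shows "(\<Sum>u\<in>#A. \<bar>u\<bar>) < (\<Sum>u\<in>#B. \<bar>u\<bar>)"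
proof -
  let ?f = "\<lambda>A s::real. indicator {0<..} s * (ln (\<Prod>u\<in>#A. 1 + u\<^sup>2 * s\<^sup>2) / s\<^sup>2)"
  have le: "(\<Sum>u\<in>#A. \<bar>u\<bar>) \<le> (\<Sum>u\<in>#B. \<bar>u\<bar>)"
    using assms by (intro sum_abs_le_of_prod_le) (simp add: less_imp_le)
  have pos: "0 < ?f B s - ?f A s" if "s > 0" for s
    using that *[of "s\<^sup>2"] coulson_sum_mset(3)[of "s\<^sup>2" A]
    by (simp add: indicator_def divide_strict_right_mono)
  have "(\<Sum>u\<in>#A. \<bar>u\<bar>) \<noteq> (\<Sum>u\<in>#B. \<bar>u\<bar>)"
  proof
    assume eq: "(\<Sum>u\<in>#A. \<bar>u\<bar>) = (\<Sum>u\<in>#B. \<bar>u\<bar>)"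
    have i: "integrable lborel (\<lambda>s. ?f B s - ?f A s)"
      by (intro Bochner_Integration.integrable_diff coulson_sum_mset(1))
    have "(\<integral>s. ?f B s - ?f A s \<partial>lborel) = 0"
      by (subst Bochner_Integration.integral_diff[OF coulson_sum_mset(1) coulson_sum_mset(1)])
         (simp only: coulson_sum_mset(2) eq diff_self)
    moreover have "0 \<le> ?f B s - ?f A s" for s
      using pos[of s] by (cases "s > 0") auto
    ultimately have "AE s in lborel. ?f B s - ?f A s = 0"
      using integral_nonneg_eq_0_iff_AE[OF i] by simp
    then have "AE s in lborel. s \<notin> {0::real<..<1}"
      by eventually_elim (use pos in force)
    then have "emeasure lborel {0::real<..<1} = 0"
      by (subst (asm) AE_iff_measurable[where N = "{0<..<1}"]) auto
    then show False by simp
  qed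
  with le show ?thesis by simp
qed

section \<open>The matching generating function\<close>

text \<open>The coefficient type is left open: real arguments serve for comparisons, complex ones for the
  zeros of the matching polynomial.\<close>

definition mgf :: "'a set set \<Rightarrow> 'b::comm_semiring_1 \<Rightarrow> 'b" where
  "mgf E y = (\<Sum>M | M \<subseteq> E \<and> pairwise disjnt M. y ^ card M)"

definition avoid :: "'a set set \<Rightarrow> 'a set \<Rightarrow> 'a set set" where
  "avoid E U = {e \<in> E. disjnt e U}"

lemma finite_avoid [simp]: "finite E \<Longrightarrow> finite (avoid E U)"
  by (simp add: avoid_def)

lemma avoid_subset: "avoid E U \<subseteq> E"
  by (auto simp: avoid_def)

lemma avoid_empty [simp]: "avoid E {} = E" "avoid {} U = {}"
  by (auto simp: avoid_def)

lemma avoid_avoid [simp]: "avoid (avoid E U) W = avoid E (U \<union> W)"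
  by (auto simp: avoid_def disjnt_def)

lemma avoid_insert: "avoid (insert e E) U = (if disjnt e U then insert e (avoid E U) else avoid E U)"
  by (auto simp: avoid_def)

lemma mgf_empty [simp]: "mgf ({} :: 'a set set) y = 1"
proof -
  have "{M::'a set set. M \<subseteq> {} \<and> pairwise disjnt M} = {{}}" by auto
  then show ?thesis unfolding mgf_def by (simp del: subset_empty)
qed

text \<open>A matching of the larger edge set either avoids \<open>e\<close>, or consists of
  \<open>e\<close> and a matching of the edges disjoint from \<open>e\<close>.\<close>

lemma mgf_insert:
  assumes "finite E" "e \<notin> E"
  shows "mgf (insert e E) y = mgf E y + y * mgf (avoid E e) y"
proof -
  let ?A = "{M. M \<subseteq> E \<and> pairwise disjnt M}"
  let ?B = "{M. M \<subseteq> avoid E e \<and> pairwise disjnt M}"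
  have fin: "finite ?A" "finite ?B"
    by (rule finite_subset[of _ "Pow E"], use assms in \<open>auto simp: avoid_def\<close>)+
  have "{M. M \<subseteq> insert e E \<and> pairwise disjnt M} = ?A \<union> insert e ` ?B" (is "?L = ?R")
  proof (intro equalityI subsetI)
    fix M assume M: "M \<in> ?L"
    show "M \<in> ?R"
    proof (cases "e \<in> M")
      case True
      then have "M - {e} \<in> ?B" "M = insert e (M - {e})"
        using M by (auto simp: pairwise_def avoid_def)
      then show ?thesis by blast
    qed (use M in auto)
  next
    fix M assume "M \<in> ?R"
    then consider "M \<in> ?A" | N where "N \<in> ?B" "M = insert e N" by blast
    then show "M \<in> ?L"
      by cases (auto simp: avoid_def pairwise_insert intro: disjnt_sym)
  qed
  moreover have "?A \<inter> insert e ` ?B = {}" using assms by auto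
  moreover have "inj_on (insert e) ?B"
    using assms by (auto simp: inj_on_def avoid_def)
  moreover have "y ^ card (insert e M) = y * y ^ card M" if "M \<in> ?B" for M
  proof -
    have "finite M" "e \<notin> M"
      using that assms by (auto simp: avoid_def intro: finite_subset)
    then show ?thesis by simp
  qed
  ultimately show ?thesis
    unfolding mgf_def using fin
    by (simp add: sum.union_disjoint sum.reindex sum_distrib_left)
qed

lemma mgf_mono:
  fixes y :: real
  assumes "E \<subseteq> F" "finite F" "0 \<le> y"
  shows "mgf E y \<le> mgf F y"
  unfolding mgf_def using assms by (intro sum_mono2) (auto intro: finite_subset[of _ "Pow F"])

lemma mgf_pos:
  fixes y :: real
  assumes "finite E" "0 \<le> y"
  shows "1 \<le> mgf E y"
  using mgf_mono[of "{}" E y] assms by simp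

text \<open>Matchings only see which edges meet, so an injective renaming of the vertices changes nothing.\<close>

lemma mgf_image:
  assumes f: "inj_on f (\<Union>E)"
  shows "mgf ((`) f ` E) y = mgf E y"
proof -
  have inj: "inj_on ((`) f) E"
    using f by (meson Pow_iff Union_upper inj_on_image_Pow inj_on_subset subsetI)
  have disj: "disjnt (f ` a) (f ` b) \<longleftrightarrow> disjnt a b" if "a \<in> E" "b \<in> E" for a b
    using that f unfolding disjnt_def inj_on_def by blast
  have "{M. M \<subseteq> (`) f ` E \<and> pairwise disjnt M} = (`) ((`) f) ` {M. M \<subseteq> E \<and> pairwise disjnt M}"
    (is "?L = ?R")
  proof (intro equalityI subsetI)
    fix M assume M: "M \<in> ?L"
    then obtain N where N: "N \<subseteq> E" "M = (`) f ` N" by (auto simp: subset_image_iff)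
    have "pairwise disjnt N"
      unfolding pairwise_def
    proof (intro ballI impI)
      fix a b assume ab: "a \<in> N" "b \<in> N" "a \<noteq> b"
      then have "f ` a \<noteq> f ` b" using inj N(1) by (auto dest: inj_onD)
      then have "disjnt (f ` a) (f ` b)"
        using M N ab by (auto simp: pairwise_def)
      then show "disjnt a b" using disj N(1) ab by blast
    qed
    with N show "M \<in> ?R" by blast
  next
    fix M assume "M \<in> ?R"
    then obtain N where "N \<subseteq> E" "pairwise disjnt N" "M = (`) f ` N" by auto
    then show "M \<in> ?L"
      using disj unfolding pairwise_def by (smt (verit, best) image_iff mem_Collect_eq subset_iff)
  qed
  moreover have "inj_on ((`) ((`) f)) {M. M \<subseteq> E \<and> pairwise disjnt M}"
    by (rule inj_on_subset[OF inj_on_image_Pow[OF inj]]) auto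
  moreover have "card ((`) f ` M) = card M" if "M \<subseteq> E" for M
    using that inj by (intro card_image) (rule inj_on_subset)
  ultimately show ?thesis
    unfolding mgf_def by (simp add: sum.reindex)
qed

text \<open>The vertex recurrence: a matching covers \<open>v\<close> by at most one of its edges. It
  follows by inserting the edges at \<open>v\<close> one after the other, since the edges inserted
  earlier all meet the new one in \<open>v\<close>.\<close>

lemma mgf_star:
  fixes v :: 'a and y :: "'b::comm_semiring_1"
  assumes "finite N" "finite R" "\<And>e. e \<in> R \<Longrightarrow> v \<notin> e"
  shows "mgf (R \<union> (\<lambda>u. {v, u}) ` N) y = mgf R y + y * (\<Sum>u\<in>N. mgf (avoid R {u}) y)"
  using assms(1)
proof (induction N)
  case (insert u N)
  have av: "avoid (R \<union> (\<lambda>u. {v, u}) ` N) {v, u} = avoid R {u}"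
    using assms(3) by (auto simp: avoid_def)
  have "{v, u} \<notin> R \<union> (\<lambda>u. {v, u}) ` N"
    using insert assms(3) by (auto simp: doubleton_eq_iff)
  then have "mgf (insert {v, u} (R \<union> (\<lambda>u. {v, u}) ` N)) y
      = mgf R y + y * (\<Sum>u\<in>N. mgf (avoid R {u}) y) + y * mgf (avoid R {u}) y"
    using insert assms(2) by (simp add: mgf_insert av)
  with insert show ?case by (simp add: algebra_simps)
qed simp

section \<open>Reality of the zeros\<close>

text \<open>This is the matching polynomial \<open>\<Sum>k. (-1)^k m_k x^(n - 2k)\<close> at an argument
  \<open>x \<noteq> 0\<close>, written through \<open>mgf\<close>.\<close>

definition mpol :: "'a set \<Rightarrow> 'a set set \<Rightarrow> complex \<Rightarrow> complex" where
  "mpol V E x = x ^ card V * mgf E (- inverse (x\<^sup>2))"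

definition induced :: "'a set set \<Rightarrow> 'a set \<Rightarrow> 'a set set" where
  "induced E V = {e \<in> E. e \<subseteq> V}"

lemma mpol_vertex_rec:
  assumes "finite V" "v \<in> V" "finite E" "\<And>e. e \<in> E \<Longrightarrow> card e = 2" "x \<noteq> 0"
  shows "mpol V (induced E V) x = x * mpol (V - {v}) (induced E (V - {v})) x
    - (\<Sum>u | u \<in> V - {v} \<and> {v, u} \<in> E. mpol (V - {v} - {u}) (induced E (V - {v} - {u})) x)"
proof -
  let ?N = "{u. u \<in> V - {v} \<and> {v, u} \<in> E}"
  let ?R = "induced E (V - {v})"
  let ?y = "- inverse (x\<^sup>2)"
  have split: "induced E V = ?R \<union> (\<lambda>u. {v, u}) ` ?N"
  proof (intro equalityI subsetI)
    fix e assume e: "e \<in> induced E V"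
    show "e \<in> ?R \<union> (\<lambda>u. {v, u}) ` ?N"
    proof (cases "v \<in> e")
      case True
      obtain a b where "e = {a, b}" "a \<noteq> b"
        using assms(4)[of e] e by (auto simp: induced_def card_2_iff)
      with True e show ?thesis by (auto simp: induced_def insert_commute)
    qed (use e in \<open>auto simp: induced_def\<close>)
  qed (use assms(2) in \<open>auto simp: induced_def\<close>)
  have av: "avoid ?R {u} = induced E (V - {v} - {u})" for u
    by (auto simp: avoid_def induced_def)
  have "mpol V (induced E V) x = x ^ card V * mgf ?R ?y
      + (\<Sum>u\<in>?N. x ^ card V * ?y * mgf (induced E (V - {v} - {u})) ?y)"
    unfolding mpol_def split using assms(1,3)
    by (subst mgf_star) (auto simp: induced_def algebra_simps sum_distrib_left av[unfolded induced_def])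
  also have "x ^ card V * mgf ?R ?y = x * mpol (V - {v}) ?R x"
    using assms(1,2) unfolding mpol_def by (subst card.remove[of V v]) auto
  also have "(\<Sum>u\<in>?N. x ^ card V * ?y * mgf (induced E (V - {v} - {u})) ?y)
      = - (\<Sum>u\<in>?N. mpol (V - {v} - {u}) (induced E (V - {v} - {u})) x)"
    unfolding sum_negf[symmetric]
  proof (intro sum.cong refl)
    fix u assume u: "u \<in> ?N"
    have "card V = Suc (Suc (card (V - {v} - {u})))"
      using u assms(1,2) by (metis (no_types, lifting) card.remove finite_Diff mem_Collect_eq)
    then show "x ^ card V * ?y * mgf (induced E (V - {v} - {u})) ?y
        = - mpol (V - {v} - {u}) (induced E (V - {v} - {u})) x"
      using assms(5) by (simp add: mpol_def power2_eq_square field_simps)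
  qed
  finally show ?thesis by simp
qed

text \<open>The argument of Heilmann and Lieb. Dividing the vertex recurrence by the polynomial of the graph
  without \<open>v\<close> gives \<open>x\<close> minus a sum of reciprocals of quotients of the
  same kind for smaller graphs. By induction these quotients have positive imaginary part, their
  reciprocals have negative imaginary part, and so the imaginary part of the new quotient is at
  least that of \<open>x\<close>.\<close>

lemma mpol_upper_half_plane:
  assumes "finite V" "finite E" "\<And>e. e \<in> E \<Longrightarrow> card e = 2" "0 < Im x"
  shows "mpol V (induced E V) x \<noteq> 0 \<and>
    (\<forall>v\<in>V. 0 < Im (mpol V (induced E V) x / mpol (V - {v}) (induced E (V - {v})) x))"
  using assms(1)
proof (induction "card V" arbitrary: V)
  case 0
  then have "V = {}" by simp
  moreover have "induced E {} = {}" using assms(3) by (force simp: induced_def)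
  ultimately show ?case by (simp add: mpol_def)
next
  case (Suc m)
  let ?p = "\<lambda>V. mpol V (induced E V) x"
  have x: "x \<noteq> 0" using assms(4) by auto
  have pos: "0 < Im (?p V / ?p (V - {v}))" if v: "v \<in> V" for v
  proof -
    let ?W = "V - {v}"
    have IH: "?p ?W \<noteq> 0" "\<And>u. u \<in> ?W \<Longrightarrow> 0 < Im (?p ?W / ?p (?W - {u}))"
      using Suc(1)[of ?W] Suc(2,3) v by auto
    have "?p V / ?p ?W = x - (\<Sum>u | u \<in> ?W \<and> {v, u} \<in> E. ?p (?W - {u}) / ?p ?W)"
      using mpol_vertex_rec[OF Suc(3) v assms(2,3) x] IH(1)
      by (simp add: diff_divide_distrib sum_divide_distrib)
    moreover have "Im (?p (?W - {u}) / ?p ?W) \<le> 0" if "u \<in> ?W" for u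
    proof -
      \<comment> \<open>Reciprocals of points of the upper half plane lie in the lower one.\<close>
      have "Im (inverse z) \<le> 0" if "0 < Im z" for z
        using that by (simp add: divide_nonpos_nonneg)
      from this[OF IH(2)[OF that]] show ?thesis
        by (simp only: inverse_divide)
    qed
    moreover have "Im (\<Sum>u | u \<in> ?W \<and> {v, u} \<in> E. ?p (?W - {u}) / ?p ?W) \<le> 0"
      using calculation(2) unfolding Im_sum by (intro sum_nonpos) auto
    ultimately show ?thesis using assms(4) by simp
  qed
  obtain v where v: "v \<in> V" using Suc(2) by (metis card.empty ex_in_conv nat.simps(3))
  have "?p V \<noteq> 0" using pos[OF v] by auto
  with pos show ?case by blast
qed

lemma cnj_mgf: "cnj (mgf E y) = mgf E (cnj y)"
  by (simp add: mgf_def)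

lemma mpol_nonreal:
  assumes "finite V" "finite E" "\<And>e. e \<in> E \<Longrightarrow> e \<subseteq> V \<and> card e = 2" "Im x \<noteq> 0"
  shows "mpol V E x \<noteq> 0"
proof -
  have E: "induced E V = E" using assms(3) by (auto simp: induced_def)
  consider "0 < Im x" | "0 < Im (cnj x)" using assms(4) by fastforce
  then show ?thesis
  proof cases
    case 1
    then show ?thesis using mpol_upper_half_plane[of V E x] assms E by auto
  next
    case 2
    then have "mpol V E (cnj x) \<noteq> 0" using mpol_upper_half_plane[of V E "cnj x"] assms E by auto
    moreover have "mpol V E (cnj x) = cnj (mpol V E x)"
      by (simp add: mpol_def cnj_mgf)
    ultimately show ?thesis by auto
  qed
qed

section \<open>From generating functions to energies\<close>

lemma matching_card_le:
  assumes "finite V" "\<And>e. e \<in> E \<Longrightarrow> e \<subseteq> V \<and> card e = 2" "M \<subseteq> E" "pairwise disjnt M"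
  shows "2 * card M \<le> card V"
proof -
  have fin: "finite e" if "e \<in> M" for e
    using that assms(2,3) by (metis card.infinite subsetD zero_neq_numeral)
  have "card (\<Union>M) = (\<Sum>e\<in>M. card e)"
    using assms(4) fin by (intro card_Union_disjoint) auto
  also have "\<dots> = (\<Sum>e\<in>M. 2)"
    using assms(2,3) by (intro sum.cong) auto
  finally have "card (\<Union>M) = 2 * card M" by simp
  moreover have "card (\<Union>M) \<le> card V"
    using assms(1-3) by (intro card_mono) auto
  ultimately show ?thesis by simp
qed

lemma simple_graphD:
  assumes "simple_graph G"
  shows "finite (verts G)" "finite (edges G)" "e \<in> edges G \<Longrightarrow> e \<subseteq> verts G" "e \<in> edges G \<Longrightarrow> card e = 2"
  using assms finite_subset[of "edges G" "Pow (verts G)"] by (auto simp: simple_graph_def)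

lemma mgf_eq_sum_num_matchings:
  assumes "simple_graph G"
  shows "mgf (edges G) y = (\<Sum>k\<le>card (verts G) div 2. of_nat (num_matchings G k) * y ^ k)"
proof -
  note G = simple_graphD[OF assms]
  let ?S = "{M. M \<subseteq> edges G \<and> pairwise disjnt M}"
  have fin: "finite ?S" by (rule finite_subset[of _ "Pow (edges G)"]) (use G(2) in auto)
  have "mgf (edges G) y = (\<Sum>k\<le>card (verts G) div 2. \<Sum>M | M \<in> ?S \<and> card M = k. y ^ card M)"
    unfolding mgf_def
  proof (intro sum.group[symmetric] fin finite_atMost image_subsetI)
    fix M assume "M \<in> ?S"
    then have "2 * card M \<le> card (verts G)"
      using matching_card_le[of "verts G" "edges G" M] G by auto
    then show "card M \<in> {..card (verts G) div 2}" by simp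
  qed
  also have "\<dots> = (\<Sum>k\<le>card (verts G) div 2. of_nat (num_matchings G k) * y ^ k)"
  proof (intro sum.cong refl)
    fix k
    have "{M \<in> ?S. card M = k} = matchings G k"
      by (auto simp: matchings_def)
    moreover have "(\<Sum>M\<in>matchings G k. y ^ card M) = (\<Sum>M\<in>matchings G k. y ^ k)"
      by (intro sum.cong) (auto simp: matchings_def)
    ultimately show "(\<Sum>M | M \<in> ?S \<and> card M = k. y ^ card M) = of_nat (num_matchings G k) * y ^ k"
      by (simp add: num_matchings_def)
  qed
  finally show ?thesis .
qed

lemma poly_matching_poly:
  assumes "simple_graph G" "x \<noteq> 0"
  shows "poly (matching_poly G) x = mpol (verts G) (edges G) x"
proof -
  let ?n = "card (verts G)"
  have "poly (matching_poly G) x = (\<Sum>k\<le>?n div 2. (-1) ^ k * of_nat (num_matchings G k) * x ^ (?n - 2 * k))"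
    by (simp add: matching_poly_def poly_sum poly_monom)
  also have "\<dots> = (\<Sum>k\<le>?n div 2. x ^ ?n * (of_nat (num_matchings G k) * (- inverse (x\<^sup>2)) ^ k))"
  proof (intro sum.cong refl)
    fix k assume "k \<in> {..?n div 2}"
    then have "x ^ ?n = x ^ (?n - 2 * k) * (x\<^sup>2) ^ k"
      by (simp flip: power_add power_mult)
    moreover have "(x\<^sup>2) ^ k * (- inverse (x\<^sup>2)) ^ k = (-1) ^ k"
      using assms(2) by (simp flip: power_mult_distrib)
    ultimately show "(-1) ^ k * of_nat (num_matchings G k) * x ^ (?n - 2 * k)
        = x ^ ?n * (of_nat (num_matchings G k) * (- inverse (x\<^sup>2)) ^ k)"
      by (simp add: ac_simps)
  qed
  also have "\<dots> = mpol (verts G) (edges G) x"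
    by (simp add: mpol_def mgf_eq_sum_num_matchings[OF assms(1)] sum_distrib_left)
  finally show ?thesis .
qed

lemma matching_poly_monic:
  assumes "simple_graph G"
  shows "degree (matching_poly G) = card (verts G)" "lead_coeff (matching_poly G) = 1"
proof -
  let ?n = "card (verts G)"
  have "matchings G 0 = {{}}"
    using simple_graphD(2)[OF assms] by (auto simp: matchings_def dest: finite_subset)
  then have "num_matchings G 0 = 1" by (simp add: num_matchings_def)
  have "coeff (matching_poly G) ?n = (\<Sum>k\<le>?n div 2. if k = 0 then 1 else 0)"
    unfolding matching_poly_def coeff_sum coeff_monom
    by (intro sum.cong) (auto simp: \<open>num_matchings G 0 = 1\<close>)
  then have 1: "coeff (matching_poly G) ?n = 1" by simp
  have "degree (matching_poly G) \<le> ?n"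
    unfolding matching_poly_def
    by (intro degree_sum_le) (auto intro: order_trans[OF degree_monom_le])
  moreover have "?n \<le> degree (matching_poly G)" using 1 by (intro le_degree) simp
  ultimately show "degree (matching_poly G) = ?n" by simp
  with 1 show "lead_coeff (matching_poly G) = 1" by simp
qed

lemma matching_roots_real:
  assumes "simple_graph G" "\<mu> \<in># proots (matching_poly G)"
  shows "Im \<mu> = 0"
proof (rule ccontr)
  assume im: "Im \<mu> \<noteq> 0"
  have "matching_poly G \<noteq> 0" using matching_poly_monic(2)[OF assms(1)] by auto
  then have "poly (matching_poly G) \<mu> = 0" using assms(2) by simp
  moreover have "\<mu> \<noteq> 0" using im by auto
  ultimately show False
    using mpol_nonreal[of "verts G" "edges G" \<mu>] im simple_graphD[OF assms(1)]
    by (simp add: poly_matching_poly[OF assms(1)])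
qed

definition real_roots :: "'a ugraph \<Rightarrow> real multiset" where
  "real_roots G = image_mset Re (proots (matching_poly G))"

lemma matching_energy_eq:
  assumes "simple_graph G"
  shows "matching_energy G = (\<Sum>u\<in>#real_roots G. \<bar>u\<bar>)"
  unfolding matching_energy_def real_roots_def image_mset.compositionality comp_def
  using matching_roots_real[OF assms]
  by (intro arg_cong[where f = sum_mset] image_mset_cong) (simp add: cmod_eq_Re)

text \<open>With \<open>z = 1/x\<close> the factorisation of the matching polynomial reads \<open>\<Sum>k.
  m_k (-z^2)^k = \<Prod>i. (1 - \<mu>_i z)\<close>. The product of the instances \<open>z = i sqrt
  y\<close> and \<open>z = -i sqrt y\<close> has the square on its left-hand side, and pairs of
  conjugate factors, equal to \<open>1 + \<mu>_i^2 y\<close>, on its right-hand side.\<close>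

lemma mgf_square:
  assumes "simple_graph G" "0 < y"
  shows "(mgf (edges G) y)\<^sup>2 = (\<Prod>u\<in>#real_roots G. 1 + u\<^sup>2 * y)"
proof -
  let ?P = "proots (matching_poly G)"
  have fact: "mgf (edges G) (- z\<^sup>2) = (\<Prod>\<mu>\<in>#?P. 1 - \<mu> * z)" if "z \<noteq> 0" for z :: complex
  proof -
    have "mpol (verts G) (edges G) (inverse z) = poly (\<Prod>\<mu>\<in>#?P. [:-\<mu>, 1:]) (inverse z)"
      using complex_poly_decompose_multiset[of "matching_poly G"] matching_poly_monic(2)[OF assms(1)]
        poly_matching_poly[OF assms(1), of "inverse z"] that by simp
    also have "\<dots> = (\<Prod>\<mu>\<in>#?P. inverse z - \<mu>)"
      by (simp add: poly_prod_mset image_mset.compositionality comp_def)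
    also have "\<dots> = (\<Prod>\<mu>\<in>#?P. inverse z * (1 - \<mu> * z))"
      using that by (intro arg_cong[where f = prod_mset] image_mset_cong) (simp add: field_simps)
    also have "\<dots> = inverse z ^ card (verts G) * (\<Prod>\<mu>\<in>#?P. 1 - \<mu> * z)"
      by (simp add: prod_mset.distrib size_proots_complex matching_poly_monic(1)[OF assms(1)] prod_mset_constant)
    finally show ?thesis using that by (simp add: mpol_def power_inverse)
  qed
  \<comment> \<open>With this choice the argument of the generating function in the factorisation is y.\<close>
  let ?z = "\<i> * of_real (sqrt y)"
  have z: "?z \<noteq> 0" "- ?z \<noteq> 0" "- (?z\<^sup>2) = of_real y" "- ((- ?z)\<^sup>2) = of_real y"
    using assms(2) by (auto simp: power_mult_distrib simp flip: of_real_power)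
  have "of_real ((mgf (edges G) y)\<^sup>2) = (mgf (edges G) (of_real y :: complex))\<^sup>2"
    by (simp add: mgf_def)
  also have "\<dots> = (\<Prod>\<mu>\<in>#?P. 1 - \<mu> * ?z) * (\<Prod>\<mu>\<in>#?P. 1 - \<mu> * (- ?z))"
    using fact[OF z(1)] fact[OF z(2)] unfolding z by (simp add: power2_eq_square)
  also have "\<dots> = (\<Prod>\<mu>\<in>#?P. (1 - \<mu> * ?z) * (1 - \<mu> * (- ?z)))"
    by (simp only: prod_mset.distrib)
  also have "\<dots> = (\<Prod>\<mu>\<in>#?P. of_real (1 + (Re \<mu>)\<^sup>2 * y))"
  proof (intro arg_cong[where f = prod_mset] image_mset_cong)
    fix \<mu> assume "\<mu> \<in># ?P"
    then have "\<mu> = of_real (Re \<mu>)"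
      using matching_roots_real[OF assms(1)] by (simp add: complex_eq_iff)
    then obtain r where r: "\<mu> = of_real r" by blast
    have "(1 - \<mu> * ?z) * (1 - \<mu> * (- ?z)) = 1 + \<mu>\<^sup>2 * (- (?z\<^sup>2))"
      by (simp add: algebra_simps power2_eq_square)
    then show "(1 - \<mu> * ?z) * (1 - \<mu> * (- ?z)) = of_real (1 + (Re \<mu>)\<^sup>2 * y)"
      unfolding z r by simp
  qed
  also have "\<dots> = of_real (\<Prod>u\<in>#real_roots G. 1 + u\<^sup>2 * y)"
  proof -
    have "(\<Prod>\<mu>\<in>#A. of_real (1 + (Re \<mu>)\<^sup>2 * y)) = complex_of_real (\<Prod>\<mu>\<in>#A. 1 + (Re \<mu>)\<^sup>2 * y)" for A
      by (induction A) simp_all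
    then show ?thesis
      unfolding real_roots_def image_mset.compositionality comp_def .
  qed
  finally show ?thesis by (simp only: of_real_eq_iff)
qed

lemma matching_energy_less:
  assumes "simple_graph G" "simple_graph H"
    and "\<And>y. 0 < y \<Longrightarrow> mgf (edges G) y < (mgf (edges H) y :: real)"
  shows "matching_energy G < matching_energy H"
  unfolding matching_energy_eq[OF assms(1)] matching_energy_eq[OF assms(2)]
proof (rule sum_abs_less_of_prod_less)
  fix y :: real assume y: "0 < y"
  have "1 \<le> mgf (edges G) y"
    using simple_graphD(2)[OF assms(1)] y by (intro mgf_pos) auto
  then show "(\<Prod>u\<in>#real_roots G. 1 + u\<^sup>2 * y) < (\<Prod>u\<in>#real_roots H. 1 + u\<^sup>2 * y)"
    using assms(3)[OF y] unfolding mgf_square[OF assms(1) y, symmetric] mgf_square[OF assms(2) y, symmetric]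
    by (intro power_strict_mono) auto
qed

lemma matching_energy_cong:
  assumes "simple_graph G" "simple_graph H"
    and "\<And>y. 0 < y \<Longrightarrow> mgf (edges G) y = (mgf (edges H) y :: real)"
  shows "matching_energy G = matching_energy H"
  unfolding matching_energy_eq[OF assms(1)] matching_energy_eq[OF assms(2)]
  using assms by (intro antisym sum_abs_le_of_prod_le) (simp_all flip: mgf_square)

text \<open>Doubling the multiset squares the product; this puts an explicit product into the form of the
  squared generating function.\<close>

lemma prod_list_square_mset:
  "(\<Prod>u\<leftarrow>us. 1 + u\<^sup>2 * y)\<^sup>2 = (\<Prod>u\<in>#mset us + mset us. 1 + u\<^sup>2 * (y::real))"
  by (simp add: power2_eq_square flip: mset_map prod_mset_prod_list)

lemma prod_list_ge_1:
  "0 \<le> y \<Longrightarrow> 1 \<le> (\<Prod>u\<leftarrow>us. 1 + u\<^sup>2 * (y::real))"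
proof (induction us)
  case (Cons u us)
  then have "1 * 1 \<le> (1 + u\<^sup>2 * y) * (\<Prod>u\<leftarrow>us. 1 + u\<^sup>2 * y)"
    by (intro mult_mono) auto
  then show ?case by simp
qed simp

text \<open>The factor 2 comes from the symmetry of the zeros: each \<open>u\<close> stands for the pair
  \<open>u, -u\<close>.\<close>

lemma matching_energy_le_of_prod:
  assumes "simple_graph G" and "\<And>y. 0 < y \<Longrightarrow> mgf (edges G) y \<le> (\<Prod>u\<leftarrow>us. 1 + u\<^sup>2 * y)"
  shows "matching_energy G \<le> 2 * (\<Sum>u\<leftarrow>us. \<bar>u\<bar>)"
proof -
  have "(\<Sum>u\<in>#real_roots G. \<bar>u\<bar>) \<le> (\<Sum>u\<in>#mset us + mset us. \<bar>u\<bar>)"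
  proof (rule sum_abs_le_of_prod_le)
    fix y :: real assume y: "0 < y"
    have "1 \<le> mgf (edges G) y"
      using simple_graphD(2)[OF assms(1)] y by (intro mgf_pos) auto
    then show "(\<Prod>u\<in>#real_roots G. 1 + u\<^sup>2 * y) \<le> (\<Prod>u\<in>#mset us + mset us. 1 + u\<^sup>2 * y)"
      using assms(2)[OF y] unfolding mgf_square[OF assms(1) y, symmetric] prod_list_square_mset[symmetric]
      by (intro power_mono) auto
  qed
  then show ?thesis
    by (simp add: matching_energy_eq[OF assms(1)] sum_mset_sum_list flip: mset_map)
qed

lemma matching_energy_ge_of_prod:
  assumes "simple_graph G" and "\<And>y. 0 < y \<Longrightarrow> (\<Prod>u\<leftarrow>us. 1 + u\<^sup>2 * y) \<le> mgf (edges G) y"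
  shows "2 * (\<Sum>u\<leftarrow>us. \<bar>u\<bar>) \<le> matching_energy G"
proof -
  have "(\<Sum>u\<in>#mset us + mset us. \<bar>u\<bar>) \<le> (\<Sum>u\<in>#real_roots G. \<bar>u\<bar>)"
  proof (rule sum_abs_le_of_prod_le)
    fix y :: real assume y: "0 < y"
    show "(\<Prod>u\<in>#mset us + mset us. 1 + u\<^sup>2 * y) \<le> (\<Prod>u\<in>#real_roots G. 1 + u\<^sup>2 * y)"
      using assms(2)[OF y] prod_list_ge_1[of y us] y
      unfolding mgf_square[OF assms(1) y, symmetric] prod_list_square_mset[symmetric]
      by (intro power_mono) auto
  qed
  then show ?thesis
    by (simp add: matching_energy_eq[OF assms(1)] sum_mset_sum_list flip: mset_map)
qed

section \<open>Simple graphs, isomorphisms and connectivity\<close>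

text \<open>Constructions on graphs are easier to follow on a vertex set and an edge set than on a record;
  the predicates are translated back by the lemma \<open>tricyclic_iff\<close>.\<close>

definition sgraph :: "'a set \<Rightarrow> 'a set set \<Rightarrow> bool" where
  "sgraph V E \<longleftrightarrow> finite V \<and> (\<forall>e\<in>E. e \<subseteq> V \<and> card e = 2)"

definition adj :: "'a set set \<Rightarrow> ('a \<times> 'a) set" where
  "adj E = {(x, y). {x, y} \<in> E}"

definition conn :: "'a set \<Rightarrow> 'a set set \<Rightarrow> bool" where
  "conn V E \<longleftrightarrow> V \<noteq> {} \<and> (\<forall>u\<in>V. \<forall>v\<in>V. (u, v) \<in> (adj E)\<^sup>*)"

definition tric :: "'a set \<Rightarrow> 'a set set \<Rightarrow> bool" where
  "tric V E \<longleftrightarrow> sgraph V E \<and> conn V E \<and> card E = card V + 2"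

lemma tricyclic_iff: "tricyclic G \<longleftrightarrow> tric (verts G) (edges G)"
  by (simp add: tricyclic_def tric_def simple_graph_def sgraph_def connected_graph_def conn_def adj_def)

lemma sgraphD:
  assumes "sgraph V E"
  shows "finite V" "finite E" "{u, v} \<in> E \<Longrightarrow> u \<in> V \<and> v \<in> V \<and> u \<noteq> v"
    "e \<in> E \<Longrightarrow> \<exists>u v. e = {u, v} \<and> u \<in> V \<and> v \<in> V \<and> u \<noteq> v"
proof -
  show "finite V" using assms by (simp add: sgraph_def)
  then show "finite E" using assms finite_subset[of E "Pow V"] by (auto simp: sgraph_def)
  show "u \<in> V \<and> v \<in> V \<and> u \<noteq> v" if "{u, v} \<in> E"
    using assms that by (cases "u = v") (auto simp: sgraph_def)
  show "\<exists>u v. e = {u, v} \<and> u \<in> V \<and> v \<in> V \<and> u \<noteq> v" if e: "e \<in> E"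
  proof -
    obtain u v where "e = {u, v}" "u \<noteq> v" using assms e by (auto simp: sgraph_def card_2_iff)
    moreover have "e \<subseteq> V" using assms e by (simp add: sgraph_def)
    ultimately show ?thesis by blast
  qed
qed

definition nbrs :: "'a set set \<Rightarrow> 'a \<Rightarrow> 'a set" where
  "nbrs E v = {u. {v, u} \<in> E}"

lemma finite_nb: "sgraph V E \<Longrightarrow> finite (nbrs E v)"
  by (rule finite_subset[of _ V]) (auto simp: nbrs_def sgraphD)

lemma mem_edge_nb: "sgraph V E \<Longrightarrow> e \<in> E \<Longrightarrow> x \<in> e \<Longrightarrow> \<exists>u\<in>nbrs E x. e = {x, u}"
  using sgraphD(4)[of V E e] by (auto simp: nbrs_def insert_commute)

text \<open>Edge sets are mapped as a whole, which suits \<open>mgf_image\<close>; on simple graphs this is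
  the notion of isomorphism of the theorem, by \<open>graph_iso_iff_giso\<close>.\<close>

definition giso :: "'a set \<Rightarrow> 'a set set \<Rightarrow> 'b set \<Rightarrow> 'b set set \<Rightarrow> bool" where
  "giso V E W F \<longleftrightarrow> (\<exists>f. bij_betw f V W \<and> F = (`) f ` E)"

lemma giso_sym:
  assumes "giso V E W F" "sgraph V E"
  shows "giso W F V E"
proof -
  obtain f where f: "bij_betw f V W" "F = (`) f ` E" using assms by (auto simp: giso_def)
  let ?g = "the_inv_into V f"
  have "?g ` f ` e = e" if "e \<in> E" for e
  proof -
    have "e \<subseteq> V" using that assms(2) by (auto simp: sgraph_def)
    then show ?thesis using f(1)
      by (auto simp: image_image bij_betw_def the_inv_into_f_f subset_iff)
  qed
  then have "(`) ?g ` F = E" using f(2) by (simp add: image_image)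
  then show ?thesis using bij_betw_the_inv_into[OF f(1)] unfolding giso_def by blast
qed

lemma giso_trans: "giso V E W F \<Longrightarrow> giso W F X H \<Longrightarrow> giso V E X H"
  unfolding giso_def
proof (elim exE conjE)
  fix f g assume "bij_betw f V W" "F = (`) f ` E" "bij_betw g W X" "H = (`) g ` F"
  then show "\<exists>h. bij_betw h V X \<and> H = (`) h ` E"
    by (intro exI[of _ "g \<circ> f"] conjI bij_betw_trans[of f V W g X]) (auto simp: image_image image_comp)
qed

lemma giso_mgf:
  assumes "giso V E W F" "sgraph V E"
  shows "mgf F y = mgf E y"
proof -
  obtain f where f: "bij_betw f V W" "F = (`) f ` E" using assms by (auto simp: giso_def)
  have "inj_on f (\<Union>E)"
    using f(1) assms(2) by (auto simp: bij_betw_def sgraph_def intro: inj_on_subset)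
  then show ?thesis using f(2) by (simp add: mgf_image)
qed

lemma graph_iso_iff_giso:
  assumes "simple_graph G" "simple_graph H"
  shows "G \<cong>\<^sub>G H \<longleftrightarrow> giso (verts G) (edges G) (verts H) (edges H)"
proof
  assume "G \<cong>\<^sub>G H"
  then obtain f where f: "bij_betw f (verts G) (verts H)"
    "\<And>u v. u \<in> verts G \<Longrightarrow> v \<in> verts G \<Longrightarrow> {u, v} \<in> edges G \<longleftrightarrow> {f u, f v} \<in> edges H"
    by (auto simp: graph_iso_def)
  have "edges H = (`) f ` edges G"
  proof (intro equalityI subsetI)
    fix e assume e: "e \<in> edges H"
    then obtain a b where ab: "e = {a, b}" "a \<in> verts H" "b \<in> verts H"
      using assms(2) by (force simp: simple_graph_def card_2_iff)
    then obtain u v where uv: "u \<in> verts G" "v \<in> verts G" "a = f u" "b = f v"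
      using f(1) unfolding bij_betw_def by blast
    then have "{u, v} \<in> edges G" using e ab f(2) by auto
    then show "e \<in> (`) f ` edges G" using ab uv by (auto intro!: image_eqI[of _ _ "{u, v}"])
  next
    fix e assume "e \<in> (`) f ` edges G"
    then obtain e' where e': "e' \<in> edges G" "e = f ` e'" by auto
    then obtain a b where "e' = {a, b}" "a \<in> verts G" "b \<in> verts G"
      using assms(1) by (force simp: simple_graph_def card_2_iff)
    then show "e \<in> edges H" using e' f(2) by auto
  qed
  then show "giso (verts G) (edges G) (verts H) (edges H)" using f(1) by (auto simp: giso_def)
next
  assume "giso (verts G) (edges G) (verts H) (edges H)"
  then obtain f where f: "bij_betw f (verts G) (verts H)" "edges H = (`) f ` edges G"
    by (auto simp: giso_def)
  have "{u, v} \<in> edges G" if uv: "u \<in> verts G" "v \<in> verts G" "{f u, f v} \<in> edges H" for u v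
  proof -
    obtain e where e: "e \<in> edges G" "f ` {u, v} = f ` e" using uv(3) f(2) by auto
    moreover have "e \<subseteq> verts G" using e assms(1) by (auto simp: simple_graph_def)
    ultimately have "{u, v} = e"
      using f(1) uv by (metis bij_betw_def empty_subsetI inj_on_image_eq_iff insert_subset)
    then show ?thesis using e by simp
  qed
  moreover have "{f u, f v} \<in> edges H" if "{u, v} \<in> edges G" for u v
    using imageI[OF that, of "(`) f"] f(2) by simp
  ultimately show "G \<cong>\<^sub>G H"
    unfolding graph_iso_def using f(1) by blast
qed

text \<open>A map that sends edges to walks sends walks to walks. All contractions below are connected for
  this reason.\<close>

lemma conn_map:
  assumes "conn V E" "f ` V = W" "\<And>u v. {u, v} \<in> E \<Longrightarrow> (f u, f v) \<in> (adj F)\<^sup>*"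
  shows "conn W F"
proof -
  have "(f u, f v) \<in> (adj F)\<^sup>*" if "(u, v) \<in> (adj E)\<^sup>*" for u v
    using that
  proof induction
    case (step v w)
    then show ?case using assms(3)[of v w] by (auto simp: adj_def intro: rtrancl_trans)
  qed simp
  then show ?thesis using assms(1,2) unfolding conn_def by blast
qed

lemma conn_supset:
  assumes "conn V E" "E \<subseteq> F"
  shows "conn V F"
proof -
  have "(adj E)\<^sup>* \<subseteq> (adj F)\<^sup>*"
    using assms(2) by (intro rtrancl_mono) (auto simp: adj_def)
  then show ?thesis using assms(1) unfolding conn_def by blast
qed

text \<open>Used to exclude small closed components.\<close>

lemma conn_closed_set:
  assumes "conn V E" "S \<subseteq> V" "S \<noteq> {}" "\<And>u v. {u, v} \<in> E \<Longrightarrow> u \<in> S \<Longrightarrow> v \<in> S"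
  shows "S = V"
proof -
  obtain s where s: "s \<in> S" using assms(3) by auto
  have "v \<in> S" if "(s, v) \<in> (adj E)\<^sup>*" for v
    using that by induction (use s assms(4) in \<open>auto simp: adj_def\<close>)
  then show ?thesis using assms(1,2) s unfolding conn_def by blast
qed

lemma conn_nb_nonempty:
  assumes "sgraph V E" "conn V E" "2 \<le> card V" "v \<in> V"
  shows "nbrs E v \<noteq> {}"
proof
  assume "nbrs E v = {}"
  then have "{v} = V"
    using assms by (intro conn_closed_set[OF assms(2)]) (auto simp: nbrs_def)
  then show False using assms(3) by auto
qed

section \<open>Removing a leaf\<close>

text \<open>From five vertices on there is room for the required number of edges.\<close>

lemma augment_tric:
  assumes "sgraph V E" "conn V E" "card E \<le> card V + 2" "5 \<le> card V"
  shows "\<exists>F. E \<subseteq> F \<and> tric V F"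
proof -
  let ?K = "{e. e \<subseteq> V \<and> card e = 2}"
  have fin: "finite V" using assms(1) by (simp add: sgraph_def)
  have "card V + 2 \<le> card V choose 2"
  proof -
    have "2 * (card V + 2) \<le> card V * (card V - 1)"
      using assms(4) by (auto simp: le_iff_add algebra_simps)
    then show ?thesis by (simp add: choose_two)
  qed
  then have "card V + 2 \<le> card ?K" using n_subsets[OF fin, of 2] by simp
  moreover have "E \<subseteq> ?K" using assms(1) by (auto simp: sgraph_def)
  moreover have "finite ?K" by (rule finite_subset[of _ "Pow V"]) (use fin in auto)
  ultimately obtain F where F: "E \<subseteq> F" "F \<subseteq> ?K" "card F = card V + 2"
    using assms(3) by (meson exists_subset_between)
  then have "tric V F"
    using assms(1,2) by (auto simp: tric_def sgraph_def intro: conn_supset)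
  with F show ?thesis by blast
qed

lemma adj_rtrancl: "{u, v} \<in> E \<Longrightarrow> (u, v) \<in> (adj E)\<^sup>*"
  by (auto simp: adj_def)

lemma leaf_removal:
  assumes "tric V E" "v \<in> V" "nbrs E v = {u}"
  shows "tric (V - {v}) (E - {{v, u}})"
    and "mgf E y = mgf (E - {{v, u}}) y + y * mgf (avoid E {v, u}) y"
proof -
  have G: "sgraph V E" "conn V E" "card E = card V + 2" using assms by (auto simp: tric_def)
  note fin = sgraphD(1,2)[OF G(1)]
  have e: "{v, u} \<in> E" using assms(3) by (auto simp: nbrs_def)
  then have u: "u \<in> V" "u \<noteq> v" using sgraphD(3)[OF G(1)] by blast+
  have only: "e = {v, u}" if "e \<in> E" "v \<in> e" for e
    using mem_edge_nb[OF G(1) that] assms(3) by auto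
  have "sgraph (V - {v}) (E - {{v, u}})"
    using G(1) only by (auto simp: sgraph_def)
  moreover have "conn (V - {v}) (E - {{v, u}})"
  proof (rule conn_map[OF G(2), of "\<lambda>x. if x = v then u else x"])
    show "(\<lambda>x. if x = v then u else x) ` V = V - {v}" using u by auto
    fix a b assume ab: "{a, b} \<in> E"
    consider "a = v" | "b = v" | "a \<noteq> v" "b \<noteq> v" by blast
    then show "(if a = v then u else a, if b = v then u else b) \<in> (adj (E - {{v, u}}))\<^sup>*"
    proof cases
      case 3
      then have "{a, b} \<in> E - {{v, u}}" using ab by (auto simp: doubleton_eq_iff)
      then show ?thesis using 3 by (simp add: adj_rtrancl)
    qed (use ab only[OF ab] u in \<open>auto simp: doubleton_eq_iff\<close>)
  qed
  ultimately show "tric (V - {v}) (E - {{v, u}})"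
    using fin e assms(2) G(3) card_gt_0_iff[of V] by (auto simp: tric_def card_Diff_singleton)
  have "mgf (insert {v, u} (E - {{v, u}})) y = mgf (E - {{v, u}}) y + y * mgf (avoid (E - {{v, u}}) {v, u}) y"
    using fin by (intro mgf_insert) auto
  moreover have "avoid (E - {{v, u}}) {v, u} = avoid E {v, u}" by (auto simp: avoid_def)
  ultimately show "mgf E y = mgf (E - {{v, u}}) y + y * mgf (avoid E {v, u}) y"
    using e by (simp add: insert_absorb)
qed

text \<open>Deleting both ends of a pendant edge may disconnect the graph. Contracting them into a further
  neighbour \<open>w\<close> of \<open>u\<close> instead keeps it connected and loses at least the
  two edges \<open>vu\<close> and \<open>uw\<close>; missing edges are then added.\<close>

lemma leaf_contraction:
  assumes "tric V E" "v \<in> V" "nbrs E v = {u}" "7 \<le> card V"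
  shows "\<exists>F. avoid E {v, u} \<subseteq> F \<and> tric (V - {v, u}) F"
proof -
  have G: "sgraph V E" "conn V E" "card E = card V + 2" using assms by (auto simp: tric_def)
  note fin = sgraphD(1,2)[OF G(1)]
  have e: "{v, u} \<in> E" using assms(3) by (auto simp: nbrs_def)
  then have u: "u \<in> V" "u \<noteq> v" using sgraphD(3)[OF G(1)] by blast+
  have only: "e = {v, u}" if "e \<in> E" "v \<in> e" for e
    using mem_edge_nb[OF G(1) that] assms(3) by auto
  have "\<exists>w. {u, w} \<in> E \<and> w \<noteq> v"
  proof (rule ccontr)
    assume no: "\<not> ?thesis"
    have "{v, u} = V"
    proof (rule conn_closed_set[OF G(2)])
      fix a b assume "{a, b} \<in> E" "a \<in> {v, u}"
      then show "b \<in> {v, u}" using only[of "{a, b}"] no by (auto simp: doubleton_eq_iff)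
    qed (use u assms(2) in auto)
    then have "card V \<le> 2" using card_insert_le_m1[of 2 "{u}" v] by auto
    then show False using assms(4) by simp
  qed
  then obtain w where w: "{u, w} \<in> E" "w \<noteq> v" by blast
  then have w': "w \<in> V" "w \<noteq> u" using sgraphD(3)[OF G(1)] by blast+
  \<comment> \<open>Both ends of the pendant edge are sent to w; the edges vu and uw collapse and are left out.\<close>
  define f where "f x = (if x = v \<or> x = u then w else x)" for x
  define F where "F = (`) f ` (E - {{v, u}, {u, w}})"
  have ne: "{v, u} \<noteq> {u, w}" using w w' u by (auto simp: doubleton_eq_iff)
  have "sgraph (V - {v, u}) F"
    unfolding sgraph_def
  proof (intro conjI ballI)
    fix e' assume "e' \<in> F"
    then obtain e where e: "e \<in> E" "e \<noteq> {v, u}" "e \<noteq> {u, w}" "e' = f ` e" by (auto simp: F_def)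
    obtain a b where ab: "e = {a, b}" "a \<in> V" "b \<in> V" "a \<noteq> b" using sgraphD(4)[OF G(1) e(1)] by blast
    have "v \<notin> e" using only e by blast
    then have "f a \<noteq> f b" using ab e by (auto simp: f_def insert_commute)
    then show "card e' = 2" using e ab by simp
    show "e' \<subseteq> V - {v, u}" using e ab w w' by (auto simp: f_def)
  qed (use fin in auto)
  moreover have "conn (V - {v, u}) F"
  proof (rule conn_map[OF G(2), of f])
    show "f ` V = V - {v, u}" using w w' by (auto simp: f_def)
    fix a b assume ab: "{a, b} \<in> E"
    show "(f a, f b) \<in> (adj F)\<^sup>*"
    proof (cases "{a, b} = {v, u} \<or> {a, b} = {u, w}")
      case True
      then show ?thesis by (auto simp: doubleton_eq_iff f_def)
    next
      case False
      then have "f ` {a, b} \<in> F" using ab unfolding F_def by blast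
      then show ?thesis by (intro adj_rtrancl) auto
    qed
  qed
  moreover have "card F \<le> card (V - {v, u}) + 2"
  proof -
    have "card F \<le> card (E - {{v, u}, {u, w}})" unfolding F_def by (rule card_image_le) (use fin in auto)
    also have "\<dots> = card V" using G(3) e w ne fin by (subst card_Diff_subset) auto
    also have "\<dots> = card (V - {v, u}) + 2"
      using u assms(2,4) fin by (subst card_Diff_subset) auto
    finally show ?thesis .
  qed
  moreover have "5 \<le> card (V - {v, u})"
    using u assms(2,4) fin by (subst card_Diff_subset) auto
  moreover have "avoid E {v, u} \<subseteq> F"
  proof
    fix e' assume e': "e' \<in> avoid E {v, u}"
    then have "f ` e' = id ` e'" by (intro image_cong) (auto simp: avoid_def f_def disjnt_def)
    moreover have "e' \<in> E - {{v, u}, {u, w}}" using e' by (auto simp: avoid_def)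
    ultimately show "e' \<in> F" unfolding F_def by (metis id_apply image_eqI image_id)
  qed
  ultimately show ?thesis using augment_tric[of "V - {v, u}" F] by blast
qed

section \<open>Threads\<close>

lemma avoid_fresh: "(\<And>e. e \<in> R \<Longrightarrow> x \<notin> e) \<Longrightarrow> avoid R (insert x U) = avoid R U"
  by (auto simp: avoid_def)

text \<open>The lemmas \<open>mgf_thread1\<close>, \<open>mgf_thread2\<close> and \<open>mgf_thread3\<close>
  evaluate a path with one, two or three inner vertices glued to the ends \<open>p\<close> and
  \<open>q\<close> of a graph \<open>R\<close> that does not contain the inner vertices: the
  summands record which of the two ends are matched into the path.\<close>

lemma mgf_thread1:
  assumes "finite R" "p \<noteq> q" "\<And>e. e \<in> R \<Longrightarrow> x \<notin> e" "x \<noteq> p" "x \<noteq> q"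
  shows "mgf (insert {p, x} (insert {x, q} R)) t = mgf R t + t * mgf (avoid R {p}) t + t * mgf (avoid R {q}) t"
proof -
  have "{p, x} \<notin> insert {x, q} R" "{x, q} \<notin> R" using assms by (auto simp: doubleton_eq_iff)
  then show ?thesis
    using assms avoid_fresh[of R x "{}"] avoid_fresh[of R x "{q}"] avoid_fresh[of R x "{p}"]
    by (simp add: mgf_insert avoid_insert insert_commute algebra_simps)
qed

lemma mgf_thread2:
  assumes "finite R" "\<And>e. e \<in> R \<Longrightarrow> x \<notin> e" "\<And>e. e \<in> R \<Longrightarrow> y \<notin> e"
    "x \<noteq> y" "x \<noteq> p" "x \<noteq> q" "y \<noteq> p" "y \<noteq> q"
  shows "mgf (insert {p, x} (insert {x, y} (insert {y, q} R))) t = mgf R t + t * mgf R t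
    + t * mgf (avoid R {p}) t + t * mgf (avoid R {q}) t + (if p = q then 0 else t\<^sup>2 * mgf (avoid R {p, q}) t)"
proof -
  have "{p, x} \<notin> insert {x, y} (insert {y, q} R)" "{x, y} \<notin> insert {y, q} R" "{y, q} \<notin> R"
    "{y, q} \<notin> avoid R {p}"
    using assms by (auto simp: doubleton_eq_iff avoid_def)
  moreover have "avoid R {p, x} = avoid R {p}" "avoid R {x, y} = R" "avoid R {y, q} = avoid R {q}"
    "avoid R {p, y, q} = avoid R {p, q}" "avoid R {y, q, p} = avoid R {p, q}" "avoid R {q, x} = avoid R {q}"
    using assms(2,3) by (auto simp: avoid_def)
  ultimately show ?thesis
    using assms
    by (simp add: mgf_insert avoid_insert algebra_simps power2_eq_square)
qed

lemma mgf_thread3: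
  assumes "finite R" "\<And>e. e \<in> R \<Longrightarrow> x \<notin> e" "\<And>e. e \<in> R \<Longrightarrow> y \<notin> e" "\<And>e. e \<in> R \<Longrightarrow> z \<notin> e"
    "x \<noteq> y" "x \<noteq> z" "y \<noteq> z" "x \<noteq> p" "y \<noteq> p" "z \<noteq> p"
  shows "mgf (insert {p, x} (insert {x, y} (insert {y, z} (insert {z, p} R)))) t
    = (1 + 2 * t) * mgf R t + 2 * t * (1 + t) * mgf (avoid R {p}) t"
proof -
  have "{p, x} \<notin> insert {x, y} (insert {y, z} (insert {z, p} R))" "{x, y} \<notin> insert {y, z} (insert {z, p} R)"
    "{y, z} \<notin> insert {z, p} R" "{z, p} \<notin> R" "{y, z} \<notin> avoid R {p}"
    using assms by (auto simp: doubleton_eq_iff avoid_def)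
  moreover have "avoid R {p, x} = avoid R {p}" "avoid R {x, y} = R" "avoid R {y, z} = R" "avoid R {z, p} = avoid R {p}"
    "avoid R {p, y, z} = avoid R {p}" "avoid R {p, x, y, z} = avoid R {p}" "avoid R {x, y, z, p} = avoid R {p}"
    "avoid R {y, z, p} = avoid R {p}"
    using assms(2-4) by (auto simp: avoid_def)
  ultimately show ?thesis
    using assms
    by (simp add: mgf_insert avoid_insert algebra_simps mult_2 mult_2_right)
qed

text \<open>Two adjacent vertices \<open>x\<close>, \<open>y\<close> of degree two whose outer neighbours
  \<open>p\<close>, \<open>r\<close> are distinct and not adjacent. These conditions say exactly
  that shortening the path by one or two vertices creates neither a loop nor a double edge.\<close>

locale thread =
  fixes V :: "'a set" and E p x y r
  assumes tric: "tric V E" and x: "nbrs E x = {p, y}" and y: "nbrs E y = {x, r}"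
    and pr: "p \<noteq> r" "{p, r} \<notin> E"
begin

definition "R = avoid E {x, y}"
definition "E1 = insert {p, x} (insert {x, r} R)"
definition "E2 = insert {p, r} R"

lemma G: "sgraph V E" "conn V E" "card E = card V + 2" "finite V" "finite E"
  using tric by (auto simp: tric_def sgraphD)

lemma in_E: "{p, x} \<in> E" "{x, y} \<in> E" "{y, r} \<in> E"
  using x y by (auto simp: nbrs_def insert_commute)

lemma neq: "p \<noteq> x" "x \<noteq> y" "y \<noteq> r" "p \<noteq> y" "x \<noteq> r"
proof -
  show 1: "p \<noteq> x" "x \<noteq> y" "y \<noteq> r" using in_E sgraphD(3)[OF G(1)] by blast+
  show "p \<noteq> y" using in_E pr by auto
  show "x \<noteq> r" using in_E pr by auto
qed

lemma in_V: "p \<in> V" "x \<in> V" "y \<in> V" "r \<in> V"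
  using in_E sgraphD(3)[OF G(1)] by blast+

lemma R_fresh: "e \<in> R \<Longrightarrow> x \<notin> e" "e \<in> R \<Longrightarrow> y \<notin> e"
  by (auto simp: R_def avoid_def)

lemma E_eq: "E = insert {p, x} (insert {x, y} (insert {y, r} R))"
proof (intro equalityI subsetI)
  fix e assume e: "e \<in> E"
  show "e \<in> insert {p, x} (insert {x, y} (insert {y, r} R))"
    using mem_edge_nb[OF G(1) e, of x] mem_edge_nb[OF G(1) e, of y] x y e
    by (auto simp: R_def avoid_def)
qed (use in_E avoid_subset[of E] in \<open>auto simp: R_def\<close>)

lemma R_props: "finite R" "{p, r} \<notin> R" "R \<subseteq> E"
  using G(5) pr(2) avoid_subset[of E] by (auto simp: R_def)

lemma card_E: "card E = 3 + card R"
proof -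
  have "{p, x} \<notin> insert {x, y} (insert {y, r} R)" "{x, y} \<notin> insert {y, r} R" "{y, r} \<notin> R"
    using neq pr R_fresh by (auto simp: doubleton_eq_iff)
  then show ?thesis using R_props(1) by (subst E_eq) simp
qed

lemma tric1: "tric (V - {y}) E1"
proof -
  have "sgraph (V - {y}) E1"
    using G(1,4) R_props R_fresh in_V neq by (auto simp: sgraph_def E1_def card_insert_if)
  moreover have "conn (V - {y}) E1"
  proof (rule conn_map[OF G(2), of "\<lambda>a. if a = y then x else a"])
    show "(\<lambda>a. if a = y then x else a) ` V = V - {y}" using neq in_V by auto
    fix a b assume ab: "{a, b} \<in> E"
    then consider "{a, b} = {p, x}" | "{a, b} = {x, y}" | "{a, b} = {y, r}" | "{a, b} \<in> R"
      using subsetD[OF equalityD1[OF E_eq] ab] by blast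
    then show "(if a = y then x else a, if b = y then x else b) \<in> (adj E1)\<^sup>*"
    proof cases
      case 4
      then have "a \<noteq> y" "b \<noteq> y" using R_fresh by auto
      then show ?thesis using 4 by (auto intro!: adj_rtrancl simp: E1_def)
    qed (use neq in \<open>auto simp: doubleton_eq_iff E1_def insert_commute intro!: adj_rtrancl\<close>)
  qed
  moreover have "card E1 = 2 + card R"
  proof -
    have "{p, x} \<notin> insert {x, r} R" "{x, r} \<notin> R"
      using neq pr R_fresh by (auto simp: doubleton_eq_iff)
    then show ?thesis using R_props(1) by (simp add: E1_def)
  qed
  ultimately show ?thesis
    using card_E G(3) in_V G(4) card_gt_0_iff[of V] by (auto simp: tric_def card_Diff_singleton)
qed

lemma tric2: "tric (V - {x, y}) E2"
proof -
  let ?f = "\<lambda>a. if a = y then r else if a = x then p else a"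
  have "sgraph (V - {x, y}) E2"
    using G(1,4) R_props R_fresh in_V neq pr by (auto simp: sgraph_def E2_def card_insert_if)
  moreover have "conn (V - {x, y}) E2"
  proof (rule conn_map[OF G(2), of ?f])
    show "?f ` V = V - {x, y}" using neq in_V by auto
    fix a b assume ab: "{a, b} \<in> E"
    then consider "{a, b} = {p, x}" | "{a, b} = {x, y}" | "{a, b} = {y, r}" | "{a, b} \<in> R"
      using subsetD[OF equalityD1[OF E_eq] ab] by blast
    then show "(?f a, ?f b) \<in> (adj E2)\<^sup>*"
    proof cases
      case 4
      then have "a \<noteq> y" "b \<noteq> y" "a \<noteq> x" "b \<noteq> x" using R_fresh by auto
      then show ?thesis using 4 by (auto intro!: adj_rtrancl simp: E2_def)
    qed (use neq in \<open>auto simp: doubleton_eq_iff E2_def insert_commute intro!: adj_rtrancl\<close>)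
  qed
  moreover have "card E2 = 1 + card R" using R_props by (simp add: E2_def)
  moreover have "card (V - {x, y}) + 2 = card V"
  proof -
    have "card {x, y} \<le> card V" using in_V G(4) by (intro card_mono) auto
    then show ?thesis using in_V neq G(4) by (subst card_Diff_subset) auto
  qed
  ultimately show ?thesis
    using card_E G(3) by (simp add: tric_def)
qed

text \<open>Both sides are expanded with the thread formulas; each is a combination of the generating
  functions of \<open>R\<close> and of \<open>R\<close> with \<open>p\<close>, \<open>r\<close>,
  or both deleted.\<close>

lemma mgf_eq: "mgf E t = mgf E1 t + t * mgf E2 t"
proof -
  have "mgf E t = mgf R t + t * mgf R t + t * mgf (avoid R {p}) t + t * mgf (avoid R {r}) t + t\<^sup>2 * mgf (avoid R {p, r}) t"
    using neq pr R_props R_fresh by (subst E_eq, subst mgf_thread2) auto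
  moreover have "mgf E1 t = mgf R t + t * mgf (avoid R {p}) t + t * mgf (avoid R {r}) t"
    unfolding E1_def using neq pr R_props R_fresh by (intro mgf_thread1) auto
  moreover have "mgf E2 t = mgf R t + t * mgf (avoid R {p, r}) t"
    unfolding E2_def using R_props by (intro mgf_insert) auto
  ultimately show ?thesis by (simp add: algebra_simps power2_eq_square)
qed

end

section \<open>Polynomials as coefficient lists\<close>

fun peval :: "int list \<Rightarrow> real \<Rightarrow> real" where
  "peval [] y = 0"
| "peval (a # p) y = of_int a + y * peval p y"

fun padd :: "int list \<Rightarrow> int list \<Rightarrow> int list" where
  "padd [] q = q"
| "padd p [] = p"
| "padd (a # p) (b # q) = (a + b) # padd p q"

text \<open>The shorter list is padded with zeros.\<close>

fun ple :: "int list \<Rightarrow> int list \<Rightarrow> bool" where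
  "ple [] q \<longleftrightarrow> list_all (\<lambda>b. 0 \<le> b) q"
| "ple (a # p) [] \<longleftrightarrow> a \<le> 0 \<and> ple p []"
| "ple (a # p) (b # q) \<longleftrightarrow> a \<le> b \<and> ple p q"

lemma peval_padd [simp]: "peval (padd p q) y = peval p y + peval q y"
  by (induction p q rule: padd.induct) (auto simp: algebra_simps)

lemma peval_nonneg: "0 \<le> y \<Longrightarrow> list_all (\<lambda>b. 0 \<le> b) q \<Longrightarrow> 0 \<le> peval q y"
  by (induction q) auto

lemma peval_mono: "ple p q \<Longrightarrow> 0 \<le> y \<Longrightarrow> peval p y \<le> peval q y"
proof (induction p q rule: ple.induct)
  case (2 a p)
  then have "y * peval p y \<le> 0" by (simp add: mult_nonneg_nonpos)
  with 2 show ?case by simp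
next
  case (3 a p b q)
  then show ?case by (auto intro!: add_mono mult_left_mono)
qed (auto simp: peval_nonneg)

definition bounded_by :: "'a set set \<Rightarrow> int list \<Rightarrow> bool" where
  "bounded_by E p \<longleftrightarrow> (\<forall>y\<ge>0. mgf E y \<le> peval p y)"

lemma bounded_by_mono: "bounded_by E p \<Longrightarrow> ple p q \<Longrightarrow> bounded_by E q"
  unfolding bounded_by_def using peval_mono order_trans by blast

text \<open>This adds up bounds along the recurrences for leaves and threads.\<close>

lemma bounded_by_sum:
  assumes "\<And>y::real. 0 \<le> y \<Longrightarrow> mgf E y \<le> mgf F y + y * mgf H y" "bounded_by F p" "bounded_by H q"
  shows "bounded_by E (padd p (0 # q))"
  unfolding bounded_by_def
proof (intro allI impI)
  fix y :: real assume y: "0 \<le> y"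
  have "mgf E y \<le> mgf F y + y * mgf H y" using assms(1) y .
  also have "\<dots> \<le> peval p y + y * peval q y"
    using assms(2,3) y unfolding bounded_by_def by (intro add_mono mult_left_mono) auto
  finally show "mgf E y \<le> peval (padd p (0 # q)) y" by simp
qed

definition esets :: "(nat \<times> nat) list \<Rightarrow> nat set set" where
  "esets es = (\<lambda>(i, j). {i, j}) ` set es"

definition norm_edge :: "nat \<times> nat \<Rightarrow> nat \<times> nat" where
  "norm_edge = (\<lambda>(i, j). if i \<le> j then (i, j) else (j, i))"

lemma norm_edge: "{fst (norm_edge e), snd (norm_edge e)} = {fst e, snd e}"
  by (auto simp: norm_edge_def split: prod.splits)

text \<open>The list \<open>f\<close> is read as the map \<open>i \<mapsto> f_i\<close>. Edges are compared
  after sorting their ends, so that the test is a computation on pairs of numbers.\<close>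

definition iso_check :: "nat \<Rightarrow> nat list \<Rightarrow> (nat \<times> nat) list \<Rightarrow> (nat \<times> nat) list \<Rightarrow> bool" where
  "iso_check n f es fs \<longleftrightarrow> length f = n \<and> distinct f \<and> list_all (\<lambda>v. v < n) f \<and>
     list_all (\<lambda>(i, j). i < n \<and> j < n) es \<and>
     (let gs = map (\<lambda>(i, j). norm_edge (f ! i, f ! j)) es; hs = map norm_edge fs
      in list_all (\<lambda>e. e \<in> set hs) gs \<and> list_all (\<lambda>e. e \<in> set gs) hs)"

lemma iso_check:
  assumes "iso_check n f es fs"
  shows "giso {..<n} (esets es) {..<n} (esets fs)"
proof -
  let ?u = "\<lambda>(i, j). {i, j :: nat}"
  have f: "length f = n" "distinct f" "set f \<subseteq> {..<n}"
    using assms by (auto simp: iso_check_def list_all_iff)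
  have set: "(\<lambda>(i, j). norm_edge (f ! i, f ! j)) ` set es = norm_edge ` set fs"
    using assms unfolding iso_check_def Let_def list_all_iff by (intro equalityI) auto
  have "bij_betw (nth f) {..<n} (set f)" using f by (intro bij_betw_nth) auto
  moreover have "set f = {..<n}"
    using f by (intro card_subset_eq) (auto simp: distinct_card)
  moreover have "esets fs = (`) (nth f) ` esets es"
  proof -
    have "esets fs = ?u ` norm_edge ` set fs"
      by (simp only: esets_def image_image case_prod_unfold norm_edge)
    also have "\<dots> = (`) (nth f) ` esets es"
      unfolding set[symmetric] by (simp add: esets_def image_image norm_edge case_prod_unfold)
    finally show ?thesis .
  qed
  ultimately show ?thesis by (auto simp: giso_def)
qed

definition simple_edges :: "nat \<Rightarrow> (nat \<times> nat) list \<Rightarrow> bool" where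
  "simple_edges n es \<longleftrightarrow> list_all (\<lambda>(i, j). i < n \<and> j < n \<and> i \<noteq> j) es"

lemma sgraph_esets: "simple_edges n es \<Longrightarrow> sgraph {..<n} (esets es)"
  by (auto simp: simple_edges_def sgraph_def esets_def list_all_iff)

text \<open>The edge recurrence, read as a program.\<close>

fun matching_coeffs :: "(nat \<times> nat) list \<Rightarrow> int list" where
  "matching_coeffs [] = [1]"
| "matching_coeffs ((u, v) # es) = padd (matching_coeffs es) (0 # matching_coeffs (filter (\<lambda>(a, b). a \<noteq> u \<and> a \<noteq> v \<and> b \<noteq> u \<and> b \<noteq> v) es))"

text \<open>An edge repeated in either orientation would be counted twice by \<open>matching_coeffs\<close>.\<close>

fun distinct_edges :: "(nat \<times> nat) list \<Rightarrow> bool" where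
  "distinct_edges [] \<longleftrightarrow> True"
| "distinct_edges ((u, v) # es) \<longleftrightarrow> (u, v) \<notin> set es \<and> (v, u) \<notin> set es \<and> distinct_edges es"

lemma distinct_edges_filter: "distinct_edges es \<Longrightarrow> distinct_edges (filter P es)"
  by (induction es rule: distinct_edges.induct) auto

lemma mgf_esets: "distinct_edges es \<Longrightarrow> mgf (esets es) y = peval (matching_coeffs es) y"
proof (induction es rule: matching_coeffs.induct)
  case 1
  then show ?case by (simp add: esets_def)
next
  case (2 u v es)
  let ?fs = "filter (\<lambda>(a, b). a \<noteq> u \<and> a \<noteq> v \<and> b \<noteq> u \<and> b \<noteq> v) es"
  have "{u, v} \<notin> esets es" using 2(3) by (auto simp: esets_def doubleton_eq_iff)
  moreover have "avoid (esets es) {u, v} = esets ?fs"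
    by (force simp: avoid_def esets_def)
  moreover have "esets ((u, v) # es) = insert {u, v} (esets es)" "finite (esets es)"
    by (auto simp: esets_def)
  ultimately have "mgf (esets ((u, v) # es)) y = mgf (esets es) y + y * mgf (esets ?fs) y"
    by (simp add: mgf_insert)
  then show ?case using 2 distinct_edges_filter by simp
qed

section \<open>Irreducible graphs\<close>

lemma path_edges_snoc: "xs \<noteq> [] \<Longrightarrow> path_edges (xs @ [y]) = insert {last xs, y} (path_edges xs)"
  by (induction xs rule: path_edges.induct) auto

lemma path_edges_rev: "path_edges (rev xs) = path_edges xs"
proof (induction xs rule: path_edges.induct)
  case (1 x y zs)
  have "path_edges ((rev zs @ [y]) @ [x]) = insert {last (rev zs @ [y]), x} (path_edges (rev zs @ [y]))"
    by (rule path_edges_snoc) simp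
  with 1 show ?case by (simp add: insert_commute)
qed auto

lemma path_edges_subset: "e \<in> path_edges xs \<Longrightarrow> e \<subseteq> set xs"
  by (induction xs rule: path_edges.induct) auto

text \<open>An item \<open>(p, zs, q)\<close> stands for the path from \<open>p\<close> through
  \<open>zs\<close> to \<open>q\<close>.\<close>

type_synonym 'a item = "'a \<times> 'a list \<times> 'a"

fun item_edges :: "'a item \<Rightarrow> 'a set set" where
  "item_edges (p, zs, q) = path_edges (p # zs @ [q])"

fun item_inner :: "'a item \<Rightarrow> 'a list" where
  "item_inner (p, zs, q) = zs"

text \<open>The graphs to which neither recurrence applies: no leaf, and no instance of the locale
  \<open>thread\<close>.\<close>

locale irreducible =
  fixes V :: "'a set" and E
  assumes tric: "tric V E"
    and no_leaf: "\<And>v u. v \<in> V \<Longrightarrow> nbrs E v \<noteq> {u}"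
    and irr: "\<And>x y p r. nbrs E x = {p, y} \<Longrightarrow> nbrs E y = {x, r} \<Longrightarrow> p \<noteq> r \<Longrightarrow> {p, r} \<in> E"
    and card_V: "4 \<le> card V"
begin

definition "B = {v \<in> V. 3 \<le> card (nbrs E v)}"
definition "D = {v \<in> V. card (nbrs E v) = 2}"

lemma G: "sgraph V E" "conn V E" "card E = card V + 2" "finite V" "finite E"
  using tric by (auto simp: tric_def sgraphD)

lemma V_split: "V = B \<union> D" "B \<inter> D = {}"
proof -
  have "2 \<le> card (nbrs E v)" if v: "v \<in> V" for v
  proof -
    have "card (nbrs E v) \<noteq> 0"
      using conn_nb_nonempty[OF G(1,2) _ v] card_V finite_nb[OF G(1)] by auto
    moreover have "card (nbrs E v) \<noteq> 1"
      using no_leaf[OF v] by (auto simp: card_1_singleton_iff)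
    ultimately show ?thesis by linarith
  qed
  then show "V = B \<union> D" "B \<inter> D = {}"
    by (force simp: B_def D_def)+
qed

lemma edge_in_V: "{u, v} \<in> E \<Longrightarrow> u \<in> V \<and> v \<in> V \<and> u \<noteq> v"
  using sgraphD(3)[OF G(1)] by blast

lemma D_nb:
  assumes "x \<in> D" "{x, a} \<in> E"
  obtains b where "nbrs E x = {a, b}" "a \<noteq> b" "{x, b} \<in> E"
proof -
  obtain c d where cd: "nbrs E x = {c, d}" "c \<noteq> d"
    using assms(1) by (auto simp: D_def card_2_iff)
  have "a \<in> nbrs E x" using assms(2) by (simp add: nbrs_def)
  then have "\<exists>b. nbrs E x = {a, b} \<and> a \<noteq> b" using cd by (auto simp: insert_commute)
  then obtain b where "nbrs E x = {a, b}" "a \<noteq> b" by blast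
  moreover have "{x, b} \<in> E" using calculation(1) by (auto simp: nbrs_def)
  ultimately show thesis using that by blast
qed

lemma D_nb_eq:
  assumes "x \<in> D" "{x, a} \<in> E" "{x, b} \<in> E" "a \<noteq> b"
  shows "nbrs E x = {a, b}"
proof -
  have "{a, b} \<subseteq> nbrs E x" using assms(2,3) by (simp add: nbrs_def)
  moreover have "card {a, b} = card (nbrs E x)" using assms(1,4) by (simp add: D_def)
  ultimately show ?thesis using card_subset_eq[OF finite_nb[OF G(1)]] by metis
qed

text \<open>The possible threads: a triangle or a square hanging at one branch vertex, or a path with at
  most two inner vertices between two distinct branch vertices. A path with two inner vertices
  occurs only between adjacent ends, since otherwise it could be shortened.\<close>

fun item_ok :: "'a item \<Rightarrow> bool" where
  "item_ok (p, zs, q) \<longleftrightarrow> p \<in> B \<and> q \<in> B \<and>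
     (if p = q then length zs \<in> {2, 3} else length zs \<le> 2 \<and> (length zs = 2 \<longrightarrow> {p, q} \<in> E))"

definition touch :: "'a set \<Rightarrow> 'a set set" where
  "touch X = {e \<in> E. e \<inter> X \<noteq> {}}"

lemma touch_nb: "touch X = (\<Union>x\<in>X. (\<lambda>u. {x, u}) ` nbrs E x)"
  using mem_edge_nb[OF G(1)] by (fastforce simp: touch_def nbrs_def)

text \<open>No edge leads from \<open>S\<close> to a vertex of degree two outside \<open>S\<close>. This
  separates the inner vertices of a new item from those of the items chosen before.\<close>

definition closed :: "'a set \<Rightarrow> bool" where
  "closed S \<longleftrightarrow> (\<forall>a b. a \<in> S \<longrightarrow> b \<in> D \<longrightarrow> {a, b} \<in> E \<longrightarrow> b \<in> S)"

text \<open>The last condition says that the inner vertices hang together inside \<open>D\<close>: a set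
  that is closed under steps inside \<open>D\<close> contains all of them or none.\<close>

definition covers :: "'a item \<Rightarrow> 'a \<Rightarrow> bool" where
  "covers it x \<longleftrightarrow> item_ok it \<and> x \<in> set (item_inner it) \<and> distinct (item_inner it) \<and>
     set (item_inner it) \<subseteq> D \<and> touch (set (item_inner it)) = item_edges it \<and>
     card (item_edges it) = Suc (length (item_inner it)) \<and>
     (\<forall>S. closed S \<longrightarrow> S \<inter> set (item_inner it) \<noteq> {} \<longrightarrow> set (item_inner it) \<subseteq> S)"

text \<open>If \<open>p\<close> had degree two as well, the triangle would be a component and hence the
  whole graph, which has at least four vertices.\<close>

lemma cover_triangle:
  assumes "x \<in> D" "y \<in> D" "nbrs E x = {p, y}" "nbrs E y = {p, x}"
  shows "covers (p, [x, y], p) x" "covers (p, [x, y], p) y"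
proof -
  have e: "{p, x} \<in> E" "{x, y} \<in> E" "{y, p} \<in> E"
    using assms by (auto simp: nbrs_def insert_commute)
  note neq = e[THEN edge_in_V]
  have "p \<in> B"
  proof (rule ccontr)
    assume "p \<notin> B"
    then have "p \<in> D" using neq V_split by blast
    then have "nbrs E p = {x, y}"
      using e neq by (intro D_nb_eq) (auto simp: insert_commute)
    then have closed: "{p, x, y} = V"
      using neq assms by (intro conn_closed_set[OF G(2)]) (auto simp: nbrs_def)
    have "card V \<le> 3" unfolding closed[symmetric] by (simp add: card_insert_if)
    then show False using card_V by simp
  qed
  moreover have "touch {x, y} = {{p, x}, {x, y}, {y, p}}"
    unfolding touch_nb using assms by (auto simp: insert_commute)
  moreover have "card {{p, x}, {x, y}, {y, p}} = 3"
    using neq by (auto simp: card_insert_if doubleton_eq_iff)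
  ultimately show "covers (p, [x, y], p) x" "covers (p, [x, y], p) y"
    using neq assms e unfolding covers_def by (auto simp: closed_def insert_commute)
qed

text \<open>If \<open>p\<close> had degree two, the square would be the whole graph; but a graph on four
  vertices with at most four edges is not tricyclic.\<close>

lemma cover_square:
  assumes "x \<in> D" "y \<in> D" "z \<in> D" "nbrs E x = {p, y}" "nbrs E y = {x, z}" "nbrs E z = {y, p}" "p \<noteq> y"
  shows "v \<in> {x, y, z} \<Longrightarrow> covers (p, [x, y, z], p) v"
proof -
  have e: "{p, x} \<in> E" "{x, y} \<in> E" "{y, z} \<in> E" "{z, p} \<in> E"
    using assms by (auto simp: nbrs_def insert_commute)
  note neq = e[THEN edge_in_V]
  have xz: "x \<noteq> z"
  proof
    assume "x = z"
    then have "nbrs E y = {x}" using assms by simp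
    then show False using no_leaf neq by blast
  qed
  have "p \<in> B"
  proof (rule ccontr)
    assume "p \<notin> B"
    then have "p \<in> D" using neq V_split by blast
    then have nbp: "nbrs E p = {x, z}"
      using e neq xz by (intro D_nb_eq) (auto simp: insert_commute)
    then have closed: "{p, x, y, z} = V"
      using neq assms by (intro conn_closed_set[OF G(2)]) (auto simp: nbrs_def)
    have "e \<inter> V \<noteq> {}" if "e \<in> E" for e using sgraphD(4)[OF G(1) that] by auto
    then have "E = touch {p, x, y, z}" unfolding closed by (auto simp: touch_def)
    also have "\<dots> \<subseteq> {{p, x}, {x, y}, {y, z}, {z, p}}"
      unfolding touch_nb using assms nbp by (auto simp: insert_commute)
    finally have "card E \<le> card {{p, x}, {x, y}, {y, z}, {z, p}}" by (intro card_mono) auto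
    also have "\<dots> \<le> 4" by (simp add: card_insert_if)
    finally show False using card_V G(3) by simp
  qed
  moreover have "touch {x, y, z} = {{p, x}, {x, y}, {y, z}, {z, p}}"
    unfolding touch_nb using assms by (auto simp: insert_commute)
  moreover have "card {{p, x}, {x, y}, {y, z}, {z, p}} = 4"
    using neq xz assms(7) by (auto simp: card_insert_if doubleton_eq_iff)
  moreover have "{x, y, z} \<subseteq> S" if "closed S" "S \<inter> {x, y, z} \<noteq> {}" for S
  proof -
    have "{x, y} \<in> E" "{y, x} \<in> E" "{y, z} \<in> E" "{z, y} \<in> E" using e by (auto simp: insert_commute)
    then show ?thesis using that assms(1-3) unfolding closed_def by blast
  qed
  ultimately show "v \<in> {x, y, z} \<Longrightarrow> covers (p, [x, y, z], p) v"
    using neq assms(1-3) xz unfolding covers_def by auto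
qed

text \<open>From \<open>x\<close> one walks to \<open>y\<close> and on to its other neighbour
  \<open>r\<close>. Irreducibility forces \<open>r\<close> to be \<open>p\<close> or a neighbour
  of \<open>p\<close>, which leaves a triangle, a path between adjacent branch vertices, or a
  square.\<close>

lemma cover_end:
  assumes "x \<in> D" "p \<in> B" "nbrs E x = {p, y}" "p \<noteq> y" "y \<in> D"
  shows "\<exists>it. covers it x"
proof -
  have e: "{p, x} \<in> E" "{x, y} \<in> E"
    using assms by (auto simp: nbrs_def insert_commute)
  obtain r where r: "nbrs E y = {x, r}" "x \<noteq> r" "{y, r} \<in> E"
    using D_nb[of y x] assms(5) e by (metis insert_commute)
  note neq = e[THEN edge_in_V] r(3)[THEN edge_in_V]
  show ?thesis
  proof (cases "p = r")
    case True
    then show ?thesis using cover_triangle[of x y p] assms r by (auto simp: insert_commute)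
  next
    case False
    then have pr: "{p, r} \<in> E" using irr[OF assms(3) r(1)] by simp
    show ?thesis
    proof (cases "r \<in> B")
      case True
      have "touch {x, y} = {{p, x}, {x, y}, {y, r}}"
        unfolding touch_nb using assms r by (auto simp: insert_commute)
      moreover have "card {{p, x}, {x, y}, {y, r}} = 3"
        using neq r assms by (auto simp: card_insert_if doubleton_eq_iff)
      ultimately have "covers (p, [x, y], r) x"
        using neq assms e r True False pr unfolding covers_def
        by (auto simp: closed_def insert_commute)
      then show ?thesis by blast
    next
      case r': False
      then have "r \<in> D" using neq V_split by blast
      then have "nbrs E r = {y, p}"
        using r pr assms(4) by (intro D_nb_eq) (auto simp: insert_commute)
      then show ?thesis
        using cover_square[of x y r p x] assms r \<open>r \<in> D\<close> by auto
    qed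
  qed
qed

text \<open>The cases are distinguished by how many of the two neighbours of \<open>x\<close> are branch
  vertices. With none, \<open>x\<close> is the middle of a hanging square; a triangle through
  \<open>x\<close> and both neighbours is excluded by \<open>cover_triangle\<close>, which makes
  its third vertex a branch vertex.\<close>

lemma cover_exists:
  assumes x: "x \<in> D"
  shows "\<exists>it. covers it x"
proof -
  obtain p q where pq: "nbrs E x = {p, q}" "p \<noteq> q"
    using x by (auto simp: D_def card_2_iff)
  have e: "{p, x} \<in> E" "{x, q} \<in> E"
    using pq by (auto simp: nbrs_def insert_commute)
  note neq = e[THEN edge_in_V]
  consider "p \<in> B" "q \<in> B" | "p \<in> B" "q \<in> D" | "p \<in> D" "q \<in> B" | "p \<in> D" "q \<in> D"
    using neq V_split by blast
  then show ?thesis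
  proof cases
    case 1
    have "touch {x} = {{p, x}, {x, q}}" unfolding touch_nb using pq by (auto simp: insert_commute)
    moreover have "card {{p, x}, {x, q}} = 2" using neq pq by (auto simp: card_insert_if doubleton_eq_iff)
    ultimately have "covers (p, [x], q) x"
      using x 1 pq unfolding covers_def by auto
    then show ?thesis by blast
  next
    case 2
    then show ?thesis using cover_end[of x p q] pq x by auto
  next
    case 3
    then show ?thesis using cover_end[of x q p] pq x by (auto simp: insert_commute)
  next
    case 4
    obtain p' where p': "nbrs E p = {x, p'}" "x \<noteq> p'" "{p, p'} \<in> E"
      using D_nb[of p x] 4 e by metis
    show ?thesis
    proof (cases "q = p'")
      case True
      then have "nbrs E q = {p, x}"
        using 4 e p' neq by (intro D_nb_eq) (auto simp: insert_commute)
      then show ?thesis using cover_triangle[of x p q] x 4 pq p' True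
        by (auto simp: insert_commute)
    next
      case False
      then have "{q, p'} \<in> E" using irr[of x q p p'] pq p' by (auto simp: insert_commute)
      then have "nbrs E q = {x, p'}"
        using 4 e p' by (intro D_nb_eq) (auto simp: insert_commute)
      then show ?thesis using cover_square[of p x q p' x] x 4 pq p'
        by (auto simp: insert_commute)
    qed
  qed
qed

text \<open>A family of items accounting for all edges that meet the set \<open>X\<close> of vertices of
  degree two.\<close>

definition partial :: "'a set \<Rightarrow> 'a item list \<Rightarrow> bool" where
  "partial X its \<longleftrightarrow> X \<subseteq> D \<and> list_all item_ok its \<and> list_all (\<lambda>it. item_inner it \<noteq> []) its \<and>
     distinct (concat (map item_inner its)) \<and> set (concat (map item_inner its)) = X \<and>
     touch X = (\<Union>it\<in>set its. item_edges it) \<and>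
     card (touch X) = (\<Sum>it\<leftarrow>its. Suc (length (item_inner it)))"

text \<open>The set \<open>X\<close> is closed, because an edge from \<open>X\<close> to a vertex of degree
  two lies on an item already chosen. So the item covering a new vertex has all its inner vertices
  outside \<open>X\<close>.\<close>

lemma partial_extend:
  assumes P: "partial X its" and x: "x \<in> D - X"
  shows "\<exists>Y its'. X \<subset> Y \<and> partial Y its'"
proof -
  have closed: "closed X"
    unfolding closed_def
  proof (intro allI impI)
    fix a b assume ab: "a \<in> X" "b \<in> D" "{a, b} \<in> E"
    then have "{a, b} \<in> touch X" by (auto simp: touch_def)
    then obtain p zs q where it: "(p, zs, q) \<in> set its" "{a, b} \<in> item_edges (p, zs, q)"
      using P unfolding partial_def by fastforce
    then have "b \<in> set (p # zs @ [q])" using path_edges_subset by fastforce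
    moreover have "p \<in> B" "q \<in> B" using P it(1) by (auto simp: partial_def list_all_iff)
    ultimately have "b \<in> set zs" using ab(2) V_split by auto
    then show "b \<in> X" using P it(1) by (force simp: partial_def)
  qed
  obtain it where it: "covers it x" using cover_exists x by blast
  let ?Z = "set (item_inner it)"
  have disj: "X \<inter> ?Z = {}"
    using it closed x unfolding covers_def by blast
  have Un: "touch (X \<union> ?Z) = touch X \<union> touch ?Z" by (auto simp: touch_def)
  moreover have "touch X \<inter> touch ?Z = {}"
  proof (rule ccontr)
    assume "touch X \<inter> touch ?Z \<noteq> {}"
    then obtain e a b where e: "e \<in> E" "a \<in> e" "a \<in> X" "b \<in> e" "b \<in> ?Z" by (auto simp: touch_def)
    moreover have "a \<noteq> b" using e disj by auto
    ultimately have "e = {a, b}" using sgraphD(4)[OF G(1) e(1)] by auto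
    moreover have "b \<in> D" using e(5) it by (auto simp: covers_def)
    ultimately have "b \<in> X" using closed e(1,3) unfolding closed_def by simp
    then show False using e(5) disj by auto
  qed
  moreover have "finite (touch X)" "finite (touch ?Z)" using G(5) by (auto simp: touch_def)
  ultimately have card: "card (touch (X \<union> ?Z)) = card (touch ?Z) + card (touch X)"
    by (simp add: card_Un_disjoint)
  have "partial (X \<union> ?Z) (it # its)"
    unfolding partial_def card
  proof (intro conjI)
    show "touch (X \<union> ?Z) = (\<Union>it\<in>set (it # its). item_edges it)"
      using Un P it unfolding partial_def covers_def by auto
    show "card (touch ?Z) + card (touch X) = (\<Sum>it\<leftarrow>it # its. Suc (length (item_inner it)))"
    proof -
      have "card (touch X) = (\<Sum>it\<leftarrow>its. Suc (length (item_inner it)))"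
        using P unfolding partial_def by blast
      moreover have "card (touch ?Z) = Suc (length (item_inner it))"
        using it unfolding covers_def by metis
      ultimately show ?thesis by simp
    qed
    show "distinct (concat (map item_inner (it # its)))"
      using P it disj unfolding partial_def covers_def by (simp add: Int_commute)
    show "set (concat (map item_inner (it # its))) = X \<union> ?Z"
      using P unfolding partial_def by (simp add: Un_commute)
  qed (use P it in \<open>auto simp: partial_def covers_def\<close>)
  moreover have "X \<subset> X \<union> ?Z" using x it by (auto simp: covers_def)
  ultimately show ?thesis by blast
qed

lemma partial_D: "\<exists>its. partial D its"
proof -
  have "finite D" using G(4) by (auto simp: D_def)
  have "\<exists>its. partial D its" if "partial X its" for X its
    using that
  proof (induction "card (D - X)" arbitrary: X its rule: less_induct)
    case less
    show ?case
    proof (cases "X = D")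
      case False
      then obtain x where "x \<in> D - X" using less(2) by (auto simp: partial_def)
      then obtain Y its' where Y: "X \<subset> Y" "partial Y its'" using partial_extend[OF less(2)] by blast
      moreover have "Y \<subseteq> D" using Y(2) unfolding partial_def by blast
      then have "D - Y \<subset> D - X" using Y(1) by blast
      then have "card (D - Y) < card (D - X)"
        using \<open>finite D\<close> by (intro psubset_card_mono) auto
      ultimately show ?thesis using less(1) by blast
    qed (use less in auto)
  qed
  moreover have "partial {} []" by (auto simp: partial_def touch_def)
  ultimately show ?thesis by blast
qed

end

section \<open>Coding irreducible graphs\<close>

text \<open>A code \<open>(a, i, j)\<close> describes a path with \<open>a\<close> inner vertices between
  the branch vertices with numbers \<open>i \<le> j\<close>.\<close>

type_synonym code = "nat \<times> nat \<times> nat"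

fun code :: "nat \<times> 'a list \<times> nat \<Rightarrow> code" where
  "code (i, zs, j) = (length zs, i, j)"

abbreviation inner :: "nat \<times> 'a list \<times> nat \<Rightarrow> 'a list" where
  "inner it \<equiv> fst (snd it)"

fun placed_edges :: "'a list \<Rightarrow> nat \<times> 'a list \<times> nat \<Rightarrow> 'a set set" where
  "placed_edges bs (i, zs, j) = path_edges (bs ! i # zs @ [bs ! j])"

text \<open>This is the degree of the branch vertex with number \<open>t\<close>, a hanging cycle counting
  twice.\<close>

definition ends :: "code list \<Rightarrow> nat \<Rightarrow> nat" where
  "ends cs t = (\<Sum>(a, i, j)\<leftarrow>cs. of_bool (i = t) + of_bool (j = t))"

text \<open>Used to sort the branch vertices, so that the search meets few of the numberings of a graph. Any
  isomorphism invariant would do; this one is computed quickly from the codes.\<close>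

definition weight :: "code list \<Rightarrow> nat \<Rightarrow> nat" where
  "weight cs t = (\<Sum>(a, i, j)\<leftarrow>cs. (if i = t then a else 0) + (if j = t then a else 0))"

text \<open>Numbers of branch vertices and lengths are below ten, so this is the lexicographic order by
  \<open>i\<close>, \<open>j\<close>, \<open>a\<close>.\<close>

fun rank :: "code \<Rightarrow> nat" where
  "rank (a, i, j) = 100 * i + 10 * j + a"

definition codes_ok :: "nat \<Rightarrow> code list \<Rightarrow> bool" where
  "codes_ok b cs \<longleftrightarrow> (\<forall>(a, i, j)\<in>set cs. i \<le> j \<and> j < b \<and>
      (if i = j then a = 2 \<or> a = 3 else a \<le> 2 \<and> (a = 2 \<longrightarrow> (0, i, j) \<in> set cs))) \<and>
     distinct (filter (\<lambda>c. fst c = 0) cs)"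

text \<open>A graph together with a numbering \<open>bs\<close> of its branch vertices and its threads in
  that numbering.\<close>

definition layout :: "'a set \<Rightarrow> 'a set set \<Rightarrow> 'a list \<Rightarrow> (nat \<times> 'a list \<times> nat) list \<Rightarrow> bool" where
  "layout V E bs its \<longleftrightarrow> distinct (bs @ concat (map inner its)) \<and> set (bs @ concat (map inner its)) = V \<and>
     E = (\<Union>it\<in>set its. placed_edges bs it) \<and> codes_ok (length bs) (map code its)"

context irreducible
begin

text \<open>To the items covering the vertices of degree two one adds an item without inner vertices for
  each edge between branch vertices.\<close>

lemma decomposition:
  "\<exists>its. list_all item_ok its \<and> distinct (concat (map item_inner its)) \<and>
     set (concat (map item_inner its)) = D \<and> E = (\<Union>it\<in>set its. item_edges it) \<and>
     card E = (\<Sum>it\<leftarrow>its. Suc (length (item_inner it))) \<and>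
     distinct (map item_edges (filter (\<lambda>it. item_inner it = []) its))"
proof -
  obtain its where its: "partial D its" using partial_D by blast
  let ?F = "{e \<in> E. e \<subseteq> B}"
  obtain es where es: "set es = ?F" "distinct es"
    using finite_distinct_list[of ?F] G(5) by auto
  define f :: "'a set \<Rightarrow> 'a item" where
    "f e = (SOME it. \<exists>p q. it = (p, [], q) \<and> e = {p, q} \<and> p \<noteq> q)" for e
  have f: "\<exists>p q. f e = (p, [], q) \<and> e = {p, q} \<and> p \<noteq> q" if e: "e \<in> ?F" for e
    unfolding f_def
  proof (rule someI_ex)
    obtain p q where "e = {p, q}" "p \<noteq> q" using e sgraphD(4)[OF G(1), of e] by blast
    then show "\<exists>it. \<exists>p q. it = (p, [], q) \<and> e = {p, q} \<and> p \<noteq> q" by blast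
  qed
  have f': "item_inner (f e) = []" "item_edges (f e) = {e}" "item_ok (f e)" if "e \<in> ?F" for e
    using f[OF that] that by auto
  \<comment> \<open>Every edge has an end of degree two or joins two branch vertices.\<close>
  have split: "E = touch D \<union> ?F"
    using sgraphD(4)[OF G(1)] V_split by (fastforce simp: touch_def)
  have "touch D \<inter> ?F = {}" using V_split(2) by (auto simp: touch_def)
  moreover have "finite (touch D)" "finite ?F" using G(5) by (auto simp: touch_def)
  ultimately have "card (touch D \<union> ?F) = card (touch D) + card ?F" by (simp add: card_Un_disjoint)
  then have card: "card E = card (touch D) + length es"
    using split es distinct_card[of es] by simp
  let ?its = "its @ map f es"
  have inner_es: "map item_inner (map f es) = map (\<lambda>_. []) es"
    using f' es(1) by auto
  have conc: "concat (map item_inner ?its) = concat (map item_inner its)"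
    by (simp only: map_append concat_append inner_es) (induction es; simp)
  have P: "D \<subseteq> D" "list_all item_ok its" "list_all (\<lambda>it. item_inner it \<noteq> []) its"
     "distinct (concat (map item_inner its))" "set (concat (map item_inner its)) = D"
     "touch D = (\<Union>it\<in>set its. item_edges it)"
     "card (touch D) = (\<Sum>it\<leftarrow>its. Suc (length (item_inner it)))"
    using its unfolding partial_def by blast+
  have "(\<Sum>it\<leftarrow>map f es. Suc (length (item_inner it))) = length es"
  proof -
    have "(\<Sum>it\<leftarrow>map f es. Suc (length (item_inner it))) = (\<Sum>e\<leftarrow>es. 1)"
      using f'(1) es(1) unfolding map_map by (intro arg_cong[where f = sum_list] map_cong) auto
    then show ?thesis by (simp add: sum_list_triv)
  qed
  then have 1: "card E = (\<Sum>it\<leftarrow>?its. Suc (length (item_inner it)))"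
    using card P(7) by simp
  have 2: "E = (\<Union>it\<in>set ?its. item_edges it)"
  proof -
    have "(\<Union>it\<in>set (map f es). item_edges it) = ?F" using f'(2) es(1) by auto
    then have "(\<Union>it\<in>set ?its. item_edges it) = touch D \<union> ?F"
      unfolding P(6) set_append UN_Un by simp
    then show ?thesis using split by simp
  qed
  have "filter (\<lambda>it. item_inner it = []) its = []"
    using P(3) by (simp add: filter_empty_conv list_all_iff)
  moreover have "filter (\<lambda>it. item_inner it = []) (map f es) = map f es"
    using f'(1) es(1) by (intro filter_True) auto
  moreover have "map item_edges (map f es) = map (\<lambda>e. {e}) es"
    using f'(2) es(1) by auto
  ultimately have 3: "distinct (map item_edges (filter (\<lambda>it. item_inner it = []) ?its))"
    using es(2) by (simp add: distinct_map inj_on_def del: map_map)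
  have 4: "list_all item_ok ?its" using P(2) f'(3) es(1) by (auto simp: list_all_iff)
  show ?thesis
    by (rule exI[of _ ?its]) (use 1 2 3 4 P(4,5) in \<open>simp only: conc simp_thms\<close>)
qed

lemma item_degree:
  assumes "item_ok (p, zs, q)" "v \<notin> set zs"
  shows "card {e \<in> path_edges (p # zs @ [q]). v \<in> e} \<le> of_bool (p = v) + of_bool (q = v)"
    and "finite {e \<in> path_edges (p # zs @ [q]). v \<in> e}"
proof -
  consider "zs = []" "p \<noteq> q" | a where "zs = [a]" "p \<noteq> q" | a b where "zs = [a, b]" | a b c where "zs = [a, b, c]"
    using assms(1) by (cases zs rule: list.exhaust[case_product list.exhaust])
      (auto split: if_splits simp: length_Suc_conv numeral_eq_Suc le_Suc_eq)
  then have "{e \<in> path_edges (p # zs @ [q]). v \<in> e} \<subseteq>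
     (if p = v then {{p, hd (zs @ [q])}} else {}) \<union> (if q = v then {{last (p # zs), q}} else {})"
    using assms(2) by cases auto
  from card_mono[OF _ this] finite_subset[OF this]
  show "card {e \<in> path_edges (p # zs @ [q]). v \<in> e} \<le> of_bool (p = v) + of_bool (q = v)"
    "finite {e \<in> path_edges (p # zs @ [q]). v \<in> e}"
    by (auto split: if_splits simp: card_insert_if)
qed

end

lemma sum_list_cong_mset: "mset xs = mset ys \<Longrightarrow> sum_list (map f xs) = (sum_list (map f ys) :: 'b::comm_monoid_add)"
  by (metis mset_map sum_mset_sum_list)

lemma card_UN_list_le: "card (\<Union>x\<in>set xs. A x) \<le> (\<Sum>x\<leftarrow>xs. card (A x))"
proof (induction xs)
  case (Cons x xs)
  have "card (A x \<union> (\<Union>x\<in>set xs. A x)) \<le> card (A x) + card (\<Union>x\<in>set xs. A x)" by (rule card_Un_le)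
  with Cons show ?case by simp
qed simp

lemma path_edge_touches_inner: "e \<in> path_edges (p # zs @ [q]) \<Longrightarrow> zs \<noteq> [] \<Longrightarrow> e \<inter> set zs \<noteq> {}"
proof (induction zs arbitrary: p)
  case (Cons a zs)
  show ?case
  proof (cases zs)
    case Nil
    then show ?thesis using Cons by auto
  next
    case (Cons b ys)
    then show ?thesis using Cons.IH[of a] Cons.prems by auto
  qed
qed simp

lemma distinct_concat_unique:
  "distinct (concat (map f xs)) \<Longrightarrow> a \<in> set xs \<Longrightarrow> b \<in> set xs \<Longrightarrow> u \<in> set (f a) \<Longrightarrow> u \<in> set (f b) \<Longrightarrow> a = b"
  by (induction xs) auto

lemma sum_ends:
  "codes_ok b cs \<Longrightarrow> (\<Sum>t<b. ends cs t) = 2 * length cs"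
proof -
  assume "codes_ok b cs"
  then have "\<forall>(a, i, j)\<in>set cs. i < b \<and> j < b" unfolding codes_ok_def by fastforce
  then show ?thesis
    by (induction cs) (auto simp: ends_def sum.distrib of_bool_def)
qed

context irreducible
begin

text \<open>An item meets a branch vertex only with its ends, so it contributes at most one edge per end.\<close>

lemma degree_le_ends:
  assumes "list_all item_ok its" "set (concat (map item_inner its)) = D"
    "E = (\<Union>it\<in>set its. item_edges it)" "v \<in> B"
  shows "card (nbrs E v) \<le> (\<Sum>(p, zs, q)\<leftarrow>its. of_bool (p = v) + of_bool (q = v))"
proof -
  let ?A = "\<lambda>it. {e \<in> item_edges it. v \<in> e}"
  have le: "card (?A (p, zs, q)) \<le> of_bool (p = v) + of_bool (q = v)" "finite (?A (p, zs, q))"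
    if "(p, zs, q) \<in> set its" for p zs q
  proof -
    have "v \<notin> set zs" using assms(2,4) that V_split(2) by force
    moreover have "item_ok (p, zs, q)" using assms(1) that by (auto simp: list_all_iff)
    ultimately show "card (?A (p, zs, q)) \<le> of_bool (p = v) + of_bool (q = v)" "finite (?A (p, zs, q))"
      using item_degree[of p zs q v] unfolding item_edges.simps by blast+
  qed
  have "inj_on (\<lambda>u. {v, u}) (nbrs E v)" by (auto simp: inj_on_def doubleton_eq_iff)
  then have "card (nbrs E v) = card ((\<lambda>u. {v, u}) ` nbrs E v)" by (simp add: card_image)
  also have "\<dots> \<le> card (\<Union>it\<in>set its. ?A it)"
  proof (intro card_mono)
    show "finite (\<Union>it\<in>set its. ?A it)" using le(2) by (force simp: split_paired_all)
    show "(\<lambda>u. {v, u}) ` nbrs E v \<subseteq> (\<Union>it\<in>set its. ?A it)"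
      using equalityD1[OF assms(3)] by (auto simp: nbrs_def)
  qed
  also have "\<dots> \<le> (\<Sum>it\<leftarrow>its. card (?A it))" by (rule card_UN_list_le)
  also have "\<dots> \<le> (\<Sum>(p, zs, q)\<leftarrow>its. of_bool (p = v) + of_bool (q = v))"
    by (intro sum_list_mono) (use le in auto)
  finally show ?thesis .
qed

text \<open>Branch vertices are sorted by descending weight, items are oriented from the smaller to the
  larger number and sorted by rank. Counting vertices and edges shows that there are two more
  items than branch vertices, because the graph has two more edges than vertices.\<close>

lemma layout_exists:
  "\<exists>bs its. layout V E bs its \<and> length its = length bs + 2 \<and>
     (\<forall>t<length bs. 3 \<le> ends (map code its) t) \<and>
     sorted (map rank (map code its)) \<and>
     (\<forall>t. Suc t < length bs \<longrightarrow> weight (map code its) (Suc t) \<le> weight (map code its) t) \<and>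
     card V = length bs + (\<Sum>c\<leftarrow>map code its. fst c)"
proof -
  obtain its0 where its0: "list_all item_ok its0" "distinct (concat (map item_inner its0))"
     "set (concat (map item_inner its0)) = D" "E = (\<Union>it\<in>set its0. item_edges it)"
     "card E = (\<Sum>it\<leftarrow>its0. Suc (length (item_inner it)))"
     "distinct (map item_edges (filter (\<lambda>it. item_inner it = []) its0))"
    using decomposition by blast
  \<comment> \<open>The weight of a branch vertex, before the branch vertices are numbered.\<close>
  define kv where "kv v = (\<Sum>(p, zs, q)\<leftarrow>its0. (if p = v then length zs else 0) + (if q = v then length zs else 0))" for v
  have "finite B" using G(4) by (simp add: B_def)
  then obtain xs where xs: "set xs = B" "distinct xs" using finite_distinct_list by blast
  define bs where "bs = rev (sort_key kv xs)"
  have bs: "set bs = B" "distinct bs" using xs by (auto simp: bs_def)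
  have desc: "kv (bs ! Suc t) \<le> kv (bs ! t)" if "Suc t < length bs" for t
  proof -
    let ?s = "map kv (sort_key kv xs)"
    have "?s ! (length bs - Suc (Suc t)) \<le> ?s ! (length bs - Suc t)"
      by (rule sorted_nth_mono[OF sorted_sort_key]) (use that in \<open>auto simp: bs_def\<close>)
    then show ?thesis using that by (simp add: bs_def rev_nth)
  qed
  \<comment> \<open>The number of a branch vertex in bs.\<close>
  define idx where "idx = the_inv_into {..<length bs} (nth bs)"
  have bij: "bij_betw (nth bs) {..<length bs} B" using bij_betw_nth[OF bs(2)] bs(1) by blast
  have idx: "idx v < length bs" "bs ! idx v = v" if "v \<in> B" for v
    using the_inv_into_into[of "nth bs" "{..<length bs}" v "{..<length bs}"] f_the_inv_into_f_bij_betw[OF bij, of v]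
      that bij by (auto simp: idx_def bij_betw_def)
  have idx_nth: "idx (bs ! t) = t" if "t < length bs" for t
    using that bij the_inv_into_f_f by (fastforce simp: idx_def bij_betw_def)
  define conv :: "'a item \<Rightarrow> nat \<times> 'a list \<times> nat" where "conv = (\<lambda>(p, zs, q). if idx p \<le> idx q then (idx p, zs, idx q) else (idx q, rev zs, idx p))"
  define its where "its = sort_key (rank \<circ> code) (map conv its0)"
  have mset: "mset its = mset (map conv its0)" by (simp add: its_def)
  then have set: "set its = conv ` set its0" by (metis mset_eq_setD set_map)
  have ok: "p \<in> B" "q \<in> B" "item_ok (p, zs, q)" if "(p, zs, q) \<in> set its0" for p zs q
    using its0(1) that by (force simp: list_all_iff)+
  have conv_edges: "placed_edges bs (conv it) = item_edges it" if it: "it \<in> set its0" for it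
  proof -
    obtain p zs q where pzq: "it = (p, zs, q)" by (cases it) auto
    have "path_edges (q # rev zs @ [p]) = path_edges (p # zs @ [q])"
      using path_edges_rev[of "p # zs @ [q]"] by simp
    then show ?thesis using ok[of p zs q] it idx by (auto simp: conv_def pzq)
  qed
  have conv_inner: "mset (inner (conv it)) = mset (item_inner it)" for it
    by (cases it) (auto simp: conv_def)
  have mset_inner: "mset (concat (map inner its)) = mset (concat (map item_inner its0))"
  proof -
    have "mset (concat (map inner its)) = (\<Sum>it\<leftarrow>its. mset (inner it))"
      by (simp add: mset_concat comp_def)
    also have "\<dots> = (\<Sum>it\<leftarrow>map conv its0. mset (inner it))"
      by (rule sum_list_cong_mset[OF mset])
    also have "\<dots> = mset (concat (map item_inner its0))"
      by (simp add: mset_concat comp_def conv_inner)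
    finally show ?thesis .
  qed
  have code_sum: "(\<Sum>c\<leftarrow>map code its. f c) = (\<Sum>it\<leftarrow>its0. f (code (conv it)))" for f :: "code \<Rightarrow> nat"
    using sum_list_cong_mset[OF mset, of "f \<circ> code"] by (simp add: comp_def)
  have len: "length its = length its0" using mset by (metis size_mset length_map)
  have fst_code: "fst (code (conv it)) = length (item_inner it)" for it
    by (cases it) (auto simp: conv_def)

  have "distinct (concat (map inner its))" "set (concat (map inner its)) = D"
    using its0(2,3) mset_eq_imp_distinct_iff[OF mset_inner] mset_eq_setD[OF mset_inner] by simp_all
  then have dist: "distinct (bs @ concat (map inner its))" "set (bs @ concat (map inner its)) = V"
    using bs V_split by auto
  have edges: "E = (\<Union>it\<in>set its. placed_edges bs it)"
    unfolding set using its0(4) conv_edges by auto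

  have shape: "i \<le> j \<and> j < length bs \<and>
      (if i = j then a = 2 \<or> a = 3 else a \<le> 2 \<and> (a = 2 \<longrightarrow> (0, i, j) \<in> set (map code its)))"
    if c: "(a, i, j) \<in> set (map code its)" for a i j
  proof -
    obtain p zs q where it: "(p, zs, q) \<in> set its0" "(a, i, j) = code (conv (p, zs, q))"
      using c set by auto
    note o = ok[OF it(1)]
    have ij: "{i, j} = {idx p, idx q}" "i \<le> j" "a = length zs" using it(2) by (auto simp: conv_def split: if_splits)
    have eq: "i = j \<longleftrightarrow> p = q"
      using ij(1) idx[OF o(1)] idx[OF o(2)] by (metis doubleton_eq_iff)
    have "(0, i, j) \<in> set (map code its)" if pq: "p \<noteq> q" "length zs = 2"
    proof -
      have "{p, q} \<in> E" using o(3) pq by simp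
      then obtain p' zs' q' where it': "(p', zs', q') \<in> set its0" "{p, q} \<in> item_edges (p', zs', q')"
        using its0(4) by fastforce
      have "set zs' \<subseteq> D" using its0(3) it'(1) by force
      then have "zs' = []"
        using path_edge_touches_inner[of "{p, q}" p' zs' q'] it'(2) o(1,2) V_split(2) by auto
      then have "{p', q'} = {p, q}" using it'(2) by auto
      then have "code (conv (p', zs', q')) = (0, i, j)"
        using \<open>zs' = []\<close> it(2) by (auto simp: conv_def doubleton_eq_iff split: if_splits)
      then show ?thesis using it'(1) set by force
    qed
    then show ?thesis using o(3) ij eq idx(1)[OF o(1)] idx(1)[OF o(2)]
      by (auto simp: doubleton_eq_iff split: if_splits)
  qed
  have "distinct (filter (\<lambda>c. fst c = 0) (map code its))"
  proof -
    define g where "g = (\<lambda>(a::nat, i, j). {{bs ! i, bs ! j}})"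
    let ?es = "filter (\<lambda>it. item_inner it = []) its0"
    have "item_edges it = g (code (conv it))" if it: "it \<in> set ?es" for it
    proof -
      obtain p zs q where pzq: "it = (p, zs, q)" by (cases it) auto
      show ?thesis
        using it ok[of p zs q] idx by (auto simp: pzq g_def conv_def insert_commute)
    qed
    then have "map item_edges ?es = map g (map (code \<circ> conv) ?es)" by simp
    then have "distinct (map (code \<circ> conv) ?es)" using its0(6) by (metis distinct_map)
    moreover have "filter (\<lambda>c. fst c = 0) (map (code \<circ> conv) its0) = map (code \<circ> conv) ?es"
      unfolding filter_map by (simp add: comp_def fst_code)
    ultimately have "distinct (filter (\<lambda>c. fst c = 0) (map (code \<circ> conv) its0))" by simp
    moreover have "mset (map code its) = mset (map (code \<circ> conv) its0)"
      using mset by (metis mset_map map_map)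
    then have "mset (filter (\<lambda>c. fst c = 0) (map code its)) = mset (filter (\<lambda>c. fst c = 0) (map (code \<circ> conv) its0))"
      by (metis mset_filter)
    ultimately show ?thesis using mset_eq_imp_distinct_iff by blast
  qed
  then have "codes_ok (length bs) (map code its)"
    unfolding codes_ok_def using shape by blast
  then have lay: "layout V E bs its"
    unfolding layout_def using dist edges by blast

  have cardV: "card V = length bs + (\<Sum>c\<leftarrow>map code its. fst c)"
  proof -
    have "card V = length (bs @ concat (map inner its))" using dist distinct_card by metis
    also have "\<dots> = length bs + length (concat (map item_inner its0))"
      using mset_inner by (metis length_append size_mset)
    also have "length (concat (map item_inner its0)) = (\<Sum>c\<leftarrow>map code its. fst c)"
      unfolding code_sum fst_code by (simp add: length_concat comp_def)
    finally show ?thesis .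
  qed
  \<comment> \<open>An item has one more edge than inner vertices, so comparing edges with vertices counts the items.\<close>
  have "(\<Sum>it\<leftarrow>xs. Suc (length (item_inner it))) = length xs + (\<Sum>it\<leftarrow>xs. length (item_inner it))"
    for xs :: "'a item list"
    by (induction xs) auto
  then have "length its = length bs + 2"
    using its0(5) cardV G(3) len unfolding code_sum fst_code by presburger
  moreover have "3 \<le> ends (map code its) t" if t: "t < length bs" for t
  proof -
    have v: "bs ! t \<in> B" using nth_mem[OF t] bs(1) by simp
    have "3 \<le> card (nbrs E (bs ! t))" using v by (simp add: B_def)
    also have "\<dots> \<le> (\<Sum>(p, zs, q)\<leftarrow>its0. of_bool (p = bs ! t) + of_bool (q = bs ! t))"
      by (rule degree_le_ends[OF its0(1,3,4) v])
    also have "\<dots> = ends (map code its) t"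
      unfolding ends_def code_sum
    proof (intro arg_cong[where f = sum_list] map_cong refl)
      fix it assume it: "it \<in> set its0"
      obtain p zs q where pzq: "it = (p, zs, q)" by (cases it) auto
      have "p = bs ! t \<longleftrightarrow> idx p = t" "q = bs ! t \<longleftrightarrow> idx q = t"
        using ok[of p zs q] it idx idx_nth t unfolding pzq by metis+
      then show "(case it of (p, zs, q) \<Rightarrow> (of_bool (p = bs ! t) + of_bool (q = bs ! t) :: nat))
          = (case code (conv it) of (a, i, j) \<Rightarrow> of_bool (i = t) + of_bool (j = t))"
        by (auto simp: pzq conv_def)
    qed
    finally show ?thesis .
  qed
  moreover have "sorted (map rank (map code its))"
    using sorted_sort_key[of "rank \<circ> code" "map conv its0"] by (simp add: its_def)
  moreover have "weight (map code its) t = kv (bs ! t)" if t: "t < length bs" for t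
    unfolding weight_def code_sum kv_def
  proof (intro arg_cong[where f = sum_list] map_cong refl)
    fix it assume it: "it \<in> set its0"
    obtain p zs q where pzq: "it = (p, zs, q)" by (cases it) auto
    have "p = bs ! t \<longleftrightarrow> idx p = t" "q = bs ! t \<longleftrightarrow> idx q = t"
      using ok[of p zs q] it idx idx_nth t unfolding pzq by metis+
    then show "(case code (conv it) of (a, i, j) \<Rightarrow> (if i = t then a else 0) + (if j = t then a else 0))
        = (case it of (p, zs, q) \<Rightarrow> (if p = bs ! t then length zs else 0) + (if q = bs ! t then length zs else 0))"
      by (auto simp: pzq conv_def)
  qed
  then have "\<forall>t. Suc t < length bs \<longrightarrow> weight (map code its) (Suc t) \<le> weight (map code its) t"
    using desc by auto
  ultimately show ?thesis using lay cardV by blast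
qed

end

text \<open>The vertices on items with ends in \<open>S\<close> form a set that no edge leaves.\<close>

lemma layout_connected:
  assumes "layout V E bs its" "conn V E" "S \<subseteq> {..<length bs}" "S \<noteq> {}"
    and S: "\<forall>(a, i, j)\<in>set (map code its). i \<in> S \<longleftrightarrow> j \<in> S"
  shows "S = {..<length bs}"
proof -
  define W where "W = nth bs ` S \<union> (\<Union>(i, zs, j)\<in>{it \<in> set its. fst it \<in> S}. set zs)"
  have dist: "distinct bs" "distinct (concat (map inner its))" "set bs \<inter> set (concat (map inner its)) = {}"
    and V: "V = set bs \<union> set (concat (map inner its))"
    and E: "E = (\<Union>it\<in>set its. placed_edges bs it)"
    and ok: "codes_ok (length bs) (map code its)"
    using assms(1) by (auto simp: layout_def)
  have iff: "i \<in> S \<longleftrightarrow> j \<in> S" "i < length bs" "j < length bs" if "(i, zs, j) \<in> set its" for i zs j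
  proof -
    have "(length zs, i, j) \<in> set (map code its)" using that by force
    then show "i \<in> S \<longleftrightarrow> j \<in> S" "i < length bs" "j < length bs" using S ok unfolding codes_ok_def by fastforce+
  qed
  have nthS: "bs ! i \<in> W \<longleftrightarrow> i \<in> S" if i: "i < length bs" for i
  proof -
    have "bs ! i \<notin> set zs" if "(k, zs, j) \<in> set its" for k zs j
      using dist(3) i that nth_mem[OF i] by force
    moreover have "bs ! i \<in> nth bs ` S \<longleftrightarrow> i \<in> S"
      using dist(1) i assms(3) by (auto simp: nth_eq_iff_index_eq subset_iff)
    ultimately show ?thesis unfolding W_def by auto
  qed
  have innerS: "u \<in> W \<longleftrightarrow> i \<in> S" if it: "(i, zs, j) \<in> set its" "u \<in> set zs" for i zs j u
  proof
    assume "i \<in> S" then show "u \<in> W" using it by (force simp: W_def)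
  next
    assume "u \<in> W"
    moreover have "u \<notin> nth bs ` S"
    proof
      assume "u \<in> nth bs ` S"
      then have "u \<in> set bs" using assms(3) by auto
      then show False using dist(3) it by force
    qed
    ultimately obtain k ws l where k: "(k, ws, l) \<in> set its" "k \<in> S" "u \<in> set ws" by (auto simp: W_def)
    have "(k, ws, l) = (i, zs, j)"
      using distinct_concat_unique[OF dist(2) k(1) it(1)] k(3) it(2) by simp
    then show "i \<in> S" using k by simp
  qed
  have "W = V"
  proof (rule conn_closed_set[OF assms(2)])
    show "W \<subseteq> V" using V assms(3) by (fastforce simp: W_def)
    show "W \<noteq> {}" using assms(4) by (auto simp: W_def)
    fix u v assume uv: "{u, v} \<in> E" "u \<in> W"
    then obtain i zs j where it: "(i, zs, j) \<in> set its" "{u, v} \<in> path_edges (bs ! i # zs @ [bs ! j])"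
      using E by fastforce
    have "{u, v} \<subseteq> set (bs ! i # zs @ [bs ! j])" using path_edges_subset[OF it(2)] .
    moreover have "x \<in> W \<longleftrightarrow> i \<in> S" if "x \<in> set (bs ! i # zs @ [bs ! j])" for x
      using that nthS iff[OF it(1)] innerS[OF it(1)] by auto
    ultimately show "v \<in> W" using uv(2) by auto
  qed
  then have "i \<in> S" if "i < length bs" for i using nthS[OF that] V that by auto
  then show ?thesis using assms(3) by auto
qed

section \<open>Evaluating codes\<close>

text \<open>The coefficients of the generating function of the coded graph in which the branch vertices in
  \<open>U\<close> are deleted. One item is split off at a time, with factors given by the thread
  formulas; the recursion therefore branches over the ends of items, not over all edges.\<close>

fun code_coeffs :: "code list \<Rightarrow> nat list \<Rightarrow> int list" where
  "code_coeffs [] U = [1]"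
| "code_coeffs ((a, i, j) # cs) U =
    (let r = code_coeffs cs U;
         ri = (if i \<in> set U then [] else 0 # code_coeffs cs (i # U))
     in if i = j then
          (if a = 2 then padd (padd r (0 # r)) (padd ri ri)
           else let s = padd ri (0 # ri); t = 0 # r in padd (padd r (padd t t)) (padd s s))
        else
        (let rj = (if j \<in> set U then [] else 0 # code_coeffs cs (j # U));
            rij = (if i \<in> set U \<or> j \<in> set U then [] else 0 # code_coeffs cs (i # j # U))
         in if a = 0 then padd r rij
            else if a = 1 then padd r (padd ri rj)
            else padd (padd r (0 # r)) (padd (padd ri rj) (0 # rij))))"

context
  fixes R :: "'a set set" and X :: "'a set" and y :: "'b::comm_semiring_1"
  assumes fin: "finite R"
begin

abbreviation "off Y \<equiv> mgf (avoid R (Y \<union> X)) y"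

text \<open>The lemmas \<open>avoid_thread0\<close> to \<open>avoid_thread3\<close> repeat the thread
  formulas when a set \<open>X\<close> of vertices outside the thread, possibly containing its
  ends, is deleted.\<close>

lemma avoid_thread0:
  assumes "{p, q} \<notin> R"
  shows "mgf (avoid (insert {p, q} R) X) y = off {} + (if p \<in> X \<or> q \<in> X then 0 else y * off {p, q})"
proof (cases "p \<in> X \<or> q \<in> X")
  case False
  have "{p, q} \<notin> avoid R X" using assms by (auto simp: avoid_def)
  then show ?thesis using False fin by (simp add: avoid_insert mgf_insert Un_commute)
qed (auto simp: avoid_insert)

lemma avoid_thread1:
  assumes "\<And>e. e \<in> R \<Longrightarrow> x \<notin> e" "x \<notin> X" "x \<noteq> p" "x \<noteq> q" "p \<noteq> q"
  shows "mgf (avoid (insert {p, x} (insert {x, q} R)) X) y =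
    off {} + (if p \<in> X then 0 else y * off {p}) + (if q \<in> X then 0 else y * off {q})"
proof -
  let ?R = "avoid R X"
  have fresh: "x \<notin> e" if "e \<in> ?R" for e using that assms(1) by (auto simp: avoid_def)
  have single: "mgf (insert {x, v} ?R) y = mgf ?R y + y * off {v}" for v
  proof -
    have "avoid ?R {x, v} = avoid R ({v} \<union> X)" using assms(1) by (auto simp: avoid_def disjnt_def)
    moreover have "{x, v} \<notin> ?R" using fresh by auto
    ultimately show ?thesis using fin by (simp add: mgf_insert del: avoid_avoid)
  qed
  have both: "mgf (insert {p, x} (insert {x, q} ?R)) y = mgf ?R y + y * off {p} + y * off {q}"
    using mgf_thread1[of ?R p q x y] fresh assms(3-5) fin by (simp add: Un_commute)
  show ?thesis
    using assms(2) single both by (simp add: avoid_insert insert_commute[of p x])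
qed

lemma avoid_thread2:
  assumes "\<And>e. e \<in> R \<Longrightarrow> x \<notin> e" "\<And>e. e \<in> R \<Longrightarrow> z \<notin> e" "x \<notin> X" "z \<notin> X"
    "x \<noteq> z" "x \<noteq> p" "x \<noteq> q" "z \<noteq> p" "z \<noteq> q"
  shows "mgf (avoid (insert {p, x} (insert {x, z} (insert {z, q} R))) X) y =
    off {} + y * off {} + (if p \<in> X then 0 else y * off {p}) + (if q \<in> X then 0 else y * off {q})
     + (if p = q \<or> p \<in> X \<or> q \<in> X then 0 else y\<^sup>2 * off {p, q})"
proof -
  let ?R = "avoid R X"
  have fresh: "x \<notin> e" "z \<notin> e" if "e \<in> ?R" for e using that assms(1,2) by (auto simp: avoid_def)
  have n: "{x, z} \<notin> ?R" "{z, v} \<notin> ?R" "{x, v} \<notin> ?R" for v using fresh by auto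
  have a: "avoid ?R {x, z} = avoid R X" "avoid ?R {z, v} = avoid R ({v} \<union> X)"
    "avoid ?R {x, v} = avoid R ({v} \<union> X)" for v
    using assms(1,2) by (auto simp: avoid_def disjnt_def)
  have mid: "mgf (insert {x, z} ?R) y = mgf ?R y + y * mgf ?R y"
    using n a fin by (simp add: mgf_insert del: avoid_avoid)
  have right: "mgf (insert {x, z} (insert {z, v} ?R)) y = mgf ?R y + y * mgf ?R y + y * off {v}"
    if "v \<noteq> x" "v \<noteq> z" for v
  proof -
    have "{x, z} \<notin> insert {z, v} ?R" using n that assms(5) by (auto simp: doubleton_eq_iff)
    moreover have "avoid (insert {z, v} ?R) {x, z} = avoid ?R {x, z}" by (simp add: avoid_insert)
    ultimately show ?thesis using n a fin by (simp add: mgf_insert algebra_simps del: avoid_avoid)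
  qed
  have left: "mgf (insert {v, x} (insert {x, z} ?R)) y = mgf ?R y + y * mgf ?R y + y * off {v}"
    if "v \<noteq> x" "v \<noteq> z" for v
  proof -
    have "{v, x} \<notin> insert {x, z} ?R" using n(3)[of v] that assms(5) by (auto simp: doubleton_eq_iff insert_commute)
    moreover have "avoid (insert {x, z} ?R) {v, x} = avoid ?R {x, v}" by (simp add: avoid_insert insert_commute)
    ultimately show ?thesis using a mid fin by (simp add: mgf_insert algebra_simps del: avoid_avoid)
  qed
  have both: "mgf (insert {p, x} (insert {x, z} (insert {z, q} ?R))) y = mgf ?R y + y * mgf ?R y
     + y * off {p} + y * off {q} + (if p = q then 0 else y\<^sup>2 * off {p, q})"
    using mgf_thread2[of ?R x z p q y] fresh assms(5-9) fin by (simp add: Un_commute)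
  show ?thesis
    using assms(3,4) mid right[of q] left[of p] both assms(6-9)
    by (auto simp add: avoid_insert algebra_simps)
qed

lemma avoid_thread3:
  assumes "\<And>e. e \<in> R \<Longrightarrow> x \<notin> e" "\<And>e. e \<in> R \<Longrightarrow> z \<notin> e" "\<And>e. e \<in> R \<Longrightarrow> w \<notin> e"
    "x \<notin> X" "z \<notin> X" "w \<notin> X" "x \<noteq> z" "x \<noteq> w" "z \<noteq> w" "x \<noteq> p" "z \<noteq> p" "w \<noteq> p"
  shows "mgf (avoid (insert {p, x} (insert {x, z} (insert {z, w} (insert {w, p} R)))) X) y =
    (1 + 2 * y) * off {} + (if p \<in> X then 0 else 2 * y * (1 + y) * off {p})"
proof -
  let ?R = "avoid R X"
  have fresh: "x \<notin> e" "z \<notin> e" "w \<notin> e" if "e \<in> ?R" for e using that assms(1-3) by (auto simp: avoid_def)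
  have n: "{x, z} \<notin> insert {z, w} ?R" "{z, w} \<notin> ?R"
    using fresh assms(7-9) by (auto simp: doubleton_eq_iff)
  have a: "avoid (insert {z, w} ?R) {x, z} = avoid R X" "avoid ?R {z, w} = avoid R X"
    using assms(1-3) by (auto simp: avoid_def disjnt_def)
  have mid: "mgf (insert {x, z} (insert {z, w} ?R)) y = (1 + 2 * y) * mgf ?R y"
    using n a fin by (simp add: mgf_insert algebra_simps mult_2 mult_2_right del: avoid_avoid)
  have both: "mgf (insert {p, x} (insert {x, z} (insert {z, w} (insert {w, p} ?R)))) y
     = (1 + 2 * y) * mgf ?R y + 2 * y * (1 + y) * off {p}"
    using mgf_thread3[of ?R x z w p y] fresh assms(7-12) fin by (simp add: Un_commute)
  show ?thesis
    using assms(4-6) mid both assms(10-12) by (auto simp add: avoid_insert)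
qed

end

text \<open>The part of \<open>codes_ok\<close> that is inherited by the tail of a list, as inductions over
  lists require.\<close>

definition shape_ok :: "nat \<Rightarrow> code list \<Rightarrow> bool" where
  "shape_ok b cs \<longleftrightarrow> (\<forall>(a, i, j)\<in>set cs. i \<le> j \<and> j < b \<and> (if i = j then a = 2 \<or> a = 3 else a \<le> 2)) \<and>
     distinct (filter (\<lambda>c. fst c = 0) cs)"

lemma codes_ok_shape: "codes_ok b cs \<Longrightarrow> shape_ok b cs"
  unfolding codes_ok_def shape_ok_def by (auto split: if_splits)

lemma finite_path_edges [simp]: "finite (path_edges xs)"
  by (induction xs rule: path_edges.induct) auto

lemma finite_placed_edges [simp]: "finite (placed_edges bs it)"
  by (cases it) auto

lemma placed_edges_subset: "e \<in> placed_edges bs (i, zs, j) \<Longrightarrow> e \<subseteq> insert (bs ! i) (insert (bs ! j) (set zs))"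
  using path_edges_subset by fastforce

text \<open>Induction over the items. The inner vertices of the first item occur on no other item, and for
  an item without inner vertices the edge itself does not occur on another item; so the thread
  formulas apply.\<close>

lemma mgf_placed:
  assumes "distinct (bs @ concat (map inner its))" "shape_ok (length bs) (map code its)" "set U \<subseteq> {..<length bs}"
  shows "mgf (avoid (\<Union>it\<in>set its. placed_edges bs it) (nth bs ` set U)) y = peval (code_coeffs (map code its) U) y"
  using assms
proof (induction its arbitrary: U)
  case (Cons it its)
  obtain i zs j where it: "it = (i, zs, j)" by (cases it) auto
  let ?R = "\<Union>it\<in>set its. placed_edges bs it"
  let ?X = "nth bs ` set U"
  let ?p = "bs ! i" and ?q = "bs ! j"
  have ij: "i \<le> j" "j < length bs" "if i = j then length zs = 2 \<or> length zs = 3 else length zs \<le> 2"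
    using Cons.prems(2) by (auto simp: shape_ok_def it)
  have shape: "shape_ok (length bs) (map code its)"
    using Cons.prems(2) by (auto simp: shape_ok_def split: if_splits)
  have other: "i' < length bs" "j' < length bs" "i' \<le> j'" if "(i', zs', j') \<in> set its" for i' zs' j'
  proof -
    have "(length zs', i', j') \<in> set (map code its)" using that by force
    then show "i' < length bs" "j' < length bs" "i' \<le> j'" using shape unfolding shape_ok_def by fastforce+
  qed
  have dist: "distinct bs" "distinct zs" "set zs \<inter> set bs = {}" "distinct (bs @ concat (map inner its))"
    "set zs \<inter> set (concat (map inner its)) = {}" "set bs \<inter> set (concat (map inner its)) = {}"
    using Cons.prems(1) by (auto simp: it)
  have IH: "mgf (avoid ?R (nth bs ` set W)) y = peval (code_coeffs (map code its) W) y" if "set W \<subseteq> {..<length bs}" for W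
    using Cons.IH[OF dist(4) shape that] .
  have IHp: "mgf (avoid ?R ({?p} \<union> ?X)) y = peval (code_coeffs (map code its) (i # U)) y"
    and IHq: "mgf (avoid ?R ({?q} \<union> ?X)) y = peval (code_coeffs (map code its) (j # U)) y"
    and IHpq: "mgf (avoid ?R ({?p, ?q} \<union> ?X)) y = peval (code_coeffs (map code its) (i # j # U)) y"
    and IH0: "mgf (avoid ?R ({} \<union> ?X)) y = peval (code_coeffs (map code its) U) y"
    using IH[of "i # U"] IH[of "j # U"] IH[of "i # j # U"] IH[of U] Cons.prems(3) ij by simp_all
  have fresh: "x \<notin> e" if xe: "x \<in> set zs" "e \<in> ?R" for x e
  proof
    assume "x \<in> e"
    obtain i' zs' j' where o: "(i', zs', j') \<in> set its" "e \<in> placed_edges bs (i', zs', j')"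
      using xe(2) by auto
    have "x \<in> set zs' \<or> x \<in> set bs"
      using placed_edges_subset[OF o(2)] \<open>x \<in> e\<close> other[OF o(1)] by auto
    then show False using dist(3,5) xe(1) o(1) by force
  qed
  have X: "x \<notin> ?X" if "x \<in> set zs" for x using that dist(3) Cons.prems(3) nth_mem by fastforce
  have memX: "bs ! t \<in> ?X \<longleftrightarrow> t \<in> set U" if "t < length bs" for t
    using that Cons.prems(3) dist(1) by (auto simp: nth_eq_iff_index_eq subset_iff)
  have pq: "?p = ?q \<longleftrightarrow> i = j" using ij dist(1) by (simp add: nth_eq_iff_index_eq)
  have inbs: "?p \<in> set bs" "?q \<in> set bs" using ij by auto
  have ne: "x \<noteq> ?p" "x \<noteq> ?q" if "x \<in> set zs" for x using that inbs dist(3) by auto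
  have fin: "finite ?R" by simp
  have goal: "mgf (avoid (path_edges (?p # zs @ [?q]) \<union> ?R) ?X) y = peval (code_coeffs (map code (it # its)) U) y"
  proof -
    consider (0) "i \<noteq> j" "zs = []" | (1) x where "i \<noteq> j" "zs = [x]" | (2) x z where "zs = [x, z]"
      | (3) x z w where "i = j" "zs = [x, z, w]"
    proof (cases "i = j")
      case True
      then have "length zs = 2 \<or> length zs = 3" using ij by auto
      then show thesis using 2 3 True by (auto simp: length_Suc_conv numeral_eq_Suc)
    next
      case False
      then have "length zs \<le> 2" using ij by simp
      then have "length zs = 0 \<or> length zs = 1 \<or> length zs = 2" by linarith
      then show thesis using 0 1 2 False by (auto simp: length_Suc_conv numeral_eq_Suc)
    qed
    then show ?thesis
    proof cases
      case 0
      have "{?p, ?q} \<notin> ?R"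
      proof
        assume "{?p, ?q} \<in> ?R"
        then obtain i' zs' j' where o: "(i', zs', j') \<in> set its" "{?p, ?q} \<in> path_edges (bs ! i' # zs' @ [bs ! j'])"
          by force
        have "zs' = []"
        proof (rule ccontr)
          assume "zs' \<noteq> []"
          then have "{?p, ?q} \<inter> set zs' \<noteq> {}" using path_edge_touches_inner[OF o(2)] by simp
          then have "?p \<in> set zs' \<or> ?q \<in> set zs'" by auto
          then show False using dist(6) inbs o(1) by force
        qed
        then have "{?p, ?q} = {bs ! i', bs ! j'}" using o(2) by simp
        then have "i' = i \<and> j' = j"
          using other[OF o(1)] ij dist(1) by (auto simp: doubleton_eq_iff nth_eq_iff_index_eq)
        then have "(0, i, j) \<in> set (map code its)" using o(1) \<open>zs' = []\<close> by force
        then show False using Cons.prems(2) 0 by (auto simp: shape_ok_def it)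
      qed
      from avoid_thread0[OF fin this, of ?X y] 0 show ?thesis
        using memX[of i] memX[of j] ij IH0 IHpq
        by (simp add: it Let_def)
    next
      case (1 x)
      from avoid_thread1[OF fin, of x ?X ?p ?q y] 1 fresh X ne pq show ?thesis
        using memX[of i] memX[of j] ij IH0 IHp IHq by (simp add: it Let_def)
    next
      case (2 x z)
      have "x \<noteq> z" using dist(2) 2 by simp
      with avoid_thread2[OF fin, of x z ?X ?p ?q y] 2 fresh X ne have
        "mgf (avoid (path_edges (?p # zs @ [?q]) \<union> ?R) ?X) y = mgf (avoid ?R ({} \<union> ?X)) y
         + y * mgf (avoid ?R ({} \<union> ?X)) y
         + (if ?p \<in> ?X then 0 else y * mgf (avoid ?R ({?p} \<union> ?X)) y)
         + (if ?q \<in> ?X then 0 else y * mgf (avoid ?R ({?q} \<union> ?X)) y)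
         + (if ?p = ?q \<or> ?p \<in> ?X \<or> ?q \<in> ?X then 0 else y\<^sup>2 * mgf (avoid ?R ({?p, ?q} \<union> ?X)) y)" by simp
      then show ?thesis unfolding IH0 IHp IHq IHpq
        using memX[of i] memX[of j] ij pq 2 by (auto simp: it Let_def power2_eq_square algebra_simps)
    next
      case (3 x z w)
      have "x \<noteq> z" "x \<noteq> w" "z \<noteq> w" using dist(2) 3 by auto
      with avoid_thread3[OF fin, of x z w ?X ?p y] 3 fresh X ne have
        "mgf (avoid (path_edges (?p # zs @ [?q]) \<union> ?R) ?X) y = (1 + 2 * y) * mgf (avoid ?R ({} \<union> ?X)) y
         + (if ?p \<in> ?X then 0 else 2 * y * (1 + y) * mgf (avoid ?R ({?p} \<union> ?X)) y)" by simp
      then show ?thesis unfolding IH0 IHp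
        using memX[of i] ij 3 by (auto simp: it Let_def algebra_simps)
    qed
  qed
  then show ?case by (simp add: it)
qed simp

lemma layout_mgf: "layout V E bs its \<Longrightarrow> mgf E y = peval (code_coeffs (map code its) []) y"
  using mgf_placed[of bs its "[]" y] codes_ok_shape unfolding layout_def by auto

fun pathl :: "nat list \<Rightarrow> (nat \<times> nat) list" where
  "pathl (x # y # zs) = (x, y) # pathl (y # zs)"
| "pathl _ = []"

text \<open>The coded graph on natural numbers: branch vertices come first, and inner vertices are numbered
  from \<open>s\<close> in the order of the codes.\<close>

fun build :: "nat \<Rightarrow> code list \<Rightarrow> (nat \<times> nat) list" where
  "build s [] = []"
| "build s ((a, i, j) # cs) = pathl (i # [s..<s + a] @ [j]) @ build (s + a) cs"

lemma path_edges_map: "path_edges (map f xs) = (`) f ` esets (pathl xs)"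
  by (induction xs rule: pathl.induct) (auto simp: esets_def)

lemma esets_append: "esets (xs @ ys) = esets xs \<union> esets ys"
  by (auto simp: esets_def)

lemma build_edges:
  assumes "shape_ok (length bs) (map code its)" "s = length (bs @ pre)"
  shows "(`) (nth (bs @ pre @ concat (map inner its))) ` esets (build s (map code its))
    = (\<Union>it\<in>set its. placed_edges bs it)"
  using assms
proof (induction its arbitrary: s pre)
  case Nil
  then show ?case by (simp add: esets_def)
next
  case (Cons it its)
  obtain i zs j where it: "it = (i, zs, j)" by (cases it) auto
  let ?xs = "bs @ pre @ concat (map inner (it # its))"
  have ij: "i < length bs" "j < length bs" using Cons.prems(1) by (auto simp: shape_ok_def it)
  have shape: "shape_ok (length bs) (map code its)"
    using Cons.prems(1) by (auto simp: shape_ok_def split: if_splits)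
  have "map (nth ?xs) [s..<s + length zs] = zs"
    using Cons.prems(2) by (intro nth_equalityI) (auto simp: nth_append it)
  then have "map (nth ?xs) (i # [s..<s + length zs] @ [j]) = bs ! i # zs @ [bs ! j]"
    using ij by (simp add: nth_append)
  then have 1: "(`) (nth ?xs) ` esets (pathl (i # [s..<s + length zs] @ [j])) = placed_edges bs it"
    by (simp only: path_edges_map[symmetric] it placed_edges.simps)
  have 2: "(`) (nth ?xs) ` esets (build (s + length zs) (map code its)) = (\<Union>it\<in>set its. placed_edges bs it)"
    using Cons.IH[OF shape, of "s + length zs" "pre @ zs"] Cons.prems(2) by (simp add: it)
  show ?case
    using 1 2 by (simp add: it esets_append image_Un)
qed

lemma layout_giso:
  assumes "layout V E bs its" "card V = n"
  shows "giso {..<n} (esets (build (length bs) (map code its))) V E"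
proof -
  let ?xs = "bs @ concat (map inner its)"
  have xs: "distinct ?xs" "set ?xs = V" and E: "E = (\<Union>it\<in>set its. placed_edges bs it)"
    using assms(1) unfolding layout_def by blast+
  have "length ?xs = n" using xs assms(2) distinct_card by metis
  then have "bij_betw (nth ?xs) {..<n} V" using bij_betw_nth[OF xs(1), of "{..<n}" V] xs(2) by simp
  moreover have "E = (`) (nth ?xs) ` esets (build (length bs) (map code its))"
  proof -
    have "shape_ok (length bs) (map code its)"
      using assms(1) codes_ok_shape unfolding layout_def by blast
    from build_edges[OF this, of "length bs" "[]"] show ?thesis unfolding E by simp
  qed
  ultimately show ?thesis by (auto simp: giso_def)
qed

section \<open>The search\<close>

text \<open>The edges of the extremal graphs, with the numbering of their definitions; for nine vertices
  this is the first of the two.\<close>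

definition extremal :: "nat \<Rightarrow> (nat \<times> nat) list" where
  "extremal n =
    (if n = 5 then [(0,2),(0,3),(1,2),(1,3),(2,3),(0,4),(1,4)]
     else if n = 6 then [(0,4),(0,5),(1,3),(1,4),(1,5),(2,3),(2,4),(2,5)]
     else if n = 7 then [(0,2),(0,3),(0,4),(1,2),(1,3),(1,4),(2,5),(5,6),(3,6)]
     else if n = 8 then [(0,1),(1,2),(2,3),(4,5),(5,6),(6,7),(0,4),(1,5),(2,6),(3,7)]
     else if n = 9 then [(0,1),(1,2),(3,4),(4,5),(0,3),(1,4),(2,5),(0,6),(6,7),(7,8),(3,8)]
     else if n = 10 then [(0,1),(1,2),(2,3),(0,3),(4,5),(5,6),(7,8),(8,9),(4,7),(5,8),(6,9),(0,4)]
     else if n = 11 then [(0,1),(0,3),(0,6),(1,2),(1,4),(2,3),(4,5),(5,6),(6,7),(7,8),(7,10),(8,9),(9,10)]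
     else if n = 12 then [(0,1),(1,2),(2,3),(0,3),(4,5),(5,6),(6,7),(4,7),(8,9),(9,10),(10,11),(8,11),(0,4),(1,8)]
     else [(0,1),(1,2),(2,3),(0,3),(4,5),(5,6),(6,7),(4,7),(8,9),(9,10),(10,11),(8,11),(0,12),(4,12),(8,12)])"

text \<open>Every tricyclic graph that is not extremal is bounded by one of these polynomials. The entries
  are the maximal ones among the values that the recurrences and the irreducible graphs produce,
  some of them merged or rounded up; they need not belong to a graph.\<close>

definition bounds :: "nat \<Rightarrow> int list list" where
  "bounds n = (if n = 3 then [[1,3]] else if n = 4 then [[1,6,3]]
    else if n = 5 then [[1,7,7]] else if n = 6 then [[1,8,14,3]]
    else if n = 7 then [[1,9,21,11]] else if n = 8 then [[1,10,29,26,4]]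
    else if n = 9 then [[1,11,38,47,15],[1,11,38,46,16],[1,11,37,47,16]]
    else if n = 10 then [[1,12,48,76,42,5],[1,12,47,72,40,6]]
    else if n = 11 then [[1,13,59,114,89,21],[1,13,58,110,87,22]]
    else if n = 12 then [[1,14,71,162,165,63,6],[1,14,71,161,164,64,6],[1,14,71,160,160,64,8]]
    else [[1,15,84,221,279,152,28],[1,15,84,220,278,157,30]])"

text \<open>The codes under which the search meets an extremal graph, each with an isomorphism to it.\<close>

definition extremal_codes :: "(code list \<times> nat list) list" where
  "extremal_codes =
   [([(0,0,2),(0,0,3),(2,0,3),(0,1,2),(2,1,2),(0,1,3)], [1,6,2,5,0,4,7,3]),
    ([(0,0,2),(2,0,2),(0,0,3),(0,1,2),(0,1,3),(2,1,3)], [1,6,5,2,0,4,7,3]),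
    ([(1,0,1),(0,0,2),(0,0,3),(0,1,2),(0,1,3),(1,2,3)], [1,2,4,5,3,0]),
    ([(1,0,1),(0,0,2),(0,0,3),(0,1,2),(0,1,3),(0,2,3)], [0,1,2,3,4]),
    ([(0,0,1),(0,0,3),(2,0,3),(0,1,2),(2,1,2),(0,2,3)], [1,2,6,5,0,4,3,7]),
    ([(0,0,1),(1,0,2),(0,0,3),(0,1,2),(1,1,3),(0,2,3)], [1,4,2,5,3,0]),
    ([(0,0,1),(0,0,2),(1,0,3),(1,1,2),(0,1,3),(0,2,3)], [1,4,5,2,3,0]),
    ([(0,0,1),(0,0,2),(2,0,2),(0,1,3),(2,1,3),(0,2,3)], [1,2,5,6,0,4,3,7]),
    ([(0,0,1),(2,0,1),(0,0,3),(0,1,2),(0,2,3),(2,2,3)], [1,5,6,2,0,4,7,3]),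
    ([(0,0,1),(2,0,1),(0,0,2),(0,1,3),(0,2,3),(2,2,3)], [1,5,2,6,0,4,3,7]),
    ([(3,0,0),(0,0,3),(0,1,2),(2,1,2),(1,1,3),(0,2,3)], [0,8,5,4,1,2,3,9,6,7]),
    ([(3,0,0),(0,0,3),(3,1,1),(0,1,3),(3,2,2),(0,2,3)], [0,4,8,12,1,2,3,5,6,7,9,10,11]),
    ([(3,0,0),(0,0,3),(3,1,1),(0,1,2),(0,2,3),(2,2,3)], [4,8,1,0,5,6,7,9,10,11,2,3]),
    ([(3,0,0),(0,0,2),(3,1,1),(0,1,3),(0,2,3),(2,2,3)], [4,8,0,1,5,6,7,9,10,11,3,2])]"

fun descending :: "nat list \<Rightarrow> bool" where
  "descending (a # b # xs) \<longleftrightarrow> b \<le> a \<and> descending (b # xs)"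
| "descending _ \<longleftrightarrow> True"

text \<open>No item joins \<open>S\<close> to the other branch vertices, so the coded graph is not connected
  unless \<open>S\<close> is empty or contains all of them.\<close>

definition separated :: "nat list \<Rightarrow> code list \<Rightarrow> bool" where
  "separated S cs \<longleftrightarrow> list_all (\<lambda>(a, i, j). (i \<in> set S) = (j \<in> set S)) cs"

text \<open>The test of a complete list of codes. Lists that are not sorted by weight are skipped.
  Disconnected lists are recognised separately, because the generating function of two disjoint
  theta graphs exceeds the bounds.\<close>

definition complete_ok :: "nat \<Rightarrow> code list \<Rightarrow> nat \<Rightarrow> bool" where
  "complete_ok b cs n =
    (if descending (map (weight cs) [0..<b]) then
       (let v = code_coeffs cs [] in
        if list_ex (ple v) (bounds n) then True
        else if b = 4 \<and> list_ex (\<lambda>S. separated S cs) [[0, 1], [0, 2], [0, 3]] then True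
        else case map_of extremal_codes cs of Some f \<Rightarrow> iso_check n f (build b cs) (extremal n) | None \<Rightarrow> False)
     else True)"

text \<open>The search runs through a fixed list of codes in the order of their ranks; \<open>Done t\<close>
  marks the place after which no code mentions the branch vertex \<open>t\<close>.\<close>

datatype step = Use nat nat nat | Done nat

text \<open>For each code the search decides whether to use it (once more). The list \<open>rem\<close>
  holds the degrees still to be filled, \<open>acc\<close> the codes chosen and \<open>n\<close>
  the number of vertices so far. A code with \<open>a = 0\<close> is an edge and is used at most
  once; a code \<open>(2, i, j)\<close> with distinct ends needs the edge \<open>(0, i,
  j)\<close>, which precedes it in rank.\<close>

function search :: "nat \<Rightarrow> step list \<Rightarrow> nat list \<Rightarrow> code list \<Rightarrow> nat \<Rightarrow> bool" where
  "search b [] rem acc n = complete_ok b acc n"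
| "search b (Done t # st) rem acc n = (if rem ! t = 0 then search b st rem acc n else True)"
| "search b (Use a i j # st) rem acc n =
    (if search b st rem acc n then
      (if i < length rem \<and> j < length rem \<and> rem ! i \<noteq> 0 then
        (let rem' = rem[i := rem ! i - 1] in
         if rem' ! j = 0 \<or> 13 < n + a \<or> (a = 2 \<and> i \<noteq> j \<and> (0, i, j) \<notin> set acc) then True
         else search b (if a = 0 then st else Use a i j # st) (rem'[j := rem' ! j - 1]) (acc @ [(a, i, j)]) (n + a))
       else True)
     else False)"
  by pat_completeness auto
termination
proof (relation "Wellfounded.measure (\<lambda>(b, st, rem, acc, n). length st + sum_list rem)", goal_cases)
  case (4 b a i j st rem acc n rem')
  then have "sum_list rem' = sum_list rem - 1" "length rem' = length rem"
    by (auto simp: sum_list_update)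
  moreover have "rem ! i \<le> sum_list rem" using 4 by (intro member_le_sum_list) auto
  moreover have "sum_list (rem'[j := rem' ! j - 1]) = sum_list rem' - 1"
    using 4 calculation(2) by (simp add: sum_list_update)
  ultimately show ?case using 4 by auto
qed auto

fun uses :: "step list \<Rightarrow> code set" where
  "uses [] = {}"
| "uses (Done t # st) = uses st"
| "uses (Use a i j # st) = insert (a, i, j) (uses st)"

fun steps_ok :: "step list \<Rightarrow> bool" where
  "steps_ok [] \<longleftrightarrow> True"
| "steps_ok (Done t # st) \<longleftrightarrow> (\<forall>(a, i, j)\<in>uses st. i \<noteq> t \<and> j \<noteq> t) \<and> steps_ok st"
| "steps_ok (Use a i j # st) \<longleftrightarrow> (\<forall>c\<in>uses st. rank (a, i, j) < rank c) \<and> steps_ok st"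

definition steps :: "nat \<Rightarrow> step list" where
  "steps b = concat (map (\<lambda>i. [Use 2 i i, Use 3 i i] @
     concat (map (\<lambda>j. [Use 0 i j, Use 1 i j, Use 2 i j]) [Suc i..<b]) @ [Done i]) [0..<b])"

lemma ends_Cons: "ends ((a, i, j) # cs) t = of_bool (i = t) + of_bool (j = t) + ends cs t"
  by (simp add: ends_def)

lemma ends_eq_0: "\<forall>(a, i, j)\<in>set cs. i \<noteq> t \<and> j \<noteq> t \<Longrightarrow> ends cs t = 0"
  by (induction cs) (auto simp: ends_def)

lemma codes_okD:
  assumes "codes_ok b cs" "(a, i, j) \<in> set cs"
  shows "i < b" "j < b" "a = 2 \<Longrightarrow> i \<noteq> j \<Longrightarrow> (0, i, j) \<in> set cs"
proof -
  have "i \<le> j \<and> j < b \<and> (if i = j then a = 2 \<or> a = 3 else a \<le> 2 \<and> (a = 2 \<longrightarrow> (0, i, j) \<in> set cs))"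
    using assms unfolding codes_ok_def by blast
  then show "i < b" "j < b" "a = 2 \<Longrightarrow> i \<noteq> j \<Longrightarrow> (0, i, j) \<in> set cs" by auto
qed

text \<open>A list of codes sorted by rank is reached by the search: if the current code is its head, the
  search may take it, otherwise the code does not occur at all and is passed over.\<close>

lemma search_sound:
  assumes "search b st rem acc n" "codes_ok b (acc @ rest)" "sorted (map rank (acc @ rest))"
    "set rest \<subseteq> uses st" "steps_ok st" "length rem = b" "\<And>t. t < b \<Longrightarrow> rem ! t = ends rest t"
    "n + sum_list (map fst rest) \<le> 13"  "\<forall>t. Done t \<in> set st \<longrightarrow> t < b"
  shows "complete_ok b (acc @ rest) (n + sum_list (map fst rest))"
  using assms
proof (induction b st rem acc n arbitrary: rest rule: search.induct)
  case (1 b rem acc n)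
  then show ?case by simp
next
  case (2 b t st rem acc n)
  have "\<forall>(a, i, j)\<in>set rest. i \<noteq> t \<and> j \<noteq> t"
    using "2.prems"(4,5) by auto
  then have t: "rem ! t = 0" using "2.prems"(7)[of t] "2.prems"(9) ends_eq_0 by simp
  then have "search b st rem acc n" using "2.prems"(1) by simp
  then show ?case
    using "2.IH"[OF t _ "2.prems"(2,3)] "2.prems"(4-9) by simp
next
  case (3 b a i j st rem acc n)
  let ?c = "(a, i, j)"
  show ?case
  proof (cases "?c \<in> set rest")
    case False
    have "search b st rem acc n" using "3.prems"(1) by (simp split: if_splits)
    moreover have "set rest \<subseteq> uses st" using "3.prems"(4) False by auto
    ultimately show ?thesis
      using "3.IH"(1)[OF _ "3.prems"(2,3)] "3.prems"(5-9) by simp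
  next
    case True
    obtain rest' where rest: "rest = ?c # rest'"
    proof (cases rest)
      case (Cons d ds)
      have "d = ?c"
      proof (rule ccontr)
        assume "d \<noteq> ?c"
        then have d: "d \<in> uses st" "?c \<in> set ds" using "3.prems"(4) True Cons by auto
        have "sorted (map rank (d # ds))" using "3.prems"(3) Cons by (simp add: sorted_append)
        then have "rank d \<le> rank ?c" using d(2) by (simp del: rank.simps)
        moreover have "rank ?c < rank d" using "3.prems"(5) d(1) by (simp del: rank.simps)
        ultimately show False by simp
      qed
      then show thesis using that Cons by blast
    qed (use True in simp)
    have mem: "?c \<in> set (acc @ rest)" using True by simp
    note ij = codes_okD(1,2)[OF "3.prems"(2) mem]
    define rem' where "rem' = rem[i := rem ! i - 1]"
    have ri: "rem ! i = Suc (of_bool (j = i) + ends rest' i)"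
      using "3.prems"(7)[OF ij(1)] by (simp add: rest ends_Cons)
    have r'j: "rem' ! j = Suc (ends rest' j)"
      using "3.prems"(6) "3.prems"(7)[OF ij(2)] ij ri by (cases "i = j") (auto simp: rem'_def rest ends_Cons)
    have W: "(0, i, j) \<in> set acc" if "a = 2" "i \<noteq> j"
    proof -
      have "(0, i, j) \<in> set (acc @ rest)" using codes_okD(3)[OF "3.prems"(2) mem that] .
      moreover have "sorted (map rank rest)" using "3.prems"(3) by (simp add: sorted_append)
      then have "(0, i, j) \<notin> set rest" using that by (auto simp: rest)
      ultimately show ?thesis by simp
    qed
    have na: "\<not> 13 < n + a" using "3.prems"(8) by (simp add: rest)
    \<comment> \<open>The guards of the branch that takes the code are met.\<close>
    have s1: "search b st rem acc n" using "3.prems"(1) by (simp split: if_splits)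
    have s2: "i < length rem \<and> j < length rem \<and> rem ! i \<noteq> 0" using "3.prems"(6) ij ri by simp
    have nc: "\<not> (rem' ! j = 0 \<or> 13 < n + a \<or> a = 2 \<and> i \<noteq> j \<and> (0, i, j) \<notin> set acc)"
      using r'j na W by auto
    have s3: "search b (if a = 0 then st else Use a i j # st) (rem'[j := rem' ! j - 1]) (acc @ [?c]) (n + a)"
      using "3.prems"(1) s1 s2 nc unfolding search.simps(3) Let_def rem'_def by (simp only: if_True if_False simp_thms)
    have "complete_ok b ((acc @ [?c]) @ rest') (n + a + sum_list (map fst rest'))"
    proof (rule "3.IH"(2)[OF s1 s2 rem'_def nc s3])
      show "codes_ok b ((acc @ [?c]) @ rest')" "sorted (map rank ((acc @ [?c]) @ rest'))"
        using "3.prems"(2,3) by (simp_all add: rest)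
      show "set rest' \<subseteq> uses (if a = 0 then st else Use a i j # st)"
      proof (cases "a = 0")
        case True
        then have "?c \<notin> set rest'" using "3.prems"(2) by (auto simp: codes_ok_def rest)
        then show ?thesis using "3.prems"(4) True by (auto simp: rest)
      qed (use "3.prems"(4) rest in auto)
      show "steps_ok (if a = 0 then st else Use a i j # st)" using "3.prems"(5) by auto
      show "length (rem'[j := rem' ! j - 1]) = b" using "3.prems"(6) by (simp add: rem'_def)
      show "rem'[j := rem' ! j - 1] ! t = ends rest' t" if t: "t < b" for t
        using "3.prems"(6) "3.prems"(7)[OF t] t ij r'j ri
        by (auto simp: rem'_def rest ends_Cons nth_list_update)
      show "n + a + sum_list (map fst rest') \<le> 13" using "3.prems"(8) by (simp add: rest)
      show "\<forall>t. Done t \<in> set (if a = 0 then st else Use a i j # st) \<longrightarrow> t < b"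
        using "3.prems"(9) by auto
    qed
    then show ?thesis by (simp add: rest add.assoc)
  qed
qed

text \<open>With \<open>b\<close> branch vertices the degrees are at least 3 and add up to \<open>2 (b +
  2)\<close>. These are all possibilities except four vertices of degree 3, which make up most of
  the search.\<close>

definition degree_seqs :: "nat list list" where
  "degree_seqs = [[6], [5,3], [3,5], [4,4], [4,3,3], [3,4,3], [3,3,4]]"

lemma search_multi: "list_all (\<lambda>rem. let b = length rem in search b (steps b) rem [] b) degree_seqs"
  by code_simp

lemma search_cubic: "list_all (\<lambda>rem. let b = length rem in search b (steps b) rem [] b) [[3,3,3,3]]"
  by code_simp

lemma uses_append [simp]: "uses (xs @ ys) = uses xs \<union> uses ys"
  by (induction xs rule: uses.induct) auto

lemma uses_concat [simp]: "uses (concat xss) = (\<Union>xs\<in>set xss. uses xs)"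
  by (induction xss) auto

lemma Done_steps: "Done t \<in> set (steps b) \<longleftrightarrow> t < b"
  by (auto simp: steps_def)

lemma steps_ok_steps: "b \<in> {1, 2, 3, 4} \<Longrightarrow> steps_ok (steps b)"
proof -
  have "list_all (\<lambda>b. steps_ok (steps b)) [1, 2, 3, 4]" by code_simp
  then show "b \<in> {1, 2, 3, 4} \<Longrightarrow> steps_ok (steps b)" by auto
qed

lemma codes_in_steps: "codes_ok b cs \<Longrightarrow> set cs \<subseteq> uses (steps b)"
proof
  fix c assume *: "codes_ok b cs" "c \<in> set cs"
  obtain a i j where c: "c = (a, i, j)" by (cases c)
  have "i \<le> j \<and> j < b \<and> (if i = j then a = 2 \<or> a = 3 else a \<le> 2)"
    using codes_ok_shape[OF *(1)] *(2) unfolding shape_ok_def c by fast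
  moreover have "a = 0 \<or> a = 1 \<or> a = 2" if "a \<le> 2" using that by linarith
  ultimately show "c \<in> uses (steps b)"
    by (cases "i = j") (auto simp: steps_def c)
qed

text \<open>Each of the \<open>b\<close> degrees is at least 3, hence \<open>3 b \<le> 2 b + 4\<close> and
  \<open>b \<le> 4\<close>.\<close>

lemma degree_sequences:
  assumes "length ds = b" "\<forall>d\<in>set ds. 3 \<le> d" "sum_list ds = 2 * (b + 2)"
  shows "b \<in> {1, 2, 3, 4} \<and>
    ds \<in> set (degree_seqs @ [[3,3,3,3]])"
proof -
  have "3 * length xs \<le> sum_list xs" if "\<forall>d\<in>set xs. 3 \<le> d" for xs :: "nat list"
    using that by (induction xs) auto
  then have "b \<le> 4" using assms by force
  moreover have "b \<noteq> 0" using assms by auto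
  ultimately consider "b = 1" | "b = 2" | "b = 3" | "b = 4" by linarith
  then show ?thesis
  proof cases
    case 1
    then show ?thesis using assms by (auto simp: length_Suc_conv degree_seqs_def)
  next
    case 2
    then obtain x y where "ds = [x, y]" using assms(1) by (auto simp: length_Suc_conv numeral_eq_Suc)
    then show ?thesis using assms 2 by (auto simp: degree_seqs_def)
  next
    case 3
    then obtain x y z where ds: "ds = [x, y, z]" using assms(1) by (auto simp: length_Suc_conv numeral_eq_Suc)
    then have "3 \<le> x" "3 \<le> y" "3 \<le> z" "x + y + z = 10" using assms 3 by auto
    then have "x = 4 \<and> y = 3 \<and> z = 3 \<or> x = 3 \<and> y = 4 \<and> z = 3 \<or> x = 3 \<and> y = 3 \<and> z = 4" by presburger
    then show ?thesis using ds 3 by (auto simp: degree_seqs_def)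
  next
    case 4
    then obtain x y z w where ds: "ds = [x, y, z, w]" using assms(1) by (auto simp: length_Suc_conv numeral_eq_Suc)
    then have "3 \<le> x" "3 \<le> y" "3 \<le> z" "3 \<le> w" "x + y + z + w = 12" using assms 4 by auto
    then have "x = 3 \<and> y = 3 \<and> z = 3 \<and> w = 3" by presburger
    then show ?thesis using ds 4 by (auto simp: degree_seqs_def)
  qed
qed

lemma descendingI: "(\<And>t. Suc t < length xs \<Longrightarrow> xs ! Suc t \<le> xs ! t) \<Longrightarrow> descending xs"
proof (induction xs rule: descending.induct)
  case (1 a b xs)
  then have "descending (b # xs)" by (metis Suc_less_eq length_Cons nth_Cons_Suc)
  moreover have "b \<le> a" using 1(2)[of 0] by simp
  ultimately show ?case by simp
qed auto

section \<open>Classification of the irreducible graphs\<close>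

lemma giso_sgraph:
  assumes "giso A F V E" "sgraph V E" "finite A" "\<And>e. e \<in> F \<Longrightarrow> e \<subseteq> A \<and> card e \<le> 2"
  shows "sgraph A F"
  unfolding sgraph_def
proof (intro conjI ballI)
  fix e assume e: "e \<in> F"
  obtain f where "E = (`) f ` F" using assms(1) by (auto simp: giso_def)
  then have "card (f ` e) = 2" using e assms(2) by (auto simp: sgraph_def)
  moreover have "finite e" using assms(3,4) e finite_subset by blast
  ultimately have "2 \<le> card e" using card_image_le by metis
  then show "card e = 2" using assms(4)[OF e] by simp
qed (use assms in auto)

text \<open>The codes of the graph are among those inspected by the search.\<close>

lemma (in irreducible) classification:
  assumes "card V \<le> 13"
  shows "(\<exists>p\<in>set (bounds (card V)). bounded_by E p) \<or> giso V E {..<card V} (esets (extremal (card V)))"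
proof -
  obtain bs its where lay: "layout V E bs its" and len: "length its = length bs + 2"
    and deg: "\<forall>t<length bs. 3 \<le> ends (map code its) t"
    and sorted: "sorted (map rank (map code its))"
    and wt: "\<forall>t. Suc t < length bs \<longrightarrow> weight (map code its) (Suc t) \<le> weight (map code its) t"
    and n: "card V = length bs + (\<Sum>c\<leftarrow>map code its. fst c)"
    using layout_exists by blast
  define cs where "cs = map code its"
  define b where "b = length bs"
  define rem where "rem = map (ends cs) [0..<b]"
  have ok: "codes_ok b cs" using lay by (simp add: layout_def b_def cs_def)
  have "sum_list rem = (\<Sum>t<b. ends cs t)"
    by (simp add: rem_def interv_sum_list_conv_sum_set_nat atLeast0LessThan)
  then have "sum_list rem = 2 * (b + 2)"
    using sum_ends[OF ok] len by (simp add: cs_def b_def)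
  moreover have "\<forall>d\<in>set rem. 3 \<le> d" using deg by (auto simp: rem_def cs_def b_def)
  ultimately have b: "b \<in> {1, 2, 3, 4}"
    and rem: "rem \<in> set (degree_seqs @ [[3,3,3,3]])"
    using degree_sequences[of rem b] by (auto simp: rem_def)
  have "length rem = b" by (simp add: rem_def)
  then have "search b (steps b) rem [] b"
    using rem search_multi search_cubic unfolding list_all_iff Let_def set_append Un_iff by blast
  then have "complete_ok b ([] @ cs) (b + sum_list (map fst cs))"
    by (rule search_sound)
       (use ok sorted codes_in_steps[OF ok] steps_ok_steps[OF b] n assms in
         \<open>auto simp: rem_def cs_def b_def Done_steps\<close>)
  then have leaf: "complete_ok b cs (card V)" using n by (simp add: cs_def b_def)
  have desc: "descending (map (weight cs) [0..<b])"
    using wt by (intro descendingI) (auto simp: cs_def b_def)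
  have mgf: "mgf E y = peval (code_coeffs cs []) y" for y
    using layout_mgf[OF lay] by (simp add: cs_def)
  \<comment> \<open>With four branch vertices these three sets and their complements are all splittings into pairs.\<close>
  have "\<not> separated S cs" if S: "b = 4" "S \<in> {[0, 1], [0, 2], [0, 3]}" for S
  proof
    assume "separated S cs"
    then have "set S = {..<b}"
      using S unfolding b_def
      by (intro layout_connected[OF lay G(2)]) (auto simp: separated_def list_all_iff cs_def)
    then have "card (set S) = 4" using S by simp
    then show False using S by auto
  qed
  then have "list_ex (ple (code_coeffs cs [])) (bounds (card V)) \<or>
      (\<exists>f. iso_check (card V) f (build b cs) (extremal (card V)))"
    using leaf desc by (auto simp: complete_ok_def Let_def split: if_splits option.splits)
  then show ?thesis
  proof
    assume "list_ex (ple (code_coeffs cs [])) (bounds (card V))"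
    then obtain p where "p \<in> set (bounds (card V))" "ple (code_coeffs cs []) p" by (auto simp: list_ex_iff)
    then show ?thesis using peval_mono mgf by (auto simp: bounded_by_def)
  next
    assume "\<exists>f. iso_check (card V) f (build b cs) (extremal (card V))"
    then obtain f where check: "iso_check (card V) f (build b cs) (extremal (card V))" by blast
    then have 1: "giso {..<card V} (esets (build b cs)) {..<card V} (esets (extremal (card V)))"
      using iso_check by blast
    have 2: "giso {..<card V} (esets (build b cs)) V E"
      using layout_giso[OF lay refl] by (simp add: b_def cs_def)
    have "sgraph {..<card V} (esets (build b cs))"
    proof (rule giso_sgraph[OF 2 G(1)])
      fix e assume "e \<in> esets (build b cs)"
      then obtain i j where "(i, j) \<in> set (build b cs)" "e = {i, j}" by (auto simp: esets_def)
      then show "e \<subseteq> {..<card V} \<and> card e \<le> 2"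
        using check by (auto simp: iso_check_def list_all_iff card_insert_if)
    qed simp
    then show ?thesis using giso_trans[OF giso_sym[OF 2] 1] by blast
  qed
qed

section \<open>Extensions of extremal graphs\<close>

definition extremal9' :: "(nat \<times> nat) list" where
  "extremal9' = [(0,2),(0,3),(0,4),(1,2),(1,3),(1,4),(2,5),(5,6),(6,7),(7,8),(3,8)]"

definition extremals :: "nat \<Rightarrow> (nat \<times> nat) list list" where
  "extremals n = (if n < 5 then [] else if n = 9 then [extremal n, extremal9'] else [extremal n])"

definition settled :: "nat \<Rightarrow> 'a set \<Rightarrow> 'a set set \<Rightarrow> bool" where
  "settled n V E \<longleftrightarrow> (\<exists>p\<in>set (bounds n). bounded_by E p) \<or> (\<exists>es\<in>set (extremals n). giso V E {..<n} (esets es))"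

text \<open>These lists bound all tricyclic graphs, the extremal ones included.\<close>

definition all_bounds :: "nat \<Rightarrow> int list list" where
  "all_bounds n = bounds n @ map matching_coeffs (extremals n)"

lemma extremals_ok:
  "es \<in> set (extremals n) \<Longrightarrow> 5 \<le> n \<Longrightarrow> n \<le> 13 \<Longrightarrow> simple_edges n es \<and> distinct_edges es"
proof -
  have "list_all (\<lambda>n. list_all (\<lambda>es. simple_edges n es \<and> distinct_edges es) (extremals n)) [5,6,7,8,9,10,11,12,13]"
    by code_simp
  moreover assume "es \<in> set (extremals n)" "5 \<le> n" "n \<le> 13"
  moreover from this have "n \<in> set [5,6,7,8,9,10,11,12,13]" by auto
  ultimately show ?thesis unfolding list_all_iff by blast
qed

lemma settled_bounded:
  assumes "settled n V E" "sgraph V E" "n \<le> 13"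
  shows "\<exists>p\<in>set (all_bounds n). bounded_by E p"
  using assms(1) unfolding settled_def
proof
  assume "\<exists>es\<in>set (extremals n). giso V E {..<n} (esets es)"
  then obtain es where es: "es \<in> set (extremals n)" "giso V E {..<n} (esets es)" by blast
  then have "5 \<le> n" by (auto simp: extremals_def split: if_splits)
  then have "mgf E y = peval (matching_coeffs es) y" for y
    using giso_mgf[OF es(2) assms(2)] extremals_ok[OF es(1)] assms(3) mgf_esets by metis
  then show ?thesis using es(1) by (auto simp: all_bounds_def bounded_by_def)
qed (auto simp: all_bounds_def)

text \<open>Deleting edges does not increase \<open>mgf\<close>, so the complete graph is the worst case.\<close>

lemma sgraph_sub_complete:
  assumes "sgraph V E" "card V = m"
    and K: "\<And>i j. i < m \<Longrightarrow> j < m \<Longrightarrow> i \<noteq> j \<Longrightarrow> {i, j} \<in> esets ks" "distinct_edges ks" "simple_edges m ks"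
  shows "bounded_by E (matching_coeffs ks)"
proof -
  have "finite V" using assms(1) sgraphD by blast
  then obtain xs where xs: "set xs = V" "distinct xs" using finite_distinct_list by blast
  have len: "length xs = m" using xs assms(2) distinct_card by metis
  have "inj_on (nth xs) (\<Union>(esets ks))"
  proof (rule inj_on_subset)
    show "inj_on (nth xs) {..<m}" using xs(2) len by (auto simp: inj_on_def nth_eq_iff_index_eq)
    show "\<Union>(esets ks) \<subseteq> {..<m}" using K(3) by (auto simp: esets_def simple_edges_def list_all_iff)
  qed
  then have mgf: "mgf ((`) (nth xs) ` esets ks) y = peval (matching_coeffs ks) y" for y
    using mgf_esets[OF K(2)] by (simp add: mgf_image)
  have "E \<subseteq> (`) (nth xs) ` esets ks"
  proof
    fix e assume "e \<in> E"
    then obtain u v where uv: "e = {u, v}" "u \<in> V" "v \<in> V" "u \<noteq> v" using sgraphD(4)[OF assms(1)] by blast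
    then obtain i j where "i < m" "j < m" "u = xs ! i" "v = xs ! j"
      using xs(1) len by (auto simp: in_set_conv_nth)
    then show "e \<in> (`) (nth xs) ` esets ks" using uv K(1)[of i j] by (auto intro!: image_eqI[of _ _ "{i, j}"])
  qed
  moreover have "finite ((`) (nth xs) ` esets ks)" by (simp add: esets_def)
  ultimately show ?thesis using mgf_mono mgf by (metis bounded_by_def)
qed

lemma bounded_3: "sgraph V E \<Longrightarrow> card V = 3 \<Longrightarrow> bounded_by E [1,3]"
proof -
  assume *: "sgraph V E" "card V = 3"
  have "bounded_by E (matching_coeffs [(0,1),(0,2),(1,2)])"
    by (rule sgraph_sub_complete[OF *])
       (auto simp: esets_def simple_edges_def numeral_eq_Suc less_Suc_eq doubleton_eq_iff)
  moreover have "matching_coeffs [(0,1),(0,2),(1,2)] = [1,3]" by code_simp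
  ultimately show ?thesis by simp
qed

lemma bounded_4: "sgraph V E \<Longrightarrow> card V = 4 \<Longrightarrow> bounded_by E [1,6,3]"
proof -
  assume *: "sgraph V E" "card V = 4"
  have "bounded_by E (matching_coeffs [(0,1),(0,2),(0,3),(1,2),(1,3),(2,3)])"
    by (rule sgraph_sub_complete[OF *])
       (auto simp: esets_def simple_edges_def numeral_eq_Suc less_Suc_eq doubleton_eq_iff)
  moreover have "matching_coeffs [(0,1),(0,2),(0,3),(1,2),(1,3),(2,3)] = [1,6,3]" by code_simp
  ultimately show ?thesis by simp
qed

lemma settled_small: "sgraph V E \<Longrightarrow> card V = n \<Longrightarrow> n = 3 \<or> n = 4 \<Longrightarrow> settled n V E"
  using bounded_3 bounded_4 by (auto simp: settled_def bounds_def)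

lemma giso_Diff:
  assumes "bij_betw f V W" "F = (`) f ` E" "sgraph V E" "{a, b} \<in> E"
  shows "(`) f ` (E - {{a, b}}) = F - {{f a, f b}}"
proof -
  have "inj_on ((`) f) (Pow V)" using assms(1) by (simp add: bij_betw_def inj_on_image_Pow)
  moreover have "E \<subseteq> Pow V" using assms(3) by (auto simp: sgraph_def)
  ultimately have "inj_on ((`) f) E" by (rule inj_on_subset)
  then show ?thesis using assms(2,4) by (simp add: inj_on_image_set_diff)
qed

lemma fun_upd_image_edges: "\<forall>e\<in>E. y \<notin> e \<Longrightarrow> (`) (f(y := z)) ` E = (`) f ` E"
  by (intro image_cong refl) (auto intro!: image_cong)

lemma bij_betw_extend: "bij_betw f V W \<Longrightarrow> y \<notin> V \<Longrightarrow> z \<notin> W \<Longrightarrow> bij_betw (f(y := z)) (insert y V) (insert z W)"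
  by (auto simp: bij_betw_def inj_on_def)

definition remove_edge :: "nat \<times> nat \<Rightarrow> (nat \<times> nat) list \<Rightarrow> (nat \<times> nat) list" where
  "remove_edge e es = filter (\<lambda>e'. e' \<noteq> e) es"

text \<open>Without repeated edges, removing the pair \<open>(i, j)\<close> removes the edge.\<close>

lemma esets_remove:
  assumes "distinct_edges es" "(i, j) \<in> set es"
  shows "esets (remove_edge (i, j) es) = esets es - {{i, j}}"
proof -
  have "(a, b) = (i, j)" if "(a, b) \<in> set es" "{a, b} = {i, j}" for a b
    using assms that
    by (induction es rule: distinct_edges.induct) (auto simp: doubleton_eq_iff)
  then show ?thesis unfolding esets_def remove_edge_def by fastforce
qed

text \<open>If shortening a thread by one vertex yields a copy of the graph \<open>es\<close>, the original
  graph arises from \<open>es\<close> by subdividing an edge.\<close>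

lemma subdivide_giso:
  assumes iso: "giso V E {..<m} (esets es)" and G: "sgraph V E" "{x, r} \<in> E" "y \<notin> V" "distinct_edges es"
  shows "\<exists>(i, j)\<in>set es. giso (insert y V) (insert {x, y} (insert {y, r} (E - {{x, r}})))
     {..<Suc m} (esets ((i, m) # (m, j) # remove_edge (i, j) es))"
proof -
  obtain f where f: "bij_betw f V {..<m}" "esets es = (`) f ` E" using iso by (auto simp: giso_def)
  have "f ` {x, r} \<in> esets es" using G(2) f(2) by blast
  then obtain i j where ij: "(i, j) \<in> set es" "{i, j} = {f x, f r}" by (auto simp: esets_def)
  have xr: "x \<in> V" "r \<in> V" using sgraphD(3)[OF G(1,2)] by auto
  then have neq: "x \<noteq> y" "r \<noteq> y" using G(3) by auto
  let ?f = "f(y := m)"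
  have bij: "bij_betw ?f (insert y V) {..<Suc m}"
    using bij_betw_extend[OF f(1) G(3), of m] by (simp add: lessThan_Suc)
  have "(`) ?f ` (E - {{x, r}}) = (`) f ` (E - {{x, r}})"
    using G(1,3) by (intro fun_upd_image_edges) (auto simp: sgraph_def)
  also have "\<dots> = esets (remove_edge (i, j) es)"
    using giso_Diff[OF f(1,2) G(1,2)] esets_remove[OF G(4) ij(1)] ij(2) by simp
  finally have "(`) ?f ` insert {x, y} (insert {y, r} (E - {{x, r}}))
      = insert {f x, m} (insert {m, f r} (esets (remove_edge (i, j) es)))"
    using neq by (simp add: insert_commute)
  also have "\<dots> = esets ((i, m) # (m, j) # remove_edge (i, j) es)"
    using ij(2) by (auto simp: esets_def doubleton_eq_iff insert_commute)
  finally have "giso (insert y V) (insert {x, y} (insert {y, r} (E - {{x, r}})))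
     {..<Suc m} (esets ((i, m) # (m, j) # remove_edge (i, j) es))"
    using bij unfolding giso_def by metis
  then show ?thesis using ij(1) by blast
qed

text \<open>The same for a thread shortened by two vertices. The two new vertices are numbered according to
  the direction in which the edge is listed in \<open>es\<close>.\<close>

lemma subdivide2_giso:
  assumes iso: "giso V E {..<m} (esets es)" and G: "sgraph V E" "{p, r} \<in> E" "x \<notin> V" "y \<notin> V" "x \<noteq> y" "distinct_edges es"
  shows "\<exists>(i, j)\<in>set es. giso (insert x (insert y V)) (insert {p, x} (insert {x, y} (insert {y, r} (E - {{p, r}}))))
     {..<Suc (Suc m)} (esets ((i, m) # (m, Suc m) # (Suc m, j) # remove_edge (i, j) es))"
proof -
  obtain f where f: "bij_betw f V {..<m}" "esets es = (`) f ` E" using iso by (auto simp: giso_def)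
  have "f ` {p, r} \<in> esets es" using G(2) f(2) by blast
  then obtain i j where ij: "(i, j) \<in> set es" "{i, j} = {f p, f r}" by (auto simp: esets_def)
  have "p \<in> V" "r \<in> V" using sgraphD(3)[OF G(1,2)] by auto
  then have neq: "p \<noteq> x" "r \<noteq> x" "p \<noteq> y" "r \<noteq> y" using G by auto
  \<comment> \<open>The listed edge (i, j) may run against the direction from p to r.\<close>
  define a b where "a = (if i = f p then m else Suc m)" and "b = (if i = f p then Suc m else m)"
  let ?f = "(f(y := b))(x := a)"
  have ab: "{a, b} = {m, Suc m}" "a \<noteq> b" "a \<ge> m" "b \<ge> m" by (auto simp: a_def b_def)
  have "bij_betw ?f (insert x (insert y V)) (insert a (insert b {..<m}))"
    using ab G by (intro bij_betw_extend f(1)) auto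
  moreover have "insert a (insert b {..<m}) = {..<Suc (Suc m)}" using ab(1) by (auto simp: lessThan_Suc)
  ultimately have bij: "bij_betw ?f (insert x (insert y V)) {..<Suc (Suc m)}" by simp
  have "(`) ?f ` (E - {{p, r}}) = (`) f ` (E - {{p, r}})"
    using G(1,3,4) by (subst fun_upd_image_edges, force simp: sgraph_def, subst fun_upd_image_edges)
      (auto simp: sgraph_def)
  also have "\<dots> = esets (remove_edge (i, j) es)"
    using giso_Diff[OF f(1,2) G(1,2)] esets_remove[OF G(6) ij(1)] ij(2) by simp
  finally have "(`) ?f ` insert {p, x} (insert {x, y} (insert {y, r} (E - {{p, r}})))
      = insert {f p, a} (insert {a, b} (insert {b, f r} (esets (remove_edge (i, j) es))))"
    using neq G(5) by (simp add: insert_commute)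
  also have "\<dots> = esets ((i, m) # (m, Suc m) # (Suc m, j) # remove_edge (i, j) es)"
    using ij(2) by (auto simp: esets_def doubleton_eq_iff insert_commute a_def b_def)
  finally have "giso (insert x (insert y V)) (insert {p, x} (insert {x, y} (insert {y, r} (E - {{p, r}}))))
     {..<Suc (Suc m)} (esets ((i, m) # (m, Suc m) # (Suc m, j) # remove_edge (i, j) es))"
    using bij unfolding giso_def by metis
  then show ?thesis using ij(1) by blast
qed

lemma pendant_giso:
  assumes iso: "giso V E {..<m} (esets es)" and G: "sgraph V E" "u \<in> V" "v \<notin> V"
  shows "\<exists>i<m. giso (insert v V) (insert {v, u} E) {..<Suc m} (esets ((m, i) # es))"
proof -
  obtain f where f: "bij_betw f V {..<m}" "esets es = (`) f ` E" using iso by (auto simp: giso_def)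
  let ?f = "f(v := m)"
  have bij: "bij_betw ?f (insert v V) {..<Suc m}"
    using bij_betw_extend[OF f(1) G(3), of m] by (simp add: lessThan_Suc)
  have "(`) ?f ` E = esets es"
    unfolding f(2) using G(1,3) by (intro fun_upd_image_edges) (auto simp: sgraph_def)
  then have "(`) ?f ` insert {v, u} E = esets ((m, f u) # es)"
    using G by (auto simp: esets_def)
  then have "giso (insert v V) (insert {v, u} E) {..<Suc m} (esets ((m, f u) # es))"
    using bij unfolding giso_def by metis
  moreover have "f u < m" using f(1) G(2) by (auto simp: bij_betw_def)
  ultimately show ?thesis by blast
qed

lemma pendant2_giso:
  assumes iso: "giso V E {..<m} (esets es)" and G: "sgraph V E" "w \<in> V" "v \<notin> V" "u \<notin> V" "u \<noteq> v"
  shows "\<exists>i<m. giso (insert v (insert u V)) (insert {v, u} (insert {u, w} E)) {..<Suc (Suc m)}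
    (esets ((Suc m, m) # (m, i) # es))"
proof -
  obtain f where f: "bij_betw f V {..<m}" "esets es = (`) f ` E" using iso by (auto simp: giso_def)
  let ?f = "(f(u := m))(v := Suc m)"
  have "bij_betw ?f (insert v (insert u V)) (insert (Suc m) (insert m {..<m}))"
    using G by (intro bij_betw_extend f(1)) auto
  then have bij: "bij_betw ?f (insert v (insert u V)) {..<Suc (Suc m)}"
    by (simp add: lessThan_Suc)
  have "(`) ?f ` E = esets es"
    unfolding f(2) using G(1,3,4) by (subst fun_upd_image_edges, force simp: sgraph_def, subst fun_upd_image_edges)
      (auto simp: sgraph_def)
  then have "(`) ?f ` insert {v, u} (insert {u, w} E) = esets ((Suc m, m) # (m, f w) # es)"
    using G by (auto simp: esets_def)
  then have "giso (insert v (insert u V)) (insert {v, u} (insert {u, w} E)) {..<Suc (Suc m)}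
    (esets ((Suc m, m) # (m, f w) # es))"
    using bij unfolding giso_def by metis
  moreover have "f w < m" using f(1) G(2) by (auto simp: bij_betw_def)
  ultimately show ?thesis by blast
qed

text \<open>Isomorphisms from those extensions of extremal graphs that are extremal again.\<close>

definition witnesses :: "nat \<Rightarrow> (nat list \<times> (nat \<times> nat) list) list" where
  "witnesses n =
   (if n = 7 then [([5,0,1,4,3,2,6], extremal 7), ([5,0,1,4,2,3,6], extremal 7),
      ([4,2,3,6,0,1,5], extremal 7), ([4,2,3,5,0,1,6], extremal 7)]
    else if n = 9 then [([7,3,4,5,6,0,1,2,8], extremal 9), ([2,1,0,7,5,4,3,8,6], extremal 9),
      ([6,0,1,2,7,3,4,5,8], extremal 9), ([2,1,0,6,5,4,3,7,8], extremal 9),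
      ([6,0,1,2,8,3,4,5,7], extremal 9), ([2,1,0,6,5,4,3,8,7], extremal 9),
      ([0,1,2,3,4,7,8,5,6], extremal9'), ([0,1,2,3,4,5,8,6,7], extremal9'), ([0,1,2,3,4,5,6,8,7], extremal9')]
    else if n = 11 then [([7,8,9,10,6,0,3,5,1,2,4], extremal 11), ([7,8,9,10,6,0,3,4,1,2,5], extremal 11)]
    else [])"

definition settled_edges :: "nat \<Rightarrow> (nat \<times> nat) list \<Rightarrow> bool" where
  "settled_edges n es \<longleftrightarrow> simple_edges n es \<and> distinct_edges es \<and>
     (if list_ex (ple (matching_coeffs es)) (bounds n) then True
      else list_ex (\<lambda>(f, fs). iso_check n f es fs) (witnesses n))"

lemma settled_edges:
  assumes "settled_edges n es" "giso V E {..<n} (esets es)" "sgraph V E"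
  shows "settled n V E"
proof -
  have es: "simple_edges n es" "distinct_edges es" using assms(1) by (auto simp: settled_edges_def)
  consider p where "p \<in> set (bounds n)" "ple (matching_coeffs es) p"
    | f fs where "(f, fs) \<in> set (witnesses n)" "iso_check n f es fs"
    using assms(1) by (auto simp: settled_edges_def list_ex_iff split: if_splits)
  then show ?thesis
  proof cases
    case 1
    then have "bounded_by E p"
      using mgf_esets[OF es(2)] giso_mgf[OF assms(2,3)] peval_mono unfolding bounded_by_def by metis
    then show ?thesis using 1 by (auto simp: settled_def)
  next
    case 2
    have "fs \<in> set (extremals n)"
      using 2(1) by (auto simp: witnesses_def extremals_def split: if_splits)
    moreover have "giso V E {..<n} (esets fs)"
      using giso_trans[OF assms(2) iso_check[OF 2(2)]] .
    ultimately show ?thesis by (auto simp: settled_def)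
  qed
qed

text \<open>The extensions by one vertex of the extremal graphs of orders 6, 8 and 10: subdivisions and
  pendant vertices.\<close>

lemma extensions_settled:
  "list_all (\<lambda>m. list_all (\<lambda>(i, j). settled_edges (Suc m) ((i, m) # (m, j) # remove_edge (i, j) (extremal m))) (extremal m)
     \<and> list_all (\<lambda>i. settled_edges (Suc m) ((m, i) # extremal m)) [0..<m]) [6, 8, 10]"
  by code_simp

text \<open>The extensions by two vertices of the extremal graph of order 7: double subdivisions and pendant
  paths.\<close>

lemma extensions2_settled:
  "list_all (\<lambda>(i, j). settled_edges 9 ((i, 7) # (7, 8) # (8, j) # remove_edge (i, j) (extremal 7))) (extremal 7)
     \<and> list_all (\<lambda>i. settled_edges 9 ((8, 7) # (7, i) # extremal 7)) [0..<7]"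
  by code_simp

lemma remove_edge_bound: "list_all (\<lambda>e. ple (matching_coeffs (remove_edge e (extremal 7))) [1,8,21,12]) (extremal 7)"
  by code_simp

definition sum_ok :: "nat \<Rightarrow> int list \<Rightarrow> int list \<Rightarrow> bool" where
  "sum_ok n p q \<longleftrightarrow> list_ex (ple (padd p (0 # q))) (bounds n)"

text \<open>For these orders every sum of bounds is again below a bound.\<close>

lemma sums_generic:
  "list_all (\<lambda>n. list_all (\<lambda>p. list_all (sum_ok n p) (all_bounds (n - 2))) (all_bounds (n - 1))) [5,6,8,10,12,13]"
  by code_simp

text \<open>For these orders the first summand must not come from an extremal graph.\<close>

lemma sums_special:
  "list_all (\<lambda>n. list_all (\<lambda>p. list_all (sum_ok n p) (all_bounds (n - 2))) (bounds (n - 1))) [7,11]"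
  by code_simp

text \<open>For order 9 the second summand must not come from the extremal graph either. The polynomial
  \<open>1 + 8 y + 21 y^2 + 12 y^3\<close> bounds its proper subgraphs.\<close>

lemma sums_9: "list_all (\<lambda>p. list_all (sum_ok 9 p) ([1,8,21,12] # bounds 7)) (bounds 8)"
  by code_simp

section \<open>The induction on the order\<close>

lemma bounded_by_subset: "bounded_by F p \<Longrightarrow> E \<subseteq> F \<Longrightarrow> finite F \<Longrightarrow> bounded_by E p"
  unfolding bounded_by_def using mgf_mono order_trans by blast

lemma settledI_sum:
  assumes "\<And>y::real. mgf E y = mgf F y + y * mgf H y" "bounded_by F p" "bounded_by H q" "sum_ok n p q"
  shows "settled n V E"
proof -
  have "bounded_by E (padd p (0 # q))"
    using assms(1-3) by (intro bounded_by_sum) auto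
  then show ?thesis
    using assms(4) bounded_by_mono unfolding settled_def sum_ok_def list_ex_iff by blast
qed

text \<open>The common part of the cases of a leaf and of a thread: \<open>F\<close> and \<open>H\<close>
  are the edge sets of the two smaller graphs. The last two assumptions take care of the orders
  for which the sums of bounds do not suffice.\<close>

lemma settled_combine:
  assumes n: "5 \<le> n" "n \<le> 13"
    and mgf: "\<And>y::real. mgf E y = mgf F y + y * mgf H y"
    and F: "settled (n - 1) W F" "sgraph W F" and H: "\<exists>q\<in>set (all_bounds (n - 2)). bounded_by H q"
    and special: "n \<in> {7, 9, 11} \<Longrightarrow> giso W F {..<n - 1} (esets (extremal (n - 1))) \<Longrightarrow> settled n V E"
    and two_maxima_of_order_9: "n = 9 \<Longrightarrow> settled n V E \<or> (\<exists>q\<in>set ([1,8,21,12] # bounds 7). bounded_by H q)"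
  shows "settled n V E"
proof (cases "n \<in> {7, 9, 11}")
  case False
  then have n': "n \<in> set [5,6,8,10,12,13]" using n by auto
  obtain p where p: "p \<in> set (all_bounds (n - 1))" "bounded_by F p"
    using settled_bounded[OF F diff_le_self[THEN order_trans, OF n(2)]] by blast
  obtain q where q: "q \<in> set (all_bounds (n - 2))" "bounded_by H q" using H by blast
  have "sum_ok n p q" using sums_generic n' p(1) q(1) unfolding list_all_iff by blast
  then show ?thesis using settledI_sum[OF mgf p(2) q(2)] by blast
next
  case True
  show ?thesis
  proof (cases "\<exists>p\<in>set (bounds (n - 1)). bounded_by F p")
    case False
    then have "giso W F {..<n - 1} (esets (extremal (n - 1)))"
      using F(1) True by (auto simp: settled_def extremals_def split: if_splits)
    then show ?thesis using special True by blast
  next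
    case p: True
    then obtain p where p: "p \<in> set (bounds (n - 1))" "bounded_by F p" by blast
    show ?thesis
    proof (cases "n = 9")
      case True
      show ?thesis
      proof (cases "settled n V E")
        case False
        then obtain q where q: "q \<in> set ([1,8,21,12] # bounds 7)" "bounded_by H q" using two_maxima_of_order_9 True by blast
        have "p \<in> set (bounds 8)" using p(1) True by simp
        then have "sum_ok 9 p q" using sums_9 q(1) unfolding list_all_iff by blast
        then show ?thesis using settledI_sum[OF mgf p(2) q(2)] True by blast
      qed
    next
      case False
      then have n': "n \<in> set [7, 11]" using True by auto
      obtain q where q: "q \<in> set (all_bounds (n - 2))" "bounded_by H q" using H by blast
      have "sum_ok n p q" using sums_special n' p(1) q(1) unfolding list_all_iff by blast
      then show ?thesis using settledI_sum[OF mgf p(2) q(2)] by blast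
    qed
  qed
qed

lemma settled_7_cases:
  "settled 7 W H \<Longrightarrow> (\<exists>q\<in>set (bounds 7). bounded_by H q) \<or> giso W H {..<7} (esets (extremal 7))"
  by (auto simp: settled_def extremals_def)

lemma extremal_edges: "5 \<le> n \<Longrightarrow> n \<le> 13 \<Longrightarrow> simple_edges n (extremal n) \<and> distinct_edges (extremal n)"
  by (rule extremals_ok) (auto simp: extremals_def)

text \<open>For orders 5 and 6 the graph without both ends of the pendant edge has at most four vertices,
  and the complete graph bounds it; otherwise it is contained in a tricyclic graph
  \<open>H\<close>. If \<open>n = 9\<close> and \<open>H\<close> is extremal, then two cases
  remain: the graph without \<open>u\<close> and \<open>v\<close> is \<open>H\<close>, so that the
  whole graph is \<open>H\<close> with a pendant path of two edges, or it misses an edge of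
  \<open>H\<close>.\<close>

lemma settled_leaf:
  fixes V :: "'a set"
  assumes n: "5 \<le> n" "n \<le> 13" and G: "tric V E" "card V = n" and leaf: "v \<in> V" "nbrs E v = {u}"
    and IH: "\<And>m (W :: 'a set) F. m < n \<Longrightarrow> 3 \<le> m \<Longrightarrow> tric W F \<Longrightarrow> card W = m \<Longrightarrow> settled m W F"
  shows "settled n V E"
proof -
  have sg: "sgraph V E" and cE: "card E = card V + 2" using G(1) by (auto simp: tric_def)
  note fin = sgraphD(1,2)[OF sg]
  let ?F = "E - {{v, u}}" and ?W = "V - {v}" and ?A = "avoid E {v, u}" and ?X = "V - {v, u}"
  have e: "{v, u} \<in> E" using leaf(2) by (auto simp: nbrs_def)
  then have u: "u \<in> V" "u \<noteq> v" using sgraphD(3)[OF sg] by blast+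
  note F = leaf_removal[OF G(1) leaf]
  have cW: "card ?W = n - 1" using G(2) leaf(1) fin by simp
  have cX: "card ?X = n - 2" using G(2) leaf(1) u fin by (simp add: card_Diff_subset)
  have m: "n - 1 < n" "3 \<le> n - 1" "n - 2 < n" "3 \<le> n - 2" using n by linarith+
  have sF: "settled (n - 1) ?W ?F" using IH[OF m(1,2) F(1) cW] .
  have sgF: "sgraph ?W ?F" using F(1) by (simp add: tric_def)
  have sgA: "sgraph ?X ?A"
    using sg by (auto simp: sgraph_def avoid_def disjnt_def)
  have VW: "insert v ?W = V" "insert v (insert u ?X) = V" using leaf(1) u by auto
  have A: "\<exists>q\<in>set (all_bounds (n - 2)). bounded_by ?A q"
  proof (cases "n \<le> 6")
    case True
    then have "settled (n - 2) ?X ?A" using n by (intro settled_small[OF sgA cX]) auto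
    then show ?thesis using settled_bounded[OF _ sgA] n by auto
  next
    case False
    then obtain H where H: "?A \<subseteq> H" "tric ?X H"
      using leaf_contraction[OF G(1) leaf] G(2) by auto
    then have sH: "sgraph ?X H" by (simp add: tric_def)
    have "settled (n - 2) ?X H" using IH[OF m(3,4) H(2) cX] .
    then obtain q where "q \<in> set (all_bounds (n - 2))" "bounded_by H q"
      using settled_bounded[OF _ sH diff_le_self[THEN order_trans, OF n(2)]] by blast
    then show ?thesis using bounded_by_subset[OF _ H(1)] sgraphD(2)[OF sH] by blast
  qed
  show ?thesis
  proof (rule settled_combine[OF n F(2) sF sgF A])
    assume n': "n \<in> {7, 9, 11}" and iso: "giso ?W ?F {..<n - 1} (esets (extremal (n - 1)))"
    obtain i where i: "i < n - 1" "giso (insert v ?W) (insert {v, u} ?F) {..<Suc (n - 1)} (esets ((n - 1, i) # extremal (n - 1)))"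
      using pendant_giso[OF iso sgF, of u v] u by auto
    have "Suc (n - 1) = n" "insert {v, u} ?F = E" using n e by auto
    then have iso': "giso V E {..<n} (esets ((n - 1, i) # extremal (n - 1)))"
      using i(2) VW by metis
    have "n - 1 \<in> set [6, 8, 10]" "i \<in> set [0..<n - 1]" using n' i(1) by auto
    then have "settled_edges (Suc (n - 1)) ((n - 1, i) # extremal (n - 1))"
      using extensions_settled unfolding list_all_iff by blast
    then show "settled n V E" using settled_edges[OF _ iso' sg] \<open>Suc (n - 1) = n\<close> by simp
  next
    assume n9: "n = 9"
    obtain H where H: "?A \<subseteq> H" "tric ?X H"
      using leaf_contraction[OF G(1) leaf] G(2) n9 by auto
    then have sH: "sgraph ?X H" and cH: "card H = 9" using cX n9 by (auto simp: tric_def)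
    have finH: "finite H" using sgraphD(2)[OF sH] .
    have "settled 7 ?X H" using IH[of 7] H(2) cX n9 by simp
    then consider q where "q \<in> set (bounds 7)" "bounded_by H q" | "giso ?X H {..<7} (esets (extremal 7))"
      using settled_7_cases by blast
    then show "settled n V E \<or> (\<exists>q\<in>set ([1,8,21,12] # bounds 7). bounded_by ?A q)"
    proof cases
      case 1
      then show ?thesis using bounded_by_subset[OF 1(2) H(1) finH] by auto
    next
      case iso: 2
      show ?thesis
      proof (cases "?A = H")
        case True
        have lt: "?A \<subset> E - {{v, u}}"
        proof -
          \<comment> \<open>A tricyclic graph of order 9 has 11 edges, H has only 9; so u has a second edge.\<close>
          have "card (E - {{v, u}}) = 10" using cE G(2) n9 e fin by simp
          moreover have "card ?A = 9" using cH unfolding True .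
          ultimately have "?A \<noteq> E - {{v, u}}" by fastforce
          moreover have "?A \<subseteq> E - {{v, u}}" by (auto simp: avoid_def)
          ultimately show ?thesis by blast
        qed
        from psubset_imp_ex_mem[OF lt] obtain e' where "e' \<in> E - {{v, u}} - ?A" ..
        then have e': "e' \<in> E" "e' \<noteq> {v, u}" "e' \<notin> ?A" by simp_all
        have v: "v \<notin> e'" using mem_edge_nb[OF sg e'(1), of v] leaf(2) e'(2) by (metis singletonD)
        have "\<not> disjnt e' {v, u}" using e'(1,3) by (simp add: avoid_def)
        then have ue: "u \<in> e'" using v by (auto simp: disjnt_def)
        then obtain w where w: "e' = {u, w}" using mem_edge_nb[OF sg e'(1)] by blast
        have "w \<in> V" "w \<noteq> u" using sgraphD(3)[OF sg, of u w] e'(1) w by blast+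
        then have w': "w \<in> ?X" using v w by blast
        have "insert {v, u} (insert {u, w} ?A) = E"
        proof (rule card_subset_eq)
          show "insert {v, u} (insert {u, w} ?A) \<subseteq> E" using e e' w avoid_subset[of E] by auto
          have "{v, u} \<notin> insert {u, w} ?A" "{u, w} \<notin> ?A"
            using e' w by (auto simp: avoid_def)
          then show "card (insert {v, u} (insert {u, w} ?A)) = card E"
            using cH True cE G(2) n9 finH by simp
        qed (use fin in auto)
        moreover obtain i where i: "i < 7" "giso (insert v (insert u ?X)) (insert {v, u} (insert {u, w} H))
            {..<Suc (Suc 7)} (esets ((Suc 7, 7) # (7, i) # extremal 7))"
          using pendant2_giso[OF iso sH w', of v u] u by auto
        ultimately have "giso V E {..<9} (esets ((8, 7) # (7, i) # extremal 7))"
          using True VW(2) by simp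
        moreover have "i \<in> set [0..<7]" using i(1) by simp
        then have "settled_edges 9 ((8, 7) # (7, i) # extremal 7)"
          using extensions2_settled unfolding list_all_iff by blast
        ultimately show ?thesis using settled_edges sg n9 by blast
      next
        case False
        then obtain d where d: "d \<in> H" "d \<notin> ?A" using H(1) by blast
        obtain a b where ab: "d = {a, b}" using sgraphD(4)[OF sH d(1)] by blast
        obtain f where f: "bij_betw f ?X {..<7}" "esets (extremal 7) = (`) f ` H"
          using iso by (auto simp: giso_def)
        have "f ` {a, b} \<in> esets (extremal 7)" using f(2) d(1) ab by blast
        then obtain i j where ij: "(i, j) \<in> set (extremal 7)" "{i, j} = {f a, f b}" by (auto simp: esets_def)
        have di: "distinct_edges (extremal 7)" using extremal_edges[of 7] by simp
        have "(`) f ` (H - {{a, b}}) = esets (remove_edge (i, j) (extremal 7))"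
          using giso_Diff[OF f sH, of a b] d(1) ab esets_remove[OF di ij(1)] ij(2) by simp
        then have "giso ?X (H - {d}) {..<7} (esets (remove_edge (i, j) (extremal 7)))"
          using f(1) ab unfolding giso_def by metis
        moreover have "sgraph ?X (H - {d})" using sH by (auto simp: sgraph_def)
        moreover have "distinct_edges (remove_edge (i, j) (extremal 7))"
          using di by (simp add: remove_edge_def distinct_edges_filter)
        ultimately have "mgf (H - {d}) y = peval (matching_coeffs (remove_edge (i, j) (extremal 7))) y" for y
          using giso_mgf mgf_esets by metis
        moreover have "ple (matching_coeffs (remove_edge (i, j) (extremal 7))) [1,8,21,12]"
          using remove_edge_bound ij(1) unfolding list_all_iff by blast
        ultimately have "bounded_by (H - {d}) [1,8,21,12]"
          unfolding bounded_by_def using peval_mono by metis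
        then have "bounded_by ?A [1,8,21,12]"
          using H(1) d(2) finH by (elim bounded_by_subset) auto
        then show ?thesis by simp
      qed
    qed
  qed
qed

text \<open>If the graph of order \<open>n - 1\<close> is extremal, the original graph is a subdivision of
  it; if \<open>n = 9\<close> and the graph of order 7 is extremal, it is a double subdivision of
  that one.\<close>

lemma settled_thread:
  fixes V :: "'a set"
  assumes n: "5 \<le> n" "n \<le> 13" and G: "thread V E p x y r" "card V = n"
    and IH: "\<And>m (W :: 'a set) F. m < n \<Longrightarrow> 3 \<le> m \<Longrightarrow> tric W F \<Longrightarrow> card W = m \<Longrightarrow> settled m W F"
  shows "settled n V E"
proof -
  note card_V = G(2)
  interpret thread V E p x y r by (rule G(1))
  have sg1: "sgraph (V - {y}) E1" and sg2: "sgraph (V - {x, y}) E2" and sg: "sgraph V E"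
    using tric1 tric2 tric by (auto simp: tric_def)
  have c1: "card (V - {y}) = n - 1" using card_V in_V G(4) by simp
  have c2: "card (V - {x, y}) = n - 2" using card_V in_V neq G(4) by (simp add: card_Diff_subset)
  have m: "n - 1 < n" "3 \<le> n - 1" "n - 2 < n" "3 \<le> n - 2" using n by linarith+
  have s1: "settled (n - 1) (V - {y}) E1" using IH[OF m(1,2) tric1 c1] .
  have s2: "settled (n - 2) (V - {x, y}) E2" using IH[OF m(3,4) tric2 c2] .
  have H: "\<exists>q\<in>set (all_bounds (n - 2)). bounded_by E2 q" using settled_bounded[OF s2 sg2] n by auto
  have xr: "{x, r} \<notin> R" "{p, r} \<notin> R" "{p, x} \<noteq> {x, r}"
    using R_fresh R_props pr by (auto simp: doubleton_eq_iff)
  show ?thesis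
  proof (rule settled_combine[OF n mgf_eq s1 sg1 H])
    assume n': "n \<in> {7, 9, 11}" and iso: "giso (V - {y}) E1 {..<n - 1} (esets (extremal (n - 1)))"
    have "distinct_edges (extremal (n - 1))" using extremal_edges[of "n - 1"] n' by auto
    then obtain i j where ij: "(i, j) \<in> set (extremal (n - 1))"
      "giso (insert y (V - {y})) (insert {x, y} (insert {y, r} (E1 - {{x, r}})))
        {..<Suc (n - 1)} (esets ((i, n - 1) # (n - 1, j) # remove_edge (i, j) (extremal (n - 1))))"
      using subdivide_giso[OF iso sg1, of x r y] by (auto simp: E1_def)
    have "insert {x, y} (insert {y, r} (E1 - {{x, r}})) = insert {p, x} (insert {x, y} (insert {y, r} R))"
      using xr by (auto simp: E1_def)
    then have E: "insert {x, y} (insert {y, r} (E1 - {{x, r}})) = E" using E_eq by simp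
    have "insert y (V - {y}) = V" "Suc (n - 1) = n" using in_V n by auto
    with E ij(2) have iso': "giso V E {..<n} (esets ((i, n - 1) # (n - 1, j) # remove_edge (i, j) (extremal (n - 1))))"
      by simp
    have "n - 1 \<in> set [6, 8, 10]" using n' by auto
    then have "settled_edges (Suc (n - 1)) ((i, n - 1) # (n - 1, j) # remove_edge (i, j) (extremal (n - 1)))"
      using extensions_settled ij(1) unfolding list_all_iff by blast
    then show "settled n V E" using settled_edges[OF _ iso' sg] \<open>Suc (n - 1) = n\<close> by simp
  next
    assume n9: "n = 9"
    consider q where "q \<in> set (bounds 7)" "bounded_by E2 q" | "giso (V - {x, y}) E2 {..<7} (esets (extremal 7))"
      using settled_7_cases s2 n9 by auto
    then show "settled n V E \<or> (\<exists>q\<in>set ([1,8,21,12] # bounds 7). bounded_by E2 q)"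
    proof cases
      case 2
      have "distinct_edges (extremal 7)" using extremal_edges[of 7] by simp
      then obtain i j where ij: "(i, j) \<in> set (extremal 7)"
        "giso (insert x (insert y (V - {x, y}))) (insert {p, x} (insert {x, y} (insert {y, r} (E2 - {{p, r}}))))
          {..<Suc (Suc 7)} (esets ((i, 7) # (7, Suc 7) # (Suc 7, j) # remove_edge (i, j) (extremal 7)))"
        using subdivide2_giso[OF 2 sg2, of p r x y] neq by (auto simp: E2_def)
      have "E2 - {{p, r}} = R" using xr by (auto simp: E2_def)
      then have E: "insert {p, x} (insert {x, y} (insert {y, r} (E2 - {{p, r}}))) = E" using E_eq by simp
      have "insert x (insert y (V - {x, y})) = V" using in_V by auto
      with E ij(2) have iso': "giso V E {..<9} (esets ((i, 7) # (7, 8) # (8, j) # remove_edge (i, j) (extremal 7)))"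
        by simp
      have "settled_edges 9 ((i, 7) # (7, 8) # (8, j) # remove_edge (i, j) (extremal 7))"
        using extensions2_settled ij(1) unfolding list_all_iff by blast
      then show ?thesis using settled_edges[OF _ iso' sg] n9 by simp
    qed auto
  qed
qed

theorem settled:
  fixes V :: "'a set"
  assumes "tric V E" "card V = n" "3 \<le> n" "n \<le> 13"
  shows "settled n V E"
  using assms
proof (induction n arbitrary: V E rule: less_induct)
  case (less n)
  have sg: "sgraph V E" using less.prems(1) by (simp add: tric_def)
  have IH: "settled m W F" if "m < n" "3 \<le> m" "tric W F" "card W = m" for m and W :: "'a set" and F
    using less.IH[OF that(1,3,4,2)] less.prems(4) that(1) by simp
  show ?case
  proof (cases "n \<le> 4")
    case True
    then show ?thesis using settled_small[OF sg less.prems(2)] less.prems(3) by linarith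
  next
    case False
    then have n: "5 \<le> n" by simp
    consider v u where "v \<in> V" "nbrs E v = {u}" | p x y r where "thread V E p x y r"
      | "irreducible V E"
    proof -
      assume a: thesis if "v \<in> V" "nbrs E v = {u}" for v u
      assume b: thesis if "thread V E p x y r" for p x y r
      assume c: thesis if "irreducible V E"
      show thesis
      proof (cases "(\<exists>v u. v \<in> V \<and> nbrs E v = {u}) \<or> (\<exists>p x y r. thread V E p x y r)")
        case False
        have "irreducible V E"
        proof
          show "tric V E" by fact
          show "4 \<le> card V" using n less.prems(2) by simp
          show "nbrs E v \<noteq> {u}" if "v \<in> V" for v u using that False by blast
          show "{p, r} \<in> E" if "nbrs E x = {p, y}" "nbrs E y = {x, r}" "p \<noteq> r" for x y p r
            using False that less.prems(1) unfolding thread_def by blast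
        qed
        then show thesis by (rule c)
      qed (use a b in blast)
    qed
    then show ?thesis
    proof cases
      case 1
      then show ?thesis using settled_leaf[OF n less.prems(4,1,2)] IH by blast
    next
      case 2
      then show ?thesis using settled_thread[OF n less.prems(4) _ less.prems(2)] IH by blast
    next
      case 3
      have "(\<exists>p\<in>set (bounds n). bounded_by E p) \<or> giso V E {..<n} (esets (extremal n))"
        using irreducible.classification[OF 3] less.prems(2,4) by simp
      then show ?thesis using n by (auto simp: settled_def extremals_def)
    qed
  qed
qed

section \<open>Comparing the energies\<close>

lemma peval_strict_mono:
  "ple p q \<Longrightarrow> length p = length q \<Longrightarrow> p \<noteq> q \<Longrightarrow> 0 < y \<Longrightarrow> peval p y < peval q y"
proof (induction p q rule: ple.induct)
  case (3 a p b q)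
  show ?case
  proof (cases "p = q")
    case False
    then have "y * peval p y < y * peval q y" using 3 by simp
    then show ?thesis using 3 by (simp add: add_le_less_mono)
  qed (use 3 in auto)
qed auto

text \<open>The product \<open>\<Prod> (1 + (u / 10000)^2 y)\<close>, multiplied by \<open>10^8\<close> for
  every factor to keep the coefficients integral.\<close>

fun scaled_prod :: "int list \<Rightarrow> int list" where
  "scaled_prod [] = [1]"
| "scaled_prod (u # us) = (let p = scaled_prod us in padd (map ((*) 100000000) p) (0 # map ((*) (u * u)) p))"

lemma peval_scale: "peval (map ((*) c) p) y = of_int c * peval p y"
  by (induction p) (auto simp: algebra_simps)

lemma peval_scaled_prod:
  "peval (scaled_prod us) y = 100000000 ^ length us * (\<Prod>u\<leftarrow>map (\<lambda>u. of_int u / 10000) us. 1 + u\<^sup>2 * y)"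
  by (induction us) (auto simp: Let_def peval_scale field_simps power2_eq_square)

definition below :: "int list \<Rightarrow> int list \<Rightarrow> bool" where
  "below p us \<longleftrightarrow> ple (map ((*) (100000000 ^ length us)) p) (scaled_prod us)"

definition above :: "int list \<Rightarrow> int list \<Rightarrow> bool" where
  "above p us \<longleftrightarrow> ple (scaled_prod us) (map ((*) (100000000 ^ length us)) p)"

lemma below: "below p us \<Longrightarrow> 0 \<le> y \<Longrightarrow> peval p y \<le> (\<Prod>u\<leftarrow>map (\<lambda>u. of_int u / 10000) us. 1 + u\<^sup>2 * y)"
  using peval_mono[of "map ((*) (100000000 ^ length us)) p" "scaled_prod us" y]
  by (simp add: below_def peval_scale peval_scaled_prod)

lemma above: "above p us \<Longrightarrow> 0 \<le> y \<Longrightarrow> (\<Prod>u\<leftarrow>map (\<lambda>u. of_int u / 10000) us. 1 + u\<^sup>2 * y) \<le> peval p y"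
  using peval_mono[of "scaled_prod us" "map ((*) (100000000 ^ length us)) p" y]
  by (simp add: above_def peval_scale peval_scaled_prod)

text \<open>For each bound that is not dominated by the extremal graph, a list of numbers \<open>u\<close>
  whose product exceeds the bound, and for the extremal graph a list whose product stays below.
  They are the square roots of the inverse negated zeros of the polynomials, multiplied by 10000
  and rounded up or down.\<close>

definition root_bounds :: "nat \<Rightarrow> int list list \<times> int list" where
  "root_bounds n =
    (if n = 10 then ([[23839,18067,14481,8916,4022]], [23523,19118,13589,8662,4626])
     else if n = 11 then ([[23842,18407,15534,10522,6390]], [23503,19473,14858,9999,6896])
     else if n = 12 then ([[23840,18752,16055,12424,7347,3740]], [23456,19736,16105,10814,8061,4350])
     else if n = 13 then ([[23836,19085,16181,14143,8226,6181], [23293,20448,16181,12362,9304,6181]],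
        [23582,18477,18477,11993,7653,7653])
     else ([], []))"

lemma bounds_beaten:
  "list_all (\<lambda>n. let e = matching_coeffs (extremal n); (uss, ls) = root_bounds n in
     list_all (\<lambda>p. (ple p e \<and> length p = length e \<and> p \<noteq> e) \<or>
       list_ex (\<lambda>us. below p us \<and> above e ls \<and> list_all (\<lambda>u. 0 \<le> u) (us @ ls) \<and> sum_list us < sum_list ls) uss) (bounds n))
   [5,6,7,8,9,10,11,12,13]"
  by code_simp

lemma sum_list_scaled:
  "list_all (\<lambda>u. 0 \<le> u) us \<Longrightarrow> (\<Sum>u\<leftarrow>map (\<lambda>u. of_int u / 10000) us. \<bar>u\<bar>) = (of_int (sum_list us) / 10000 :: real)"
  by (induction us) (auto simp: add_divide_distrib)

text \<open>If the bound is dominated coefficientwise, the energies compare by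
  \<open>matching_energy_less\<close>. Otherwise they are separated by the sums of the two lists
  in \<open>root_bounds\<close>.\<close>

lemma energy_less:
  assumes G: "simple_graph G" and H: "simple_graph H" "edges H = esets (extremal n)"
    and n: "5 \<le> n" "n \<le> 13" and p: "p \<in> set (bounds n)" "bounded_by (edges G) p"
  shows "matching_energy G < matching_energy H"
proof -
  let ?e = "matching_coeffs (extremal n)"
  obtain uss ls where r: "root_bounds n = (uss, ls)" by fastforce
  have mH: "mgf (edges H) y = peval ?e y" for y
    using extremal_edges[OF n] mgf_esets H(2) by simp
  have mG: "mgf (edges G) y \<le> peval p y" if "0 < y" for y
    using p(2) that by (simp add: bounded_by_def)
  have "n \<in> set [5,6,7,8,9,10,11,12,13]" using n by auto
  from bspec[OF bounds_beaten[unfolded list_all_iff] this]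
  have "\<forall>p\<in>set (bounds n). (ple p ?e \<and> length p = length ?e \<and> p \<noteq> ?e) \<or>
       list_ex (\<lambda>us. below p us \<and> above ?e ls \<and> (\<forall>u\<in>set (us @ ls). 0 \<le> u) \<and> sum_list us < sum_list ls) uss"
    by (simp only: Let_def r prod.case)
  then consider "ple p ?e" "length p = length ?e" "p \<noteq> ?e"
    | us where "below p us" "above ?e ls" "list_all (\<lambda>u. 0 \<le> u) (us @ ls)" "sum_list us < sum_list ls"
    using p(1) unfolding list_all_iff list_ex_iff by blast
  then show ?thesis
  proof cases
    case 1
    then show ?thesis
      using peval_strict_mono mG mH by (intro matching_energy_less G H(1)) (metis order_le_less_trans)
  next
    case 2
    let ?s = "map (\<lambda>u. of_int u / 10000 :: real)"
    have "matching_energy G \<le> 2 * (\<Sum>u\<leftarrow>?s us. \<bar>u\<bar>)"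
      using mG below[OF 2(1)] by (intro matching_energy_le_of_prod G) (meson less_imp_le order_trans)
    also have "\<dots> < 2 * (\<Sum>u\<leftarrow>?s ls. \<bar>u\<bar>)"
      using 2(3,4) by (simp add: sum_list_scaled list_all_append del: map_map)
    also have "\<dots> \<le> matching_energy H"
      using above[OF 2(2)] mH by (intro matching_energy_ge_of_prod H(1)) (simp add: less_imp_le)
    finally show ?thesis .
  qed
qed

lemma matching_energy_giso:
  assumes "simple_graph G" "simple_graph H" "giso (verts G) (edges G) (verts H) (edges H)"
  shows "matching_energy G = matching_energy H"
proof -
  have "sgraph (verts G) (edges G)" using assms(1) by (simp add: simple_graph_def sgraph_def)
  then have "mgf (edges H) y = (mgf (edges G) y :: real)" for y using giso_mgf assms(3) by blast
  then show ?thesis by (intro matching_energy_cong assms) simp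
qed

lemma simple_graph_esets:
  "simple_edges n es \<Longrightarrow> verts H = {..<n} \<Longrightarrow> edges H = esets es \<Longrightarrow> simple_graph H"
  using sgraph_esets[of n es] by (simp add: simple_graph_def sgraph_def)

lemma energy_cases:
  assumes "5 \<le> n" "n \<le> 13" "tricyclic G" "card (verts G) = n" "verts H = {..<n}" "edges H = esets (extremal n)"
  shows "matching_energy G < matching_energy H \<or> (\<exists>es\<in>set (extremals n). giso (verts G) (edges G) {..<n} (esets es))"
proof -
  have "simple_graph G" using assms(3) by (simp add: tricyclic_def)
  moreover have "simple_graph H" using simple_graph_esets extremal_edges assms(1,2,5,6) by metis
  moreover have "settled n (verts G) (edges G)"
    using settled[of "verts G" "edges G" n] assms by (simp add: tricyclic_iff)
  ultimately show ?thesis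
    using energy_less assms(1,2,6) unfolding settled_def by blast
qed

lemma unique_maximum:
  assumes "5 \<le> n" "n \<le> 13" "n \<noteq> 9" "tricyclic G" "card (verts G) = n" "verts H = {..<n}" "edges H = esets (extremal n)"
  shows "matching_energy G \<le> matching_energy H \<and> (matching_energy G = matching_energy H \<longleftrightarrow> G \<cong>\<^sub>G H)"
proof -
  have G: "simple_graph G" using assms(4) by (simp add: tricyclic_def)
  have H: "simple_graph H" using simple_graph_esets extremal_edges assms(1,2,6,7) by metis
  have "matching_energy G < matching_energy H \<or> giso (verts G) (edges G) (verts H) (edges H)"
    using energy_cases[OF assms(1,2,4-7)] assms(3,6,7) by (auto simp: extremals_def split: if_splits)
  then show ?thesis
    using matching_energy_giso[OF G H] graph_iso_iff_giso[OF G H] by auto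
qed

lemma edges_of_extremal_graphs:
  "edges G5 = esets (extremal 5)" "edges G6 = esets (extremal 6)" "edges G7 = esets (extremal 7)"
  "edges G8 = esets (extremal 8)" "edges G9_1 = esets (extremal 9)" "edges G9_2 = esets extremal9'"
  "edges G10_2 = esets (extremal 10)" "edges G11_2 = esets (extremal 11)"
  "edges G12_2 = esets (extremal 12)" "edges G13_2 = esets (extremal 13)"
proof -
  have bip: "complete_bipartite_edges A B = (\<Union>a\<in>A. \<Union>b\<in>B. {{a, b}})" for A B :: "nat set"
    by (auto simp: complete_bipartite_edges_def)
  have K4: "complete_edges {0, 1, 2, 3 :: nat} = {{0, 1}, {0, 2}, {0, 3}, {1, 2}, {1, 3}, {2, 3}}"
  proof (intro equalityI subsetI)
    fix e assume "e \<in> complete_edges {0, 1, 2, 3 :: nat}"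
    then obtain a b where "e = {a, b}" "a \<noteq> b" "a \<in> {0, 1, 2, 3}" "b \<in> {0, 1, 2, 3}"
      by (auto simp: complete_edges_def card_2_iff)
    then show "e \<in> {{0, 1}, {0, 2}, {0, 3}, {1, 2}, {1, 3}, {2, 3}}"
      by (elim insertE emptyE) (simp_all add: insert_commute)
  qed (auto simp: complete_edges_def)
  show "edges G5 = esets (extremal 5)"
  proof -
    have "complete_edges {0, 1, 2, 3 :: nat} - {{0, 1}} = {{0, 2}, {0, 3}, {1, 2}, {1, 3}, {2, 3}}"
      unfolding K4 by (simp add: insert_Diff_if doubleton_eq_iff)
    then show ?thesis by (simp add: G5_def esets_def extremal_def) (simp only: insert_commute)
  qed
  show "edges G6 = esets (extremal 6)" "edges G7 = esets (extremal 7)" "edges G9_2 = esets extremal9'"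
    by (auto simp: G6_def G7_def G9_2_def bip esets_def extremal_def extremal9'_def doubleton_eq_iff insert_commute)
  show "edges G8 = esets (extremal 8)" "edges G9_1 = esets (extremal 9)"
    "edges G10_2 = esets (extremal 10)" "edges G11_2 = esets (extremal 11)"
    "edges G12_2 = esets (extremal 12)" "edges G13_2 = esets (extremal 13)"
    by (auto simp: G8_def G9_1_def G10_2_def G11_2_def G12_2_def G13_2_def ladder_edges_def cycle_edges_def
        esets_def extremal_def insert_commute)
qed

lemma verts_of_extremal_graphs:
  "verts G5 = {..<5}" "verts G6 = {..<6}" "verts G7 = {..<7}" "verts G8 = {..<8}"
  "verts G9_1 = {..<9}" "verts G9_2 = {..<9}" "verts G10_2 = {..<10}" "verts G11_2 = {..<11}"
  "verts G12_2 = {..<12}" "verts G13_2 = {..<13}"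
  by (simp_all add: G5_def G6_def G7_def G8_def G9_1_def G9_2_def G10_2_def G11_2_def G12_2_def G13_2_def)

text \<open>The two extremal graphs have the same matching numbers, hence the same energy.\<close>

lemma two_maxima_of_order_9:
  assumes "tricyclic G" "card (verts G) = 9"
  shows "matching_energy G \<le> matching_energy G9_1 \<and>
     matching_energy G9_1 = matching_energy G9_2 \<and>
     (matching_energy G = matching_energy G9_1 \<longleftrightarrow> G \<cong>\<^sub>G G9_1 \<or> G \<cong>\<^sub>G G9_2)"
proof -
  have G: "simple_graph G" using assms by (simp add: tricyclic_def)
  have V: "verts G9_1 = {..<9}" "verts G9_2 = {..<9}" by (simp_all add: G9_1_def G9_2_def)
  have es: "simple_edges 9 (extremal 9)" "distinct_edges (extremal 9)" "simple_edges 9 extremal9'" "distinct_edges extremal9'"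
    using extremals_ok[of _ 9] by (simp_all add: extremals_def)
  have H: "simple_graph G9_1" "simple_graph G9_2"
    using simple_graph_esets es V edges_of_extremal_graphs(5,6) by metis+
  have "matching_coeffs (extremal 9) = matching_coeffs extremal9'" by code_simp
  then have "mgf (edges G9_1) y = (mgf (edges G9_2) y :: real)" for y
    using es by (simp add: edges_of_extremal_graphs mgf_esets)
  then have eq: "matching_energy G9_1 = matching_energy G9_2"
    by (intro matching_energy_cong H)
  have "matching_energy G < matching_energy G9_1 \<or> giso (verts G) (edges G) (verts G9_1) (edges G9_1)
     \<or> giso (verts G) (edges G) (verts G9_2) (edges G9_2)"
    using energy_cases[of 9 G G9_1] assms V by (auto simp: extremals_def edges_of_extremal_graphs)
  then show ?thesis
    using matching_energy_giso[OF G H(1)] matching_energy_giso[OF G H(2)]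
      graph_iso_iff_giso[OF G H(1)] graph_iso_iff_giso[OF G H(2)] eq by auto
qed

theorem theorem2p5:
  fixes G :: "'a ugraph" and n :: nat
  assumes "5 \<le> n" and "n \<le> 13"
    and "tricyclic G" and "card (verts G) = n"
  shows
    "(n = 5 \<longrightarrow> matching_energy G \<le> matching_energy G5 \<and>
        (matching_energy G = matching_energy G5 \<longleftrightarrow> G \<cong>\<^sub>G G5)) \<and>
     (n = 6 \<longrightarrow> matching_energy G \<le> matching_energy G6 \<and>
        (matching_energy G = matching_energy G6 \<longleftrightarrow> G \<cong>\<^sub>G G6)) \<and>
     (n = 7 \<longrightarrow> matching_energy G \<le> matching_energy G7 \<and>
        (matching_energy G = matching_energy G7 \<longleftrightarrow> G \<cong>\<^sub>G G7)) \<and>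
     (n = 8 \<longrightarrow> matching_energy G \<le> matching_energy G8 \<and>
        (matching_energy G = matching_energy G8 \<longleftrightarrow> G \<cong>\<^sub>G G8)) \<and>
     (n = 9 \<longrightarrow> matching_energy G \<le> matching_energy G9_1 \<and>
        matching_energy G9_1 = matching_energy G9_2 \<and>
        (matching_energy G = matching_energy G9_1 \<longleftrightarrow> G \<cong>\<^sub>G G9_1 \<or> G \<cong>\<^sub>G G9_2)) \<and>
     (n = 10 \<longrightarrow> matching_energy G \<le> matching_energy G10_2 \<and>
        (matching_energy G = matching_energy G10_2 \<longleftrightarrow> G \<cong>\<^sub>G G10_2)) \<and>
     (n = 11 \<longrightarrow> matching_energy G \<le> matching_energy G11_2 \<and>
        (matching_energy G = matching_energy G11_2 \<longleftrightarrow> G \<cong>\<^sub>G G11_2)) \<and>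
     (n = 12 \<longrightarrow> matching_energy G \<le> matching_energy G12_2 \<and>
        (matching_energy G = matching_energy G12_2 \<longleftrightarrow> G \<cong>\<^sub>G G12_2)) \<and>
     (n = 13 \<longrightarrow> matching_energy G \<le> matching_energy G13_2 \<and>
        (matching_energy G = matching_energy G13_2 \<longleftrightarrow> G \<cong>\<^sub>G G13_2))"
proof -
  note max = unique_maximum[OF assms(1,2) _ assms(3,4)]
  have 5: "matching_energy G \<le> matching_energy G5 \<and>
      (matching_energy G = matching_energy G5 \<longleftrightarrow> G \<cong>\<^sub>G G5)" if "n = 5"
    using that by (intro max) (simp_all add: edges_of_extremal_graphs verts_of_extremal_graphs)
  have 6: "matching_energy G \<le> matching_energy G6 \<and>
      (matching_energy G = matching_energy G6 \<longleftrightarrow> G \<cong>\<^sub>G G6)" if "n = 6"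
    using that by (intro max) (simp_all add: edges_of_extremal_graphs verts_of_extremal_graphs)
  have 7: "matching_energy G \<le> matching_energy G7 \<and>
      (matching_energy G = matching_energy G7 \<longleftrightarrow> G \<cong>\<^sub>G G7)" if "n = 7"
    using that by (intro max) (simp_all add: edges_of_extremal_graphs verts_of_extremal_graphs)
  have 8: "matching_energy G \<le> matching_energy G8 \<and>
      (matching_energy G = matching_energy G8 \<longleftrightarrow> G \<cong>\<^sub>G G8)" if "n = 8"
    using that by (intro max) (simp_all add: edges_of_extremal_graphs verts_of_extremal_graphs)
  have 10: "matching_energy G \<le> matching_energy G10_2 \<and>
      (matching_energy G = matching_energy G10_2 \<longleftrightarrow> G \<cong>\<^sub>G G10_2)" if "n = 10"
    using that by (intro max) (simp_all add: edges_of_extremal_graphs verts_of_extremal_graphs)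
  have 11: "matching_energy G \<le> matching_energy G11_2 \<and>
      (matching_energy G = matching_energy G11_2 \<longleftrightarrow> G \<cong>\<^sub>G G11_2)" if "n = 11"
    using that by (intro max) (simp_all add: edges_of_extremal_graphs verts_of_extremal_graphs)
  have 12: "matching_energy G \<le> matching_energy G12_2 \<and>
      (matching_energy G = matching_energy G12_2 \<longleftrightarrow> G \<cong>\<^sub>G G12_2)" if "n = 12"
    using that by (intro max) (simp_all add: edges_of_extremal_graphs verts_of_extremal_graphs)
  have 13: "matching_energy G \<le> matching_energy G13_2 \<and>
      (matching_energy G = matching_energy G13_2 \<longleftrightarrow> G \<cong>\<^sub>G G13_2)" if "n = 13"
    using that by (intro max) (simp_all add: edges_of_extremal_graphs verts_of_extremal_graphs)
  show ?thesis
    using two_maxima_of_order_9[of G] assms(3,4) 5 6 7 8 10 11 12 13 by metis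
qed

end
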